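(* Let $N\ge 1$ and let $x=(x_1,\ldots,x_N)\in C^\infty(\mathbb{R};\mathbb{R}^N)$ be a solution of the classical rational Calogero--Moser system $$\ddot x_j(t)=\sum_{k\ne j}\frac{8}{(x_j(t)-x_k(t))^3},\qquad 1\le j\le N,\ t\in\mathbb{R}.$$ Then there exist $c\in\mathbb{R}$ and $\varepsilon_0>0$, together with rational multisoliton solutions $q^\varepsilon\in C(\mathbb{R};H^1_+(\mathbb{R}))$, $0<\varepsilon<\varepsilon_0$, of the focusing continuum Calogero--Moser equation $$ i\partial_t q+\partial_x^2 q-2i\,q\,\partial_x\Pi_+\bigl(|q|^2\bigr)=0,$$ such that $$\lim_{\varepsilon\downarrow 0}\ \sup_{t\in\mathbb{R}}\ d_{\mathrm{BL}}\Bigl(|q^\varepsilon(t,x)|^2\,dx,\ 2\pi\sum_{j=1}^N\delta_{x_j(t)-ct}\Bigr)=0.$$ In particular, $|q^\varepsilon(t,x)|^2\to 2\pi\sum_{j=1}^N\delta_{x_j(t)-ct}$ in the sense of distributions as $\varepsilon\downarrow0$, uniformly for $t\in\mathbb{R}$.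
   Context: $\Pi_+$ is the Cauchy--Szeg\H{o} projection onto non-negative wavenumbers (the Fourier multiplier with symbol $\mathbf 1_{[0,\infty)}$); $L^2_+(\mathbb{R})=\Pi_+L^2(\mathbb{R})$ is the Hardy space and $H^1_+(\mathbb{R})=H^1(\mathbb{R})\cap L^2_+(\mathbb{R})$. A solution of the particle system has $x_j(t)\neq x_k(t)$ for $j\ne k$ and all $t$. For finite Borel measures $\mu,\nu$ on $\mathbb{R}$, the bounded-Lipschitz distance is $$d_{\mathrm{BL}}(\mu,\nu)=\sup\Bigl\{\int_{\mathbb{R}}\varphi\,d(\mu-\nu):\ \|\varphi\|_{L^\infty}\le 1,\ \mathrm{Lip}(\varphi)\le 1\Bigr\}.$$ Rational multisolitons (G\'erard--Lenzmann): let $\lambda_1,\ldots,\lambda_N$ be distinct real numbers with $\lambda_m=0$ for some index $m$, let $\rho>0$, $\gamma_1,\ldots,\gamma_N\in\mathbb{R}$ and $\phi\in\mathbb{R}$. Put $\mathcal M(t)=2t\,\mathrm{diag}(\lambda_1,\ldots,\lambda_N)+W$, where $W_{jj}=\gamma_j-i\rho\,\delta_{jm}$ and $W_{jk}=\frac{i}{\lambda_j-\lambda_k}$ for $j\ne k$. The associated rational multisoliton is $$q(t,x)=\sqrt{2\rho}\,e^{i\phi}\,e_m^*(\mathcal M(t)-xI)^{-1}\mathbf 1,$$ where $\mathbf 1=(1,\ldots,1)^T\in\mathbb{C}^N$ and $e_m$ is the $m$th standard basis vector of $\mathbb{C}^N$. It is a known result of G\'erard and Lenzmann that this $q$ belongs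 to $C(\mathbb{R};H^1_+(\mathbb{R}))$ and solves the focusing continuum Calogero--Moser equation, that its poles in $x$ are the eigenvalues of $\mathcal M(t)$, which lie in the open lower half-plane, and that whenever these eigenvalues $\alpha_j(t)-i\beta_j(t)$ ($\beta_j(t)>0$) are simple, $|q(t,x)|^2=\sum_{j=1}^N\frac{2\beta_j(t)}{(x-\alpha_j(t))^2+\beta_j(t)^2}$. *)

theory Defs
  imports "HOL-Analysis.Analysis"
begin

section \<open>Calogero--Moser particle system\<close>

definition smooth :: "(real \<Rightarrow> 'a::real_normed_vector) \<Rightarrow> bool" where
  "smooth f \<longleftrightarrow>
     (\<exists>D :: nat \<Rightarrow> real \<Rightarrow> 'a. D 0 = f \<and>
        (\<forall>k t. (D k has_vector_derivative D (Suc k) t) (at t)))"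

definition calogero_moser_solution :: "(real \<Rightarrow> real ^ 'n) \<Rightarrow> bool" where
  "calogero_moser_solution x \<longleftrightarrow>
     smooth x \<and>
     (\<forall>t j k. j \<noteq> k \<longrightarrow> x t $ j \<noteq> x t $ k) \<and>
     (\<exists>v. \<forall>t. (x has_vector_derivative v t) (at t) \<and>
        (v has_vector_derivative
           (\<chi> j. \<Sum>k\<in>UNIV - {j}. 8 / (x t $ j - x t $ k) ^ 3)) (at t))"


section \<open>Function spaces on the line\<close>

text \<open>
  Elements of \<open>L\<^sup>2\<close> are represented by functions, not by classes modulo null sets. Accordingly,
  operators that are only determined almost everywhere (the Fourier transform on \<open>L\<^sup>2\<close>, the
  Cauchy--Szego projection, weak derivatives) are relations between representatives.
\<close>

definition L2_space :: "(real \<Rightarrow> complex) set" where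
  "L2_space = {f \<in> borel_measurable lborel. integrable lborel (\<lambda>x. (cmod (f x))\<^sup>2)}"

definition L2_tendsto ::
    "('i \<Rightarrow> real \<Rightarrow> complex) \<Rightarrow> (real \<Rightarrow> complex) \<Rightarrow> 'i filter \<Rightarrow> bool" where
  "L2_tendsto F f net \<longleftrightarrow>
     ((\<lambda>i. \<integral>\<^sup>+x. ennreal ((cmod (F i x - f x))\<^sup>2) \<partial>lborel) \<longlongrightarrow> 0) net"

definition fourier_L1 :: "(real \<Rightarrow> complex) \<Rightarrow> real \<Rightarrow> complex" where
  "fourier_L1 f \<xi> = (LINT x|lborel. exp (- \<i> * of_real (x * \<xi>)) * f x)"

text \<open>\<open>g\<close> is the Fourier transform of \<open>f\<close> in \<open>L\<^sup>2\<close>: the extension by continuity of the Fourier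
  integral from \<open>L\<^sup>1 \<inter> L\<^sup>2\<close> (Plancherel).\<close>

definition fourier_L2 :: "(real \<Rightarrow> complex) \<Rightarrow> (real \<Rightarrow> complex) \<Rightarrow> bool" where
  "fourier_L2 f g \<longleftrightarrow>
     f \<in> L2_space \<and> g \<in> L2_space \<and>
     (\<exists>F :: nat \<Rightarrow> real \<Rightarrow> complex.
        (\<forall>n. integrable lborel (F n) \<and> F n \<in> L2_space) \<and>
        L2_tendsto F f sequentially \<and>
        L2_tendsto (\<lambda>n. fourier_L1 (F n)) g sequentially)"

text \<open>\<open>h = \<Pi>\<^sub>+ f\<close> almost everywhere.\<close>

definition szego_projection :: "(real \<Rightarrow> complex) \<Rightarrow> (real \<Rightarrow> complex) \<Rightarrow> bool" where
  "szego_projection f h \<longleftrightarrow>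
     (\<exists>g. fourier_L2 f g \<and> fourier_L2 h (\<lambda>\<xi>. indicator {0..} \<xi> * g \<xi>))"

definition L2_plus :: "(real \<Rightarrow> complex) set" where
  "L2_plus = {h. \<exists>f\<in>L2_space. szego_projection f h}"

definition test_function :: "(real \<Rightarrow> complex) \<Rightarrow> bool" where
  "test_function \<phi> \<longleftrightarrow> smooth \<phi> \<and> compact (closure {x. \<phi> x \<noteq> 0})"

definition weak_L2_derivative :: "(real \<Rightarrow> complex) \<Rightarrow> (real \<Rightarrow> complex) \<Rightarrow> bool" where
  "weak_L2_derivative f g \<longleftrightarrow>
     g \<in> L2_space \<and>
     (\<forall>\<phi>. test_function \<phi> \<longrightarrow>
        (LINT x|lborel. f x * vector_derivative \<phi> (at x)) = - (LINT x|lborel. g x * \<phi> x))"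

definition H1_space :: "(real \<Rightarrow> complex) set" where
  "H1_space = {f \<in> L2_space. \<exists>g. weak_L2_derivative f g}"

definition H1_plus :: "(real \<Rightarrow> complex) set" where
  "H1_plus = H1_space \<inter> L2_plus"

text \<open>\<open>q \<in> C(\<real>; H\<^sup>1\<^sub>+(\<real>))\<close>; continuity in the \<open>H\<^sup>1\<close> norm is continuity of
  both \<open>q\<close> and its weak derivative \<open>p\<close> in the \<open>L\<^sup>2\<close> norm.\<close>

definition continuous_into_H1_plus :: "(real \<Rightarrow> real \<Rightarrow> complex) \<Rightarrow> bool" where
  "continuous_into_H1_plus q \<longleftrightarrow>
     (\<forall>t. q t \<in> H1_plus) \<and>
     (\<exists>p. (\<forall>t. weak_L2_derivative (q t) (p t)) \<and>
          (\<forall>t. L2_tendsto q (q t) (at t) \<and> L2_tendsto p (p t) (at t)))"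


section \<open>The focusing continuum Calogero--Moser equation\<close>

text \<open>
  Classical solutions: all derivatives exist pointwise, and \<open>P t\<close> is the differentiable
  representative of \<open>\<Pi>\<^sub>+ (|q(t)|\<^sup>2)\<close>.
\<close>

definition ccm_solution :: "(real \<Rightarrow> real \<Rightarrow> complex) \<Rightarrow> bool" where
  "ccm_solution q \<longleftrightarrow>
     (\<exists>q\<^sub>t q\<^sub>x q\<^sub>x\<^sub>x P P\<^sub>x.
        (\<forall>t. szego_projection (\<lambda>x. of_real ((cmod (q t x))\<^sup>2)) (P t)) \<and>
        (\<forall>t x.
          ((\<lambda>s. q s x) has_vector_derivative q\<^sub>t t x) (at t) \<and>
          (q t has_vector_derivative q\<^sub>x t x) (at x) \<and>
          (q\<^sub>x t has_vector_derivative q\<^sub>x\<^sub>x t x) (at x) \<and>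
          (P t has_vector_derivative P\<^sub>x t x) (at x) \<and>
          \<i> * q\<^sub>t t x + q\<^sub>x\<^sub>x t x - 2 * \<i> * q t x * P\<^sub>x t x = 0))"


section \<open>Rational multisolitons\<close>

definition multisoliton_W :: "real ^ 'n \<Rightarrow> 'n \<Rightarrow> real \<Rightarrow> real ^ 'n \<Rightarrow> complex ^ 'n ^ 'n" where
  "multisoliton_W l m \<rho> \<gamma> =
     (\<chi> j k. if j = k then of_real (\<gamma> $ j) - \<i> * of_real \<rho> * (if j = m then 1 else 0)
             else \<i> / of_real (l $ j - l $ k))"

definition multisoliton_M ::
    "real ^ 'n \<Rightarrow> 'n \<Rightarrow> real \<Rightarrow> real ^ 'n \<Rightarrow> real \<Rightarrow> complex ^ 'n ^ 'n" where
  "multisoliton_M l m \<rho> \<gamma> t =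
     (\<chi> j k. if j = k then of_real (2 * t * l $ j) else 0) + multisoliton_W l m \<rho> \<gamma>"

definition multisoliton ::
    "real ^ 'n \<Rightarrow> 'n \<Rightarrow> real \<Rightarrow> real ^ 'n \<Rightarrow> real \<Rightarrow> real \<Rightarrow> real \<Rightarrow> complex" where
  "multisoliton l m \<rho> \<gamma> \<phi> t x =
     of_real (sqrt (2 * \<rho>)) * exp (\<i> * of_real \<phi>) *
     (matrix_inv (multisoliton_M l m \<rho> \<gamma> t - mat (of_real x)) *v vec 1) $ m"

definition rational_multisolitons :: "'n::finite itself \<Rightarrow> (real \<Rightarrow> real \<Rightarrow> complex) set" where
  "rational_multisolitons _ =
     {multisoliton l m \<rho> \<gamma> \<phi> | (l :: real ^ 'n) m \<rho> \<gamma> \<phi>.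
        inj (($) l) \<and> l $ m = 0 \<and> \<rho> > 0}"


section \<open>Measures\<close>

text \<open>The supremum is taken in the extended reals; for finite measures it is finite. Since the
  \<open>\<phi>\<close> are continuous, their \<open>L\<^sup>\<infinity>\<close> norm is the supremum norm.\<close>

definition bl_dist :: "real measure \<Rightarrow> real measure \<Rightarrow> ereal" where
  "bl_dist \<mu> \<nu> =
     (SUP \<phi>\<in>{\<phi> :: real \<Rightarrow> real. (\<forall>x. \<bar>\<phi> x\<bar> \<le> 1) \<and> 1-lipschitz_on UNIV \<phi>}.
        ereal ((LINT x|\<mu>. \<phi> x) - (LINT x|\<nu>. \<phi> x)))"

definition density_measure :: "(real \<Rightarrow> complex) \<Rightarrow> real measure" where
  "density_measure f = density lborel (\<lambda>x. ennreal ((cmod (f x))\<^sup>2))"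

text \<open>The measure \<open>2\<pi> \<Sum>\<^sub>j \<delta>\<close>, with \<open>\<delta>\<close> at \<open>y\<^sub>j\<close>; the sum of Dirac masses is the push-forward of
  counting measure on the index set.\<close>

definition dirac_comb :: "real ^ 'n \<Rightarrow> real measure" where
  "dirac_comb y = scale_measure (ennreal (2 * pi)) (distr (count_space UNIV) borel (($) y))"

end

(*
  If x solves the particle system, the Lax pair X' = 2 L + [B, X], L' = [B, L] makes the spectrum
  of X(t) + 2 (s - t) L(t) independent of t, so x(s) is the spectrum of X(0) + 2 s L(0). In an
  eigenbasis of L(0), normalised by the commutator [X, L] = -i (J - 1) with J the all-ones matrix,
  this is the Hermitian matrix 2 s diag(kappa) + W. Subtracting 2 s kappa_m (the Galilean boost
  with c = 2 kappa_m) and adding the rank-one damping -i rho e_m e_m^* gives exactly the matrix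
  M(s) of a rational multisoliton with l = kappa - kappa_m, and epsilon is this damping rho.

  With R the resolvent of M, q is proportional to e_m^* R 1, the Szego projection of |q|^2 is
  -i 1^* R 1, and the equation reduces to an identity obtained from [diag(l), M] = i (J - 1).

  For the limit, put B(x) = sum_j p_j / (y_j - x), where y_j are the eigenvalues of the undamped
  matrix and p_j > 0 the squared m-th components of its unit eigenvectors. Then
  |q|^2 = d/dx 2 arctan (epsilon B(x)), which has mass close to 2 pi near each y_j and little mass
  elsewhere, at a rate that depends only on the gap between particles. The gap is bounded below
  uniformly in time because tr L^2 is conserved.
*)
theory Submission
  imports Defs "HOL-Complex_Analysis.Cauchy_Integral_Theorem"
begin

text \<open>The delicate point is uniformity in time. For large |t| the eigenvectors of the undamped
  matrix approach coordinate vectors, so weights p_j may degenerate to 0 and the bump at y_j may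
  become arbitrarily narrow; no estimate may use a lower bound for p_j. The arctangent form removes
  this danger: across a pole, arctan jumps from pi/2 to -pi/2 whatever the weight, and elsewhere
  only sum p_j = 1 and the gap enter. The comparison is with the real spectrum of the undamped
  matrix, not with the complex poles of q, so collisions among the latter do no harm.

  On the Fourier side, L2 transforms are a relation defined by approximation, so each Hardy-space
  claim is proved by exhibiting a transform. All functions concerned are linear in the resolvent: a
  multiple of 1/(x + i), which is not integrable, plus a quadratically decaying part, for which the
  contour can be shifted.

  The condition lambda_m = 0 decouples row m: it removes the Lambda terms in the equation for q and
  in the density formula, and it excludes real eigenvalues of M.\<close>

unbundle no fps_syntax

section \<open>Fourier transforms of Hardy functions\<close>

lemma
  shows integrable_one_over_one_plus_square: "integrable lborel (\<lambda>x::real. 1 / (1 + x\<^sup>2))"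
    and integral_one_over_one_plus_square: "(LINT x|lborel. 1 / (1 + x\<^sup>2)) = pi"
proof -
  have *: "((arctan \<circ> real_of_ereal) \<longlongrightarrow> - (pi / 2)) (at_right (-\<infinity>))"
      "((arctan \<circ> real_of_ereal) \<longlongrightarrow> pi / 2) (at_left \<infinity>)"
    unfolding ereal_tendsto_simps by (rule tendsto_arctan_at_bot, rule tendsto_arctan_at_top)
  have **: "(arctan has_real_derivative 1 / (1 + x\<^sup>2)) (at x)" "isCont (\<lambda>x. 1 / (1 + x\<^sup>2)) x" for x :: real
    using DERIV_arctan[of x] sum_power2_eq_zero_iff[of 1 x]
    by (auto simp: inverse_eq_divide intro!: continuous_intros)
  have "set_integrable lborel (einterval (-\<infinity>) \<infinity>) (\<lambda>x::real. 1 / (1 + x\<^sup>2))"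
    by (rule interval_integral_FTC_nonneg(1)[OF _ **(1) **(2) _ *]) auto
  then show "integrable lborel (\<lambda>x::real. 1 / (1 + x\<^sup>2))"
    by (simp add: set_integrable_def)
  have "(LBINT x=-\<infinity>..\<infinity>. 1 / (1 + x\<^sup>2)) = pi / 2 - - (pi / 2)"
    by (rule interval_integral_FTC_nonneg(2)[OF _ **(1) **(2) _ *]) auto
  then show "(LINT x|lborel. 1 / (1 + x\<^sup>2)) = pi"
    by (simp add: interval_lebesgue_integral_def set_lebesgue_integral_def)
qed

lemma integrable_quadratic_decay:
  fixes f :: "real \<Rightarrow> complex"
  assumes "continuous_on UNIV f" "\<And>x. cmod (f x) \<le> C / (1 + x\<^sup>2)"
  shows "integrable lborel f"
proof (rule Bochner_Integration.integrable_bound)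
  show "integrable lborel (\<lambda>x. C * (1 / (1 + x\<^sup>2)))"
    by (intro integrable_mult_right integrable_one_over_one_plus_square)
  show "f \<in> borel_measurable lborel"
    using assms(1) borel_measurable_continuous_onI by simp
  show "AE x in lborel. cmod (f x) \<le> norm (C * (1 / (1 + x\<^sup>2)))"
    proof (intro AE_I2)
    fix x :: real
    have "cmod (f x) \<le> C * (1 / (1 + x\<^sup>2))"
      using assms(2)[of x] by simp
    then show "cmod (f x) \<le> norm (C * (1 / (1 + x\<^sup>2)))"
      unfolding real_norm_def by (rule order_trans[OF _ abs_ge_self])
  qed
qed

text \<open>Turns a bound C / (1 + |z|)^2 on a half-plane into the integrable majorant C / (1 + x^2)
  on every horizontal line, with one constant for all heights.\<close>

lemma one_plus_norm_square_ge:
  fixes z :: complex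
  shows "1 + (Re z)\<^sup>2 \<le> (1 + cmod z)\<^sup>2"
proof -
  have "(Re z)\<^sup>2 \<le> (cmod z)\<^sup>2"
    using abs_Re_le_cmod[of z] by (metis abs_le_square_iff abs_norm_cancel)
  then show ?thesis
    unfolding power2_sum by (simp add: add_increasing2)
qed

lemma tendsto_integral_truncation:
  fixes f :: "real \<Rightarrow> complex"
  assumes "integrable lborel f"
  shows "(\<lambda>n. LINT x|lborel. indicator {-real n..real n} x *\<^sub>R f x) \<longlonglongrightarrow> (LINT x|lborel. f x)"
proof (rule integral_dominated_convergence)
  show "integrable lborel (\<lambda>x. cmod (f x))"
    using assms by simp
  show "AE x in lborel. (\<lambda>n. indicator {-real n..real n} x *\<^sub>R f x) \<longlonglongrightarrow> f x"
  proof (intro AE_I2 tendsto_eventually)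
    fix x :: real
    have "\<forall>\<^sub>F n in sequentially. \<bar>x\<bar> \<le> real n"
      by (meson eventually_at_top_linorder of_nat_mono order_trans real_arch_simple)
    then show "\<forall>\<^sub>F n in sequentially. indicator {-real n..real n} x *\<^sub>R f x = f x"
      by eventually_elim (auto simp: indicator_def)
  qed
qed (use assms in \<open>auto simp: indicator_def\<close>)

text \<open>Cauchy's theorem for the rectangle between heights 0 and y over [-n, n]. The exponential
  factor is what the Fourier kernel picks up at height y; the vertical sides are O(1/n^2).\<close>

lemma fourier_L1_shift:
  fixes k :: "complex \<Rightarrow> complex"
  assumes hol: "k holomorphic_on {z. Im z > - \<eta>}" and "0 < \<eta>"
    and bd: "\<And>z. Im z > - \<eta> \<Longrightarrow> cmod (k z) \<le> C / (1 + cmod z)\<^sup>2"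
    and y: "y > - \<eta>"
  shows "fourier_L1 (\<lambda>x. k (of_real x)) \<xi>
           = of_real (exp (y * \<xi>)) * fourier_L1 (\<lambda>x. k (of_real x + \<i> * of_real y)) \<xi>"
proof -
  define S where "S = {z. Im z > - \<eta>}"
  define f where "f z = exp (- \<i> * z * of_real \<xi>) * k z" for z
  have S: "convex S" "open S"
    unfolding S_def by (simp_all add: convex_halfspace_Im_gt open_halfspace_Im_gt)
  have fhol: "f holomorphic_on S"
    unfolding f_def using hol S_def by (auto intro!: holomorphic_intros)
  \<comment> \<open>A primitive on the convex half-plane replaces contour integrals: horizontal
    integrals are differences of \<open>G\<close> at the corners, and the vertical sides are
    increments of \<open>G\<close>.\<close>
  obtain G where "\<And>z. z \<in> S \<Longrightarrow> (G has_field_derivative f z) (at z within S)"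
    using holomorphic_convex_primitive'[OF S fhol] by blast
  then have G: "(G has_field_derivative f z) (at z)" if "z \<in> S" for z
    using that S(2) by (metis at_within_open)
  have C: "0 \<le> C"
    using bd[of 0] \<open>0 < \<eta>\<close> by (simp add: order_trans[OF norm_ge_zero])
  have nexp: "cmod (exp (- \<i> * z * of_real \<xi>)) = exp (Im z * \<xi>)" for z
    by (simp add: norm_exp_eq_Re)
  have int: "integrable lborel (\<lambda>x. f (of_real x + \<i> * of_real s))"
    and FTC: "(LINT x|lborel. indicator {-real n..real n} x *\<^sub>R f (of_real x + \<i> * of_real s))
         = G (of_real n + \<i> * of_real s) - G (- of_real n + \<i> * of_real s)" if s: "s > - \<eta>" for s n
  proof -
    have cont: "continuous_on UNIV (\<lambda>x::real. f (of_real x + \<i> * of_real s))"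
      by (rule continuous_on_compose2[OF holomorphic_on_imp_continuous_on[OF fhol]])
        (auto intro!: continuous_intros simp: S_def s)
    show "integrable lborel (\<lambda>x. f (of_real x + \<i> * of_real s))"
    proof (rule integrable_quadratic_decay[OF cont, where C = "exp (s * \<xi>) * C"])
      fix x :: real
      let ?z = "complex_of_real x + \<i> * of_real s"
      have "cmod (k ?z) \<le> C / (1 + cmod ?z)\<^sup>2"
        using bd[of ?z] s by simp
      also have "\<dots> \<le> C / (1 + x\<^sup>2)"
        using one_plus_norm_square_ge[of ?z] C
        by (intro divide_left_mono mult_pos_pos zero_less_power) (auto intro: add_pos_nonneg)
      finally show "cmod (f ?z) \<le> exp (s * \<xi>) * C / (1 + x\<^sup>2)"
        unfolding f_def norm_mult nexp
        using mult_left_mono[of _ "C / (1 + x\<^sup>2)" "exp (s * \<xi>)"] by simp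
    qed
    have "((\<lambda>x::real. G (of_real x + \<i> * of_real s)) has_vector_derivative f (of_real x + \<i> * of_real s)) (at x within T)" for x T
    proof -
      have 1: "((\<lambda>x::real. complex_of_real x + \<i> * of_real s) has_vector_derivative 1) (at x within T)"
        by (auto intro!: derivative_eq_intros)
      have "(G has_field_derivative f (of_real x + \<i> * of_real s)) (at (of_real x + \<i> * of_real s))"
        by (rule G) (simp add: S_def s)
      from field_vector_diff_chain_within[OF 1 DERIV_subset[OF this]] show ?thesis
        by (simp add: o_def)
    qed
    then show "(LINT x|lborel. indicator {-real n..real n} x *\<^sub>R f (of_real x + \<i> * of_real s))
         = G (of_real n + \<i> * of_real s) - G (- of_real n + \<i> * of_real s)"
      using integral_FTC_Icc[of "-real n" "real n" "\<lambda>x. G (of_real x + \<i> * of_real s)" "\<lambda>x. f (of_real x + \<i> * of_real s)"]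
        continuous_on_subset[OF cont] by simp
  qed
  \<comment> \<open>Mean value inequality along the vertical side:
    \<open>\<bar>Im z\<bar> \<le> \<bar>y\<bar>\<close> controls the exponential and
    \<open>Re z = a\<close> supplies the decay of \<open>k\<close>.\<close>
  have side: "cmod (G (of_real a) - G (of_real a + \<i> * of_real y)) \<le> exp (\<bar>y\<bar> * \<bar>\<xi>\<bar>) * (C / (1 + \<bar>a\<bar>)\<^sup>2) * \<bar>y\<bar>" for a :: real
  proof -
    let ?L = "closed_segment (of_real a) (of_real a + \<i> * of_real y)"
    have *: "Re z = a \<and> Im z > - \<eta> \<and> \<bar>Im z\<bar> \<le> \<bar>y\<bar>" if zL: "z \<in> ?L" for z
    proof -
      obtain u where u: "0 \<le> u" "u \<le> 1" "z = (1 - u) *\<^sub>R of_real a + u *\<^sub>R (of_real a + \<i> * of_real y)"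
        using zL by (metis in_segment(1))
      have "Re z = a" "Im z = u * y"
        using u(3) by (auto simp: algebra_simps)
      moreover have "\<bar>u * y\<bar> \<le> \<bar>y\<bar>"
        using u by (simp add: abs_mult mult_left_le_one_le)
      moreover have "u * y > - \<eta>"
      proof (cases "y \<ge> 0")
        case False
        then have "u * y \<ge> y"
          using u by (simp add: mult_le_cancel_right1 mult_le_cancel_right2)
        then show ?thesis using y by simp
      qed (use \<open>0 < \<eta>\<close> u in \<open>smt (verit) mult_nonneg_nonneg\<close>)
      ultimately show ?thesis by simp
    qed
    have "cmod (G (of_real a) - G (of_real a + \<i> * of_real y)) \<le> exp (\<bar>y\<bar> * \<bar>\<xi>\<bar>) * (C / (1 + \<bar>a\<bar>)\<^sup>2) *
           cmod (of_real a - (of_real a + \<i> * of_real y))"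
    proof (rule field_differentiable_bound[where S = ?L])
      fix z assume z: "z \<in> ?L"
      show "(G has_field_derivative f z) (at z within ?L)"
        using *[OF z] by (intro DERIV_subset[OF G]) (auto simp: S_def)
      have "exp (Im z * \<xi>) \<le> exp (\<bar>y\<bar> * \<bar>\<xi>\<bar>)"
        proof -
        have "Im z * \<xi> \<le> \<bar>Im z\<bar> * \<bar>\<xi>\<bar>"
          by (metis abs_ge_self abs_mult)
        also have "\<dots> \<le> \<bar>y\<bar> * \<bar>\<xi>\<bar>"
          using *[OF z] by (simp add: mult_right_mono)
        finally show ?thesis by simp
      qed
      moreover have "cmod (k z) \<le> C / (1 + \<bar>a\<bar>)\<^sup>2"
      proof -
        have "cmod (k z) \<le> C / (1 + cmod z)\<^sup>2"
          using *[OF z] bd by auto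
        also have "\<dots> \<le> C / (1 + \<bar>a\<bar>)\<^sup>2"
          using C abs_Re_le_cmod[of z] *[OF z] by (intro divide_left_mono power_mono mult_pos_pos zero_less_power) (auto intro: add_pos_nonneg)
        finally show ?thesis .
      qed
      ultimately show "cmod (f z) \<le> exp (\<bar>y\<bar> * \<bar>\<xi>\<bar>) * (C / (1 + \<bar>a\<bar>)\<^sup>2)"
        unfolding f_def norm_mult nexp by (intro mult_mono) auto
    qed auto
    then show ?thesis
      by (simp add: norm_mult)
  qed
  define d where "d n = (LINT x|lborel. indicator {-real n..real n} x *\<^sub>R f (of_real x))
        - (LINT x|lborel. indicator {-real n..real n} x *\<^sub>R f (of_real x + \<i> * of_real y))" for n
  have dbound: "cmod (d n) \<le> 2 * exp (\<bar>y\<bar> * \<bar>\<xi>\<bar>) * C * \<bar>y\<bar> * (1 / (1 + real n))\<^sup>2" for n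
  proof -
    have "d n = (G (of_real n) - G (of_real n + \<i> * of_real y)) - (G (of_real (- n)) - G (of_real (- n) + \<i> * of_real y))"
      unfolding d_def using FTC[of 0 n] FTC[of y n] y \<open>0 < \<eta>\<close> by simp
    then have "cmod (d n) \<le> cmod (G (of_real n) - G (of_real n + \<i> * of_real y)) + cmod (G (of_real (- n)) - G (of_real (- n) + \<i> * of_real y))"
      by (metis norm_triangle_ineq4)
    also have "\<dots> \<le> 2 * (exp (\<bar>y\<bar> * \<bar>\<xi>\<bar>) * (C / (1 + real n)\<^sup>2) * \<bar>y\<bar>)"
      unfolding mult_2 using add_mono[OF side[of "real n"] side[of "- real n"]] by simp
    finally show ?thesis
      by (simp add: power_divide mult_ac)
  qed
  have dlim: "(\<lambda>n. 2 * exp (\<bar>y\<bar> * \<bar>\<xi>\<bar>) * C * \<bar>y\<bar> * (1 / (1 + real n))\<^sup>2) \<longlonglongrightarrow> 2 * exp (\<bar>y\<bar> * \<bar>\<xi>\<bar>) * C * \<bar>y\<bar> * 0\<^sup>2"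
  proof (intro tendsto_intros)
    show "(\<lambda>n. 1 / (1 + real n)) \<longlonglongrightarrow> 0"
      using LIMSEQ_inverse_real_of_nat by (simp add: inverse_eq_divide add.commute)
  qed
  have "d \<longlonglongrightarrow> 0"
    by (rule Lim_null_comparison[OF always_eventually[OF allI[OF dbound]]]) (use dlim in simp)
  moreover have "d \<longlonglongrightarrow> (LINT x|lborel. f (of_real x)) - (LINT x|lborel. f (of_real x + \<i> * of_real y))"
    unfolding d_def using int[of 0] int[of y] y \<open>0 < \<eta>\<close> by (intro tendsto_diff tendsto_integral_truncation) auto
  ultimately have "(LINT x|lborel. f (of_real x)) = (LINT x|lborel. f (of_real x + \<i> * of_real y))"
    using LIMSEQ_unique by fastforce
  moreover have "(LINT x|lborel. f (of_real x)) = fourier_L1 (\<lambda>x. k (of_real x)) \<xi>"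
    unfolding fourier_L1_def f_def by (simp add: mult_ac)
  moreover have "(LINT x|lborel. f (of_real x + \<i> * of_real y)) = of_real (exp (y * \<xi>)) * fourier_L1 (\<lambda>x. k (of_real x + \<i> * of_real y)) \<xi>"
    unfolding fourier_L1_def f_def integral_mult_right_zero[symmetric]
    by (intro Bochner_Integration.integral_cong) (auto simp: exp_of_real[symmetric] exp_add[symmetric] algebra_simps)
  ultimately show ?thesis by simp
qed

section \<open>Square integrability and the calculus of the relation
  \<open>fourier_L2\<close>\<close>

lemma L2_spaceI:
  assumes [measurable]: "f \<in> borel_measurable borel"
    and "\<And>x. (cmod (f x))\<^sup>2 \<le> C / (1 + x\<^sup>2)"
  shows "f \<in> L2_space"
proof -
  have "integrable lborel (\<lambda>x. (cmod (f x))\<^sup>2)"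
  proof (rule Bochner_Integration.integrable_bound)
    show "integrable lborel (\<lambda>x. C * (1 / (1 + x\<^sup>2)))"
      by (intro integrable_mult_right integrable_one_over_one_plus_square)
    show "AE x in lborel. norm ((cmod (f x))\<^sup>2) \<le> norm (C * (1 / (1 + x\<^sup>2)))"
    proof (intro AE_I2)
      fix x :: real
      have "(cmod (f x))\<^sup>2 \<le> C * (1 / (1 + x\<^sup>2))"
        using assms(2)[of x] by simp
      then show "norm ((cmod (f x))\<^sup>2) \<le> norm (C * (1 / (1 + x\<^sup>2)))"
        unfolding real_norm_def abs_power2 by (rule order_trans[OF _ abs_ge_self])
    qed
  qed measurable
  then show ?thesis
    by (simp add: L2_space_def)
qed

lemma L2_space_linear_decay:
  fixes f :: "real \<Rightarrow> complex"
  assumes "continuous_on UNIV f" "\<And>x. cmod (f x) \<le> C / (1 + \<bar>x\<bar>)"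
  shows "f \<in> L2_space"
proof (rule L2_spaceI)
  show "f \<in> borel_measurable borel"
    using assms(1) borel_measurable_continuous_onI by simp
  fix x :: real
  have "(cmod (f x))\<^sup>2 \<le> (C / (1 + \<bar>x\<bar>))\<^sup>2"
    using assms(2)[of x] by (intro power_mono) auto
  also have "\<dots> = C\<^sup>2 / (1 + \<bar>x\<bar>)\<^sup>2"
    by (simp add: power_divide)
  also have "\<dots> \<le> C\<^sup>2 / (1 + x\<^sup>2)"
    using one_plus_norm_square_ge[of "of_real x"]
    by (intro divide_left_mono mult_pos_pos) (auto intro: add_pos_nonneg)
  finally show "(cmod (f x))\<^sup>2 \<le> C\<^sup>2 / (1 + x\<^sup>2)" .
qed

lemma L2_space_measurable: "f \<in> L2_space \<Longrightarrow> f \<in> borel_measurable borel"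
  by (simp add: L2_space_def)

abbreviation sq_norm :: "(real \<Rightarrow> complex) \<Rightarrow> ennreal" where
  "sq_norm f \<equiv> \<integral>\<^sup>+x. ennreal ((cmod (f x))\<^sup>2) \<partial>lborel"

text \<open>A substitute for Minkowski's inequality without square roots; the factor 2 is harmless
  for finiteness and for limits equal to 0.\<close>

lemma sq_norm_add_le:
  assumes [measurable]: "f \<in> borel_measurable borel" "g \<in> borel_measurable borel"
  shows "sq_norm (\<lambda>x. f x + g x) \<le> 2 * sq_norm f + 2 * sq_norm g"
proof -
  have "(cmod (f x + g x))\<^sup>2 \<le> 2 * (cmod (f x))\<^sup>2 + 2 * (cmod (g x))\<^sup>2" for x
  proof -
    have "(cmod (f x + g x))\<^sup>2 \<le> (cmod (f x) + cmod (g x))\<^sup>2"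
      by (intro power_mono norm_triangle_ineq) auto
    also have "\<dots> \<le> 2 * (cmod (f x))\<^sup>2 + 2 * (cmod (g x))\<^sup>2"
      using sum_squares_bound[of "cmod (f x)" "cmod (g x)"] by (simp add: power2_sum)
    finally show ?thesis .
  qed
  then have "sq_norm (\<lambda>x. f x + g x)
     \<le> (\<integral>\<^sup>+x. (2 * ennreal ((cmod (f x))\<^sup>2) + 2 * ennreal ((cmod (g x))\<^sup>2)) \<partial>lborel)"
    by (intro nn_integral_mono)
      (simp add: ennreal_plus[symmetric] ennreal_mult[symmetric] ennreal_numeral[symmetric] ennreal_leI del: ennreal_plus ennreal_numeral)
  also have "\<dots> = 2 * sq_norm f + 2 * sq_norm g"
    by (subst nn_integral_add) (auto simp: nn_integral_cmult)
  finally show ?thesis .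
qed

lemma L2_space_iff:
  "f \<in> L2_space \<longleftrightarrow> f \<in> borel_measurable borel \<and> sq_norm f < \<infinity>"
  unfolding L2_space_def integrable_iff_bounded by auto

lemma L2_space_add: "f \<in> L2_space \<Longrightarrow> g \<in> L2_space \<Longrightarrow> (\<lambda>x. f x + g x) \<in> L2_space"
  unfolding L2_space_iff using sq_norm_add_le[of f g]
  by (auto simp: ennreal_mult_less_top intro!: le_less_trans[OF sq_norm_add_le[of f g]])

lemma L2_space_cmult: "f \<in> L2_space \<Longrightarrow> (\<lambda>x. c * f x) \<in> L2_space"
  unfolding L2_space_def by (auto simp: norm_mult power_mult_distrib)

lemma nn_integral_reflect:
  fixes f :: "real \<Rightarrow> ennreal"
  assumes [measurable]: "f \<in> borel_measurable borel"
  shows "(\<integral>\<^sup>+x. f (- x) \<partial>lborel) = (\<integral>\<^sup>+x. f x \<partial>lborel)"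
  using nn_integral_real_affine[of f "-1" 0] by simp

lemma borel_measurable_cnj [measurable]: "cnj \<in> borel_measurable borel"
  by (intro borel_measurable_continuous_onI continuous_intros)

lemma L2_space_cnj_reflect: "f \<in> L2_space \<Longrightarrow> (\<lambda>x. cnj (f (- x))) \<in> L2_space"
  unfolding L2_space_iff using nn_integral_reflect[of "\<lambda>x. ennreal ((cmod (f x))\<^sup>2)"]
  by (auto intro!: measurable_compose[OF _ borel_measurable_cnj])

lemma L2_space_cnj: "f \<in> L2_space \<Longrightarrow> (\<lambda>x. cnj (f x)) \<in> L2_space"
  unfolding L2_space_iff by (auto intro!: measurable_compose[OF _ borel_measurable_cnj])

lemma L2_tendsto_dominated:
  assumes [measurable]: "\<And>n. F n \<in> borel_measurable borel" "f \<in> borel_measurable borel"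
    and w: "integrable lborel w"
    and bound: "\<And>n. AE x in lborel. (cmod (F n x - f x))\<^sup>2 \<le> w x"
    and lim: "AE x in lborel. (\<lambda>n. F n x) \<longlonglongrightarrow> f x"
  shows "L2_tendsto F f sequentially"
proof -
  have "(\<lambda>n. \<integral>\<^sup>+x. ennreal ((cmod (F n x - f x))\<^sup>2) \<partial>lborel) \<longlonglongrightarrow> (\<integral>\<^sup>+x. ennreal 0 \<partial>(lborel :: real measure))"
  proof (rule nn_integral_dominated_convergence[where w = "\<lambda>x. ennreal (w x)"])
    show "AE x in lborel. ennreal ((cmod (F j x - f x))\<^sup>2) \<le> ennreal (w x)" for j
      using bound[of j] by (auto intro: ennreal_leI)
    show "(\<lambda>x. ennreal (w x)) \<in> borel_measurable lborel"
      using w by measurable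
    show "(\<integral>\<^sup>+ x. ennreal (w x) \<partial>lborel) < \<infinity>"
      using w by (simp add: integrable_iff_bounded) (smt (verit, best) nn_integral_mono ennreal_leI abs_ge_self order_le_less_trans)
    show "AE x in lborel. (\<lambda>n. ennreal ((cmod (F n x - f x))\<^sup>2)) \<longlonglongrightarrow> ennreal 0"
      using lim
    proof eventually_elim
      case (elim x)
      then have "(\<lambda>n. (cmod (F n x - f x))\<^sup>2) \<longlonglongrightarrow> (cmod (f x - f x))\<^sup>2"
        by (intro tendsto_intros)
      then show ?case
        by (intro tendsto_ennrealI) simp
    qed
  qed measurable
  then show ?thesis
    by (simp add: L2_tendsto_def)
qed

lemma L2_tendsto_add:
  assumes [measurable]: "\<And>n. F n \<in> borel_measurable borel" "f \<in> borel_measurable borel"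
    "\<And>n. G n \<in> borel_measurable borel" "g \<in> borel_measurable borel"
    and "L2_tendsto F f net" "L2_tendsto G g net"
  shows "L2_tendsto (\<lambda>n x. F n x + G n x) (\<lambda>x. f x + g x) net"
proof -
  have lim: "((\<lambda>n. 2 * sq_norm (\<lambda>x. F n x - f x) + 2 * sq_norm (\<lambda>x. G n x - g x))
      \<longlongrightarrow> 2 * 0 + 2 * 0) net"
    using assms(5,6) unfolding L2_tendsto_def
    by (intro tendsto_add ennreal_tendsto_cmult) auto
  show ?thesis
    unfolding L2_tendsto_def
  proof (rule tendsto_sandwich[OF _ _ tendsto_const, rotated 2])
    show "((\<lambda>n. 2 * sq_norm (\<lambda>x. F n x - f x) + 2 * sq_norm (\<lambda>x. G n x - g x))
      \<longlongrightarrow> 0) net"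
      using lim by simp
    show "\<forall>\<^sub>F n in net. sq_norm (\<lambda>x. F n x + G n x - (f x + g x))
      \<le> 2 * sq_norm (\<lambda>x. F n x - f x) + 2 * sq_norm (\<lambda>x. G n x - g x)"
      using sq_norm_add_le[of "\<lambda>x. F _ x - f x" "\<lambda>x. G _ x - g x"]
      by (intro always_eventually allI) (simp add: algebra_simps)
  qed auto
qed

lemma L2_tendsto_cmult:
  assumes [measurable]: "\<And>n. F n \<in> borel_measurable borel" "f \<in> borel_measurable borel"
    and "L2_tendsto F f net"
  shows "L2_tendsto (\<lambda>n x. c * F n x) (\<lambda>x. c * f x) net"
proof -
  have "((\<lambda>n. ennreal ((cmod c)\<^sup>2) * sq_norm (\<lambda>x. F n x - f x)) \<longlongrightarrow> ennreal ((cmod c)\<^sup>2) * 0) net"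
    using assms(3) unfolding L2_tendsto_def by (intro ennreal_tendsto_cmult) auto
  moreover have "ennreal ((cmod c)\<^sup>2) * sq_norm (\<lambda>x. F n x - f x)
      = sq_norm (\<lambda>x. c * F n x - c * f x)" for n
    by (subst nn_integral_cmult[symmetric])
      (auto simp: ennreal_mult[symmetric] norm_mult right_diff_distrib[symmetric] power_mult_distrib)
  ultimately show ?thesis
    by (simp add: L2_tendsto_def)
qed

lemma L2_tendsto_cnj:
  "L2_tendsto F f net \<Longrightarrow> L2_tendsto (\<lambda>n x. cnj (F n x)) (\<lambda>x. cnj (f x)) net"
  by (simp add: L2_tendsto_def complex_cnj_diff[symmetric] del: complex_cnj_diff)

lemma L2_tendsto_reflect:
  assumes [measurable]: "\<And>n. F n \<in> borel_measurable borel" "f \<in> borel_measurable borel"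
    and "L2_tendsto F f net"
  shows "L2_tendsto (\<lambda>n x. F n (- x)) (\<lambda>x. f (- x)) net"
  using assms(3) nn_integral_reflect[of "\<lambda>x. ennreal ((cmod (F _ x - f x))\<^sup>2)"]
  by (simp add: L2_tendsto_def)

lemma fourier_L1_measurable [measurable]:
  assumes [measurable]: "f \<in> borel_measurable borel"
  shows "fourier_L1 f \<in> borel_measurable borel"
  unfolding fourier_L1_def by measurable

lemma integrable_fourier_kernel:
  assumes "integrable lborel f"
  shows "integrable lborel (\<lambda>x. exp (- \<i> * of_real (x * \<xi>)) * f x)"
  by (rule Bochner_Integration.integrable_bound[OF assms])
    (use assms in \<open>auto simp: norm_mult norm_exp_eq_Re\<close>)

lemma fourier_L1_add:
  "integrable lborel f \<Longrightarrow> integrable lborel g \<Longrightarrow>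
    fourier_L1 (\<lambda>x. f x + g x) \<xi> = fourier_L1 f \<xi> + fourier_L1 g \<xi>"
  using integrable_fourier_kernel[of f \<xi>] integrable_fourier_kernel[of g \<xi>]
  by (simp add: fourier_L1_def distrib_left)

lemma fourier_L1_cmult: "fourier_L1 (\<lambda>x. c * f x) \<xi> = c * fourier_L1 f \<xi>"
  by (simp add: fourier_L1_def mult.left_commute)

lemma fourier_L1_cnj: "fourier_L1 (\<lambda>x. cnj (f x)) \<xi> = cnj (fourier_L1 f (- \<xi>))"
proof -
  have "fourier_L1 (\<lambda>x. cnj (f x)) \<xi> = (LINT x|lborel. cnj (exp (- \<i> * of_real (x * - \<xi>)) * f x))"
    unfolding fourier_L1_def by (intro Bochner_Integration.integral_cong) (auto simp: exp_cnj)
  then show ?thesis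
    unfolding fourier_L1_def by (simp only: Bochner_Integration.integral_cnj)
qed

lemma norm_fourier_L1_le: "cmod (fourier_L1 f \<xi>) \<le> (LINT x|lborel. cmod (f x))"
  unfolding fourier_L1_def
  by (rule order_trans[OF integral_norm_bound]) (simp add: norm_mult norm_exp_eq_Re)

lemma fourier_L2E:
  assumes "fourier_L2 f g"
  obtains F where "\<And>n. integrable lborel (F n)" "\<And>n. F n \<in> L2_space" "L2_tendsto F f sequentially"
      "L2_tendsto (\<lambda>n. fourier_L1 (F n)) g sequentially" "f \<in> L2_space" "g \<in> L2_space"
  using assms unfolding fourier_L2_def by blast

lemma fourier_L2I:
  assumes "\<And>n. integrable lborel (F n)" "\<And>n. F n \<in> L2_space" "L2_tendsto F f sequentially"
      "L2_tendsto G g sequentially" "f \<in> L2_space" "g \<in> L2_space" "\<And>n. fourier_L1 (F n) = G n"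
  shows "fourier_L2 f g"
proof -
  have "(\<lambda>n. fourier_L1 (F n)) = G"
    using assms(7) by (simp add: fun_eq_iff)
  then show ?thesis
    using assms(1-6) unfolding fourier_L2_def by (intro conjI exI[of _ F] allI) simp_all
qed

lemma fourier_L2_add:
  assumes "fourier_L2 f g" "fourier_L2 f' g'"
  shows "fourier_L2 (\<lambda>x. f x + f' x) (\<lambda>\<xi>. g \<xi> + g' \<xi>)"
proof -
  obtain F where F: "\<And>n. integrable lborel (F n)" "\<And>n. F n \<in> L2_space" "L2_tendsto F f sequentially"
      "L2_tendsto (\<lambda>n. fourier_L1 (F n)) g sequentially" "f \<in> L2_space" "g \<in> L2_space"
    using fourier_L2E[OF assms(1)] by blast
  obtain F' where F': "\<And>n. integrable lborel (F' n)" "\<And>n. F' n \<in> L2_space" "L2_tendsto F' f' sequentially"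
      "L2_tendsto (\<lambda>n. fourier_L1 (F' n)) g' sequentially" "f' \<in> L2_space" "g' \<in> L2_space"
    using fourier_L2E[OF assms(2)] by blast
  note [measurable] = F(2,5,6)[THEN L2_space_measurable] F'(2,5,6)[THEN L2_space_measurable]
  show ?thesis
    by (rule fourier_L2I[OF _ _ L2_tendsto_add[OF _ _ _ _ F(3) F'(3)] L2_tendsto_add[OF _ _ _ _ F(4) F'(4)]])
      (auto simp: fourier_L1_add[OF F(1) F'(1)] fun_eq_iff intro: L2_space_add F F')
qed

lemma fourier_L2_cmult:
  assumes "fourier_L2 f g"
  shows "fourier_L2 (\<lambda>x. c * f x) (\<lambda>\<xi>. c * g \<xi>)"
proof -
  obtain F where F: "\<And>n. integrable lborel (F n)" "\<And>n. F n \<in> L2_space" "L2_tendsto F f sequentially"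
      "L2_tendsto (\<lambda>n. fourier_L1 (F n)) g sequentially" "f \<in> L2_space" "g \<in> L2_space"
    using fourier_L2E[OF assms] by blast
  note [measurable] = F(2,5,6)[THEN L2_space_measurable]
  show ?thesis
    by (rule fourier_L2I[OF _ _ L2_tendsto_cmult[OF _ _ F(3)] L2_tendsto_cmult[OF _ _ F(4)]])
      (auto simp: fourier_L1_cmult fun_eq_iff intro: L2_space_cmult F)
qed

lemma fourier_L2_cnj:
  assumes "fourier_L2 f g"
  shows "fourier_L2 (\<lambda>x. cnj (f x)) (\<lambda>\<xi>. cnj (g (- \<xi>)))"
proof -
  obtain F where F: "\<And>n. integrable lborel (F n)" "\<And>n. F n \<in> L2_space" "L2_tendsto F f sequentially"
      "L2_tendsto (\<lambda>n. fourier_L1 (F n)) g sequentially" "f \<in> L2_space" "g \<in> L2_space"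
    using fourier_L2E[OF assms] by blast
  note [measurable] = F(2,5,6)[THEN L2_space_measurable]
  show ?thesis
    by (rule fourier_L2I[OF _ _ L2_tendsto_cnj[OF F(3)] L2_tendsto_cnj[OF L2_tendsto_reflect[OF _ _ F(4)]]])
      (auto simp: fourier_L1_cnj fun_eq_iff intro: L2_space_cnj L2_space_cnj_reflect F)
qed

text \<open>Used to discard the frequency 0, which is common to the spectra of a Hardy function and
  of its conjugate.\<close>

lemma fourier_L2_cong_AE:
  assumes "fourier_L2 f g" "g' \<in> L2_space" "AE \<xi> in lborel. g' \<xi> = g \<xi>"
  shows "fourier_L2 f g'"
proof -
  have "sq_norm (\<lambda>x. G x - g' x) = sq_norm (\<lambda>x. G x - g x)" for G
    using assms(3) by (intro nn_integral_cong_AE) auto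
  then show ?thesis
    using assms(1,2) unfolding fourier_L2_def L2_tendsto_def by auto
qed

lemma fourier_L2_of_L1:
  assumes "integrable lborel f" "f \<in> L2_space" "fourier_L1 f \<in> L2_space"
  shows "fourier_L2 f (fourier_L1 f)"
  using assms unfolding fourier_L2_def L2_tendsto_def
  by (intro conjI exI[of _ "\<lambda>n. f"]) auto

section \<open>Fourier transforms of functions holomorphic slightly below the real axis\<close>

lemma norm_inverse_shifted_le:
  assumes "0 < b" "Im z \<ge> - b / 2"
  shows "1 + cmod z \<le> (1 + 2 * (1 + b) / b) * cmod (z + \<i> * of_real b)"
proof -
  \<comment> \<open>In this half-plane z keeps distance b/2 from the pole -ib, so the constant in 1
    + |z| <= |z + ib| + (1 + b) is absorbed by 2 (1 + b) / b times |z + ib|.\<close>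
  have 1: "b / 2 \<le> cmod (z + \<i> * of_real b)"
    using assms abs_Im_le_cmod[of "z + \<i> * of_real b"] by simp
  have "cmod z \<le> cmod (z + \<i> * of_real b) + b"
    using norm_triangle_ineq4[of "z + \<i> * of_real b" "\<i> * of_real b"] assms by (simp add: norm_mult)
  moreover have "1 + b \<le> 2 * (1 + b) / b * cmod (z + \<i> * of_real b)"
    using mult_left_mono[OF 1, of "2 * (1 + b) / b"] assms by simp
  ultimately show ?thesis
    by (simp add: algebra_simps)
qed

text \<open>Brings exponential decay of transforms into the form required by
  \<open>L2_spaceI\<close>, through exp u >= 1 + u^2/2.\<close>

lemma exp_neg_le_quadratic:
  assumes "0 < a" "0 \<le> (x::real)"
  shows "exp (- (a * x)) \<le> (1 + 2 / a\<^sup>2) / (1 + x\<^sup>2)"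
proof -
  have "1 + (a * x)\<^sup>2 / 2 \<le> exp (a * x)"
    using exp_lower_Taylor_quadratic[of "a * x"] assms by (smt (verit) mult_nonneg_nonneg)
  then have "(1 + 2 / a\<^sup>2) * (1 + (a * x)\<^sup>2 / 2) \<le> (1 + 2 / a\<^sup>2) * exp (a * x)"
    by (intro mult_left_mono) auto
  moreover have "1 + x\<^sup>2 \<le> (1 + 2 / a\<^sup>2) * (1 + (a * x)\<^sup>2 / 2)"
    using assms by (simp add: field_simps power_mult_distrib)
  ultimately have "1 + x\<^sup>2 \<le> (1 + 2 / a\<^sup>2) * exp (a * x)"
    by linarith
  then show ?thesis
    by (simp add: exp_minus field_simps add_pos_nonneg)
qed

text \<open>A Paley--Wiener argument. Shifting to height y bounds the transform by exp (y \<xi>) C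
  pi for every y > -\<eta>. Letting y grow kills negative frequencies; y = -\<eta>/2 gives
  exponential decay at positive ones, so that the transform is in L2 without Plancherel.\<close>

lemma fourier_L2_hardy_L1:
  fixes k :: "complex \<Rightarrow> complex"
  assumes hol: "k holomorphic_on {z. Im z > - \<eta>}" and "0 < \<eta>"
    and bd: "\<And>z. Im z > - \<eta> \<Longrightarrow> cmod (k z) \<le> C / (1 + cmod z)\<^sup>2"
  shows "integrable lborel (\<lambda>x. k (of_real x))"
    and "\<xi> < 0 \<Longrightarrow> fourier_L1 (\<lambda>x. k (of_real x)) \<xi> = 0"
    and "fourier_L2 (\<lambda>x. k (of_real x)) (fourier_L1 (\<lambda>x. k (of_real x)))"
proof -
  define g where "g = fourier_L1 (\<lambda>x. k (of_real x))"
  have C: "0 \<le> C"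
    using bd[of 0] \<open>0 < \<eta>\<close> by (simp add: order_trans[OF norm_ge_zero])
  have bd': "cmod (k (of_real x + \<i> * of_real y)) \<le> C / (1 + x\<^sup>2)" if "y > - \<eta>" for x y
  proof -
    let ?z = "complex_of_real x + \<i> * of_real y"
    have "cmod (k ?z) \<le> C / (1 + cmod ?z)\<^sup>2"
      using bd[of ?z] that by simp
    also have "\<dots> \<le> C / (1 + x\<^sup>2)"
      using one_plus_norm_square_ge[of ?z] C
      by (intro divide_left_mono mult_pos_pos zero_less_power) (auto intro: add_pos_nonneg)
    finally show ?thesis .
  qed
  have cont: "continuous_on UNIV (\<lambda>x::real. k (of_real x + \<i> * of_real y))" if "y > - \<eta>" for y
    by (rule continuous_on_compose2[OF holomorphic_on_imp_continuous_on[OF hol]])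
      (auto intro!: continuous_intros simp: that)
  show int: "integrable lborel (\<lambda>x. k (of_real x))"
    using integrable_quadratic_decay[OF cont[of 0] bd'[of 0]] \<open>0 < \<eta>\<close> by simp
  have g: "cmod (g \<xi>) \<le> exp (y * \<xi>) * (C * pi)" if "y > - \<eta>" for y \<xi>
  proof -
    have "cmod (fourier_L1 (\<lambda>x. k (of_real x + \<i> * of_real y)) \<xi>) \<le> (LINT x|lborel. cmod (k (of_real x + \<i> * of_real y)))"
      by (rule norm_fourier_L1_le)
    also have "\<dots> \<le> (LINT x|lborel. C * (1 / (1 + x\<^sup>2)))"
      using integrable_quadratic_decay[OF cont[OF that] bd'[OF that]] bd'[OF that]
      by (intro integral_mono integrable_mult_right integrable_one_over_one_plus_square) auto
    also have "\<dots> = C * pi"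
      by (simp only: integral_mult_right_zero integral_one_over_one_plus_square)
    finally have *: "cmod (fourier_L1 (\<lambda>x. k (of_real x + \<i> * of_real y)) \<xi>) \<le> C * pi" .
    have "g \<xi> = of_real (exp (y * \<xi>)) * fourier_L1 (\<lambda>x. k (of_real x + \<i> * of_real y)) \<xi>"
      unfolding g_def by (rule fourier_L1_shift[OF hol \<open>0 < \<eta>\<close> bd that])
    then show ?thesis
      using * by (simp add: norm_mult mult_left_mono)
  qed
  have neg: "g \<xi> = 0" if "\<xi> < 0" for \<xi>
  proof -
    have "(\<lambda>n. exp \<xi> ^ n * (C * pi)) \<longlonglongrightarrow> 0 * (C * pi)"
      using that by (intro tendsto_intros LIMSEQ_realpow_zero) auto
    moreover have "cmod (g \<xi>) \<le> exp \<xi> ^ n * (C * pi)" for n :: nat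
      using g[of "real n" \<xi>] \<open>0 < \<eta>\<close> by (simp add: exp_of_nat_mult)
    ultimately have "cmod (g \<xi>) \<le> 0 * (C * pi)"
      by (intro LIMSEQ_le_const) auto
    then show ?thesis by simp
  qed
  then show "\<xi> < 0 \<Longrightarrow> fourier_L1 (\<lambda>x. k (of_real x)) \<xi> = 0"
    by (simp add: g_def)
  have meas [measurable]: "(\<lambda>x. k (of_real x)) \<in> borel_measurable borel"
    using int by measurable
  have "g \<in> L2_space"
  proof (rule L2_spaceI)
    show "g \<in> borel_measurable borel"
      unfolding g_def by measurable
    fix \<xi> :: real
    show "(cmod (g \<xi>))\<^sup>2 \<le> (C * pi)\<^sup>2 * (1 + 2 / \<eta>\<^sup>2) / (1 + \<xi>\<^sup>2)"
    proof (cases "\<xi> < 0")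
      case False
      have "(cmod (g \<xi>))\<^sup>2 \<le> (exp (- (\<eta> / 2) * \<xi>) * (C * pi))\<^sup>2"
        using g[of "- (\<eta> / 2)" \<xi>] \<open>0 < \<eta>\<close> by (intro power_mono) auto
      also have "\<dots> = (C * pi)\<^sup>2 * exp (- (\<eta> * \<xi>))"
        by (simp add: power_mult_distrib exp_double[symmetric])
      also have "\<dots> \<le> (C * pi)\<^sup>2 * ((1 + 2 / \<eta>\<^sup>2) / (1 + \<xi>\<^sup>2))"
        using False \<open>0 < \<eta>\<close> by (intro mult_left_mono exp_neg_le_quadratic) auto
      finally show ?thesis by simp
    qed (simp add: neg add_nonneg_nonneg)
  qed
  moreover have "(\<lambda>x. k (of_real x)) \<in> L2_space"
  proof (rule L2_spaceI)
    fix x :: real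
    have "(cmod (k (of_real x)))\<^sup>2 \<le> (C / (1 + x\<^sup>2))\<^sup>2"
      using bd'[of 0 x] \<open>0 < \<eta>\<close> by (intro power_mono) auto
    also have "\<dots> = C\<^sup>2 / (1 + x\<^sup>2)\<^sup>2"
      by (simp add: power_divide)
    also have "\<dots> \<le> C\<^sup>2 / (1 + x\<^sup>2)"
      by (intro divide_left_mono mult_pos_pos zero_less_power)
        (auto intro: add_pos_nonneg self_le_power)
    finally show "(cmod (k (of_real x)))\<^sup>2 \<le> C\<^sup>2 / (1 + x\<^sup>2)" .
  qed measurable
  ultimately show "fourier_L2 (\<lambda>x. k (of_real x)) (fourier_L1 (\<lambda>x. k (of_real x)))"
    using int unfolding g_def by (intro fourier_L2_of_L1)
qed

text \<open>A single simple pole decays like 1/|x| and is not integrable; the difference of two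
  decays quadratically and has a genuine Fourier integral.\<close>

definition pole_diff :: "real \<Rightarrow> real \<Rightarrow> complex \<Rightarrow> complex" where
  "pole_diff b c z = 1 / (z + \<i> * of_real b) - 1 / (z + \<i> * of_real c)"

lemma pole_diff_hardy:
  assumes "0 < b" "0 < c"
  obtains \<eta> C where "0 < \<eta>" "pole_diff b c holomorphic_on {z. Im z > - \<eta>}"
    "\<And>z. Im z > - \<eta> \<Longrightarrow> cmod (pole_diff b c z) \<le> C / (1 + cmod z)\<^sup>2"
proof -
  define \<eta> where "\<eta> = min b c / 2"
  define D where "D b = 1 + 2 * (1 + b) / b" for b :: real
  have D: "0 < D b" "0 < D c"
    using assms by (auto simp: D_def add_pos_pos)
  have nz: "z + \<i> * of_real b \<noteq> 0" "z + \<i> * of_real c \<noteq> 0" if "Im z > - \<eta>" for z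
    using that assms by (auto simp: \<eta>_def complex_eq_iff)
  show thesis
  proof (rule that[of \<eta> "\<bar>c - b\<bar> * (D b * D c)"])
    show "0 < \<eta>" using assms by (simp add: \<eta>_def)
    show "pole_diff b c holomorphic_on {z. Im z > - \<eta>}"
      unfolding pole_diff_def using nz by (auto intro!: holomorphic_intros)
    fix z assume z: "Im z > - \<eta>"
    let ?u = "cmod (z + \<i> * of_real b)" and ?v = "cmod (z + \<i> * of_real c)"
    have uv: "0 < ?u" "0 < ?v" using nz[OF z] by auto
    have "(1 + cmod z) * (1 + cmod z) \<le> (D b * ?u) * (D c * ?v)"
      using z assms D unfolding D_def \<eta>_def
      by (intro mult_mono norm_inverse_shifted_le) auto
    then have *: "1 / (?u * ?v) \<le> (D b * D c) / (1 + cmod z)\<^sup>2"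
      using uv by (simp add: field_simps power2_eq_square add_pos_nonneg)
    have "pole_diff b c z = \<i> * of_real (c - b) / ((z + \<i> * of_real b) * (z + \<i> * of_real c))"
      using nz[OF z] by (simp add: pole_diff_def field_simps)
    then have "cmod (pole_diff b c z) = \<bar>c - b\<bar> * (1 / (?u * ?v))"
      by (simp add: norm_divide norm_mult del: of_real_diff)
    also have "\<dots> \<le> \<bar>c - b\<bar> * ((D b * D c) / (1 + cmod z)\<^sup>2)"
      using * by (intro mult_left_mono) auto
    finally show "cmod (pole_diff b c z) \<le> \<bar>c - b\<bar> * (D b * D c) / (1 + cmod z)\<^sup>2"
      by simp
  qed
qed

text \<open>Residues would give -2 pi i (exp (-b \<xi>) - exp (-c \<xi>)) for \<xi> > 0.
  Translations and dilations determine this up to the constant factor, which suffices because only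
  the support and the decay matter.\<close>

definition pole_diff_hat :: "real \<Rightarrow> real \<Rightarrow> real \<Rightarrow> complex" where
  "pole_diff_hat b c \<xi> = fourier_L1 (\<lambda>x. pole_diff b c (of_real x)) \<xi>"

lemma pole_diff_integrable: "0 < b \<Longrightarrow> 0 < c \<Longrightarrow> integrable lborel (\<lambda>x. pole_diff b c (of_real x))"
  using fourier_L2_hardy_L1(1) pole_diff_hardy by metis

lemma pole_diff_hat_neg: "0 < b \<Longrightarrow> 0 < c \<Longrightarrow> \<xi> < 0 \<Longrightarrow> pole_diff_hat b c \<xi> = 0"
  unfolding pole_diff_hat_def using fourier_L2_hardy_L1(2) pole_diff_hardy by metis

lemma pole_diff_hat_add:
  assumes "0 < b" "0 < c" "0 < d"
  shows "pole_diff_hat b d \<xi> = pole_diff_hat b c \<xi> + pole_diff_hat c d \<xi>"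
proof -
  have "pole_diff b d z = pole_diff b c z + pole_diff c d z" for z
    by (simp add: pole_diff_def)
  then show ?thesis
    unfolding pole_diff_hat_def by (simp add: fourier_L1_add pole_diff_integrable assms)
qed

text \<open>Moving both poles down by s amounts to evaluating the function at height s, so this is
  the contour shift.\<close>

lemma pole_diff_hat_shift:
  assumes "0 < b" "0 < c" "0 \<le> s"
  shows "pole_diff_hat (b + s) (c + s) \<xi> = of_real (exp (- s * \<xi>)) * pole_diff_hat b c \<xi>"
proof -
  obtain \<eta> C where *: "0 < \<eta>" "pole_diff b c holomorphic_on {z. Im z > - \<eta>}"
    "\<And>z. Im z > - \<eta> \<Longrightarrow> cmod (pole_diff b c z) \<le> C / (1 + cmod z)\<^sup>2"
    using pole_diff_hardy[OF assms(1,2)] by blast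
  have "pole_diff_hat b c \<xi> = of_real (exp (s * \<xi>)) * fourier_L1 (\<lambda>x. pole_diff b c (of_real x + \<i> * of_real s)) \<xi>"
    unfolding pole_diff_hat_def using assms(3) *(1) by (intro fourier_L1_shift[OF *(2,1,3)]) auto
  also have "(\<lambda>x. pole_diff b c (of_real x + \<i> * of_real s)) = (\<lambda>x. pole_diff (b + s) (c + s) (of_real x))"
    by (simp add: pole_diff_def algebra_simps)
  finally show ?thesis
    by (simp add: pole_diff_hat_def exp_minus exp_of_real field_simps)
qed

lemma pole_diff_hat_scale:
  assumes "0 < b"
  shows "pole_diff_hat b (b * c) \<xi> = pole_diff_hat 1 c (b * \<xi>)"
proof -
  have "of_real b * pole_diff b (b * c) (of_real (b * x)) = pole_diff 1 c (of_real x)" for x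
  proof -
    have *: "of_real b * (1 / (of_real (b * x) + \<i> * of_real (b * d))) = 1 / (complex_of_real x + \<i> * of_real d)" for d
    proof -
      have "complex_of_real (b * x) + \<i> * of_real (b * d) = of_real b * (of_real x + \<i> * of_real d)"
        by (simp add: algebra_simps)
      then show ?thesis using assms by simp
    qed
    show ?thesis
      using *[of 1] *[of c] by (simp add: pole_diff_def right_diff_distrib)
  qed
  then have "pole_diff_hat 1 c (b * \<xi>) = (LINT x|lborel. b *\<^sub>R (exp (- \<i> * of_real ((0 + b * x) * \<xi>)) * pole_diff b (b * c) (of_real (0 + b * x))))"
    unfolding pole_diff_hat_def fourier_L1_def scaleR_conv_of_real
    by (intro Bochner_Integration.integral_cong) (auto simp: mult_ac)
  also have "\<dots> = pole_diff_hat b (b * c) \<xi>"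
    unfolding pole_diff_hat_def fourier_L1_def integral_scaleR_right
    using assms lborel_integral_real_affine[of b "\<lambda>x. exp (- \<i> * of_real (x * \<xi>)) * pole_diff b (b * c) (of_real x)" 0]
    by simp
  finally show ?thesis by simp
qed

text \<open>Translation invariance makes \<open>s \<mapsto> pole_diff_hat 1 (1 + s)\<close> a cocycle, and
  dilation invariance then fixes its dependence on the frequency.\<close>

lemma pole_diff_hat_eq:
  obtains c\<^sub>0 :: complex where
    "\<And>s \<xi>. 0 < s \<Longrightarrow> 0 < \<xi> \<Longrightarrow> pole_diff_hat 1 (1 + s) \<xi> = c\<^sub>0 * of_real (exp (- \<xi>) * (1 - exp (- s * \<xi>)))"
proof -
  define D where "D \<xi> = pole_diff_hat 1 2 \<xi> / of_real (1 - exp (- \<xi>))" for \<xi>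
  have one: "pole_diff_hat 1 (1 + s) \<xi> = D \<xi> * of_real (1 - exp (- s * \<xi>))" if "0 < s" "0 < \<xi>" for s \<xi>
  proof -
    let ?e = "\<lambda>s. complex_of_real (exp (- s * \<xi>))"
    let ?K = "\<lambda>b c. pole_diff_hat b c \<xi>"
    \<comment> \<open>The same transform with poles 1 and 2 + s, split at 1 + s and then at 2.
      Comparing the two splittings expresses \<open>?K 1 (1 + s)\<close> through
      \<open>?K 1 2\<close>.\<close>
    have "?K 1 (1 + s) + ?e s * ?K 1 2 = ?K 1 (2 + s)"
      using pole_diff_hat_shift[of 1 2 s \<xi>] pole_diff_hat_add[of 1 "1 + s" "2 + s" \<xi>] that by simp
    moreover have "?K 1 2 + ?e 1 * ?K 1 (1 + s) = ?K 1 (2 + s)"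
      using pole_diff_hat_shift[of 1 "1 + s" 1 \<xi>] pole_diff_hat_add[of 1 2 "2 + s" \<xi>] that by (simp add: add_ac)
    ultimately have "?K 1 (1 + s) * (1 - ?e 1) = ?K 1 2 * (1 - ?e s)"
      by (simp add: algebra_simps)
    moreover have "1 - ?e 1 \<noteq> 0"
      using that by (simp add: exp_of_real)
    ultimately show ?thesis
      by (simp add: D_def field_simps)
  qed
  have scale: "D (b * \<xi>) = of_real (exp (- (b - 1) * \<xi>)) * D \<xi>" if "1 \<le> b" "0 < \<xi>" for b \<xi>
  proof -
    \<comment> \<open>The poles b and 2b arise both from 1 and 2 by dilation and from 1 and 1 + b by
      translation.\<close>
    have "D (b * \<xi>) * of_real (1 - exp (- b * \<xi>)) = pole_diff_hat b (b * 2) \<xi>"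
      using one[of 1 "b * \<xi>"] pole_diff_hat_scale[of b 2 \<xi>] that by simp
    also have "\<dots> = of_real (exp (- (b - 1) * \<xi>)) * pole_diff_hat 1 (1 + b) \<xi>"
      using pole_diff_hat_shift[of 1 "1 + b" "b - 1" \<xi>] that by (simp add: mult.commute)
    also have "\<dots> = of_real (exp (- (b - 1) * \<xi>)) * D \<xi> * of_real (1 - exp (- b * \<xi>))"
      using one[of b \<xi>] that by simp
    finally show ?thesis
      using that by (simp add: exp_of_real)
  qed
  \<comment> \<open>\<open>scale\<close> only enlarges frequencies, so frequency 1 is dilated to
    \<xi> or \<xi> to 1, whichever is smaller.\<close>
  have const: "D \<xi> = D 1 * of_real (exp 1) * of_real (exp (- \<xi>))" if "0 < \<xi>" for \<xi>
  proof (cases "1 \<le> \<xi>")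
    case True
    then show ?thesis
      using scale[of \<xi> 1] by (simp add: exp_diff exp_minus field_simps)
  next
    case False
    then have "D 1 = of_real (exp (- (1 / \<xi> - 1) * \<xi>)) * D \<xi>"
      using scale[of "1 / \<xi>" \<xi>] that by simp
    moreover have "- (1 / \<xi> - 1) * \<xi> = \<xi> - 1"
      using that by (simp add: field_simps)
    ultimately show ?thesis
      by (simp add: exp_diff exp_minus field_simps)
  qed
  show thesis
  proof (rule that[of "D 1 * of_real (exp 1)"])
    fix s \<xi> :: real
    assume "0 < s" "0 < \<xi>"
    then show "pole_diff_hat 1 (1 + s) \<xi> = D 1 * of_real (exp 1) * of_real (exp (- \<xi>) * (1 - exp (- s * \<xi>)))"
      using one[of s \<xi>] const[of \<xi>] by (simp only: of_real_mult mult.assoc)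
  qed
qed

text \<open>The approximants subtract a second pole that escapes to -i infinity. The subtracted term
  tends to 0 in L2, and the transforms are \<open>g\<close> times 1 - exp (-(1 + n) \<xi>) for \<xi>
  > 0, which converge to \<open>g\<close> by dominated convergence; frequency 0 is a null
  set.\<close>

lemma fourier_L2_simple_pole:
  obtains g where "fourier_L2 (\<lambda>x. 1 / (of_real x + \<i>)) g" "\<And>\<xi>. \<xi> < 0 \<Longrightarrow> g \<xi> = 0"
proof -
  obtain c\<^sub>0 where c\<^sub>0: "\<And>s \<xi>. 0 < s \<Longrightarrow> 0 < \<xi> \<Longrightarrow> pole_diff_hat 1 (1 + s) \<xi> = c\<^sub>0 * of_real (exp (- \<xi>) * (1 - exp (- s * \<xi>)))"
    by (rule pole_diff_hat_eq) blast
  define g where "g \<xi> = (if 0 < \<xi> then c\<^sub>0 * of_real (exp (- \<xi>)) else 0)" for \<xi> :: real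
  \<comment> \<open>The second pole is 1 + (1 + n), so that the shift 1 + n is positive already for
    n = 0.\<close>
  define F where "F n x = pole_diff 1 (2 + real n) (of_real x)" for n x
  have [measurable]: "F n \<in> borel_measurable borel" "g \<in> borel_measurable borel"
      "(\<lambda>x. 1 / (complex_of_real x + \<i>)) \<in> borel_measurable borel" for n
    unfolding F_def pole_diff_def g_def by measurable
  have sq: "(cmod (1 / (of_real x + \<i> * of_real b)))\<^sup>2 = 1 / (x\<^sup>2 + b\<^sup>2)" for x b :: real
    by (simp add: norm_divide power_divide cmod_power2)
  have 1: "(\<lambda>x. 1 / (of_real x + \<i>)) \<in> L2_space"
    using sq[of _ 1] by (intro L2_spaceI[where C = 1]) (auto simp: add.commute)
  have 2: "integrable lborel (F n)" "F n \<in> L2_space" for n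
  proof -
    obtain \<eta> C where *: "0 < \<eta>" "pole_diff 1 (2 + real n) holomorphic_on {z. Im z > - \<eta>}"
      "\<And>z. Im z > - \<eta> \<Longrightarrow> cmod (pole_diff 1 (2 + real n) z) \<le> C / (1 + cmod z)\<^sup>2"
      using pole_diff_hardy[of 1 "2 + real n"] by auto
    show "integrable lborel (F n)"
      unfolding F_def by (rule fourier_L2_hardy_L1(1)[OF *(2,1,3)])
    have "fourier_L2 (F n) (fourier_L1 (F n))"
      unfolding F_def by (rule fourier_L2_hardy_L1(3)[OF *(2,1,3)])
    then show "F n \<in> L2_space"
      by (simp add: fourier_L2_def)
  qed
  have g2: "(cmod (g \<xi>))\<^sup>2 \<le> (cmod c\<^sub>0)\<^sup>2 * (1 + 2 / 2\<^sup>2) / (1 + \<xi>\<^sup>2)" for \<xi>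
  proof (cases "0 < \<xi>")
    case True
    have "(cmod c\<^sub>0)\<^sup>2 * exp (- (2 * \<xi>)) \<le> (cmod c\<^sub>0)\<^sup>2 * ((1 + 2 / 2\<^sup>2) / (1 + \<xi>\<^sup>2))"
      using True by (intro mult_left_mono exp_neg_le_quadratic) auto
    then show ?thesis
      using True by (simp add: g_def norm_mult power_mult_distrib exp_double[symmetric])
  qed (simp add: g_def add_nonneg_nonneg)
  then have 3: "g \<in> L2_space"
    by (intro L2_spaceI) measurable
  have 4: "L2_tendsto F (\<lambda>x. 1 / (of_real x + \<i>)) sequentially"
  proof (rule L2_tendsto_dominated)
    have diff: "F n x - 1 / (of_real x + \<i>) = - (1 / (of_real x + \<i> * of_real (2 + real n)))" for n x
      by (simp add: F_def pole_diff_def)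
    show "AE x in lborel. (cmod (F n x - 1 / (of_real x + \<i>)))\<^sup>2 \<le> 1 / (1 + x\<^sup>2)" for n
    proof (rule AE_I2)
      fix x :: real
      have "1 \<le> (2 + real n)\<^sup>2"
        by (intro one_le_power) auto
      then show "(cmod (F n x - 1 / (of_real x + \<i>)))\<^sup>2 \<le> 1 / (1 + x\<^sup>2)"
        unfolding diff norm_minus_cancel sq by (intro divide_left_mono mult_pos_pos) (auto intro: add_pos_nonneg add_nonneg_pos)
    qed
    show "AE x in lborel. (\<lambda>n. F n x) \<longlonglongrightarrow> 1 / (of_real x + \<i>)"
    proof (rule AE_I2)
      fix x :: real
      have "(\<lambda>n. F n x - 1 / (of_real x + \<i>)) \<longlonglongrightarrow> 0"
      proof (rule Lim_null_comparison[OF always_eventually])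
        show "\<forall>n. cmod (F n x - 1 / (of_real x + \<i>)) \<le> inverse (real (Suc n))"
        proof
          fix n
          have "real (Suc n) \<le> cmod (of_real x + \<i> * of_real (2 + real n))"
            using abs_Im_le_cmod[of "of_real x + \<i> * of_real (2 + real n)"] by simp
          then have "inverse (cmod (of_real x + \<i> * of_real (2 + real n))) \<le> inverse (real (Suc n))"
            by (rule le_imp_inverse_le) simp
          then show "cmod (F n x - 1 / (of_real x + \<i>)) \<le> inverse (real (Suc n))"
            by (simp only: diff norm_minus_cancel norm_divide norm_one inverse_eq_divide)
        qed
      qed (rule LIMSEQ_inverse_real_of_nat)
      then show "(\<lambda>n. F n x) \<longlonglongrightarrow> 1 / (of_real x + \<i>)"
        by (simp add: LIM_zero_iff)
    qed
  qed (auto intro: integrable_one_over_one_plus_square)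
  have hat: "fourier_L1 (F n) \<xi> - g \<xi> = - g \<xi> * of_real (exp (- ((1 + real n) * \<xi>)))" if "\<xi> \<noteq> 0" for n \<xi>
  proof (cases "\<xi> < 0")
    case True
    then show ?thesis
      using pole_diff_hat_neg[of 1 "2 + real n" \<xi>] by (simp add: F_def[abs_def] pole_diff_hat_def g_def)
  next
    case False
    then show ?thesis
      using c\<^sub>0[of "1 + real n" \<xi>] that
      by (simp add: F_def[abs_def] pole_diff_hat_def g_def algebra_simps)
  qed
  have nz: "AE \<xi> in lborel. \<xi> \<noteq> (0::real)"
    by (rule AE_lborel_singleton)
  have 5: "L2_tendsto (\<lambda>n. fourier_L1 (F n)) g sequentially"
  proof (rule L2_tendsto_dominated)
    show "integrable lborel (\<lambda>\<xi>. (cmod (g \<xi>))\<^sup>2)"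
      using 3 by (simp add: L2_space_def)
    show "AE \<xi> in lborel. (cmod (fourier_L1 (F n) \<xi> - g \<xi>))\<^sup>2 \<le> (cmod (g \<xi>))\<^sup>2" for n
      using nz
    proof eventually_elim
      case (elim \<xi>)
      have "cmod (g \<xi>) * exp (- ((1 + real n) * \<xi>)) \<le> cmod (g \<xi>)"
        by (cases "0 < \<xi>") (auto simp: g_def intro!: mult_left_le)
      then show ?case
        unfolding hat[OF elim] by (intro power_mono) (auto simp: norm_mult)
    qed
    show "AE \<xi> in lborel. (\<lambda>n. fourier_L1 (F n) \<xi>) \<longlonglongrightarrow> g \<xi>"
      using nz
    proof eventually_elim
      case (elim \<xi>)
      have "(\<lambda>n. fourier_L1 (F n) \<xi> - g \<xi>) \<longlonglongrightarrow> 0"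
      proof (cases "\<xi> < 0")
        case False
        have "(\<lambda>n. g \<xi> * of_real (exp (- \<xi>) ^ Suc n)) \<longlonglongrightarrow> g \<xi> * of_real 0"
          using False elim by (intro tendsto_intros LIMSEQ_Suc LIMSEQ_realpow_zero) auto
        moreover have eq: "- (g \<xi> * of_real (exp (- \<xi>) ^ Suc n)) = fourier_L1 (F n) \<xi> - g \<xi>" for n
          unfolding hat[OF elim] exp_of_nat_mult[symmetric] by simp
        ultimately show ?thesis
          using tendsto_minus[of "\<lambda>n. g \<xi> * of_real (exp (- \<xi>) ^ Suc n)"] unfolding eq by fastforce
      qed (simp add: hat[OF elim], simp add: g_def)
      then show ?case
        by (simp add: LIM_zero_iff)
    qed
  qed measurable
  show thesis
    using 1 2 3 4 5 by (intro that[of g]) (auto simp: fourier_L2_def g_def)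
qed

text \<open>The form in which resolvent entries occur: their leading 1/z behaviour at infinity is
  carried by the simple pole, and the remainder is integrable.\<close>

lemma fourier_L2_hardy:
  fixes k :: "complex \<Rightarrow> complex"
  assumes "k holomorphic_on {z. Im z > - \<eta>}" "0 < \<eta>"
    and "\<And>z. Im z > - \<eta> \<Longrightarrow> cmod (k z) \<le> C / (1 + cmod z)\<^sup>2"
  obtains g where "fourier_L2 (\<lambda>x. c / (of_real x + \<i>) + k (of_real x)) g" "\<And>\<xi>. \<xi> < 0 \<Longrightarrow> g \<xi> = 0"
proof -
  obtain g where g: "fourier_L2 (\<lambda>x. 1 / (of_real x + \<i>)) g" "\<And>\<xi>. \<xi> < 0 \<Longrightarrow> g \<xi> = 0"
    using fourier_L2_simple_pole by blast
  let ?k = "\<lambda>x. k (of_real x)"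
  have k: "fourier_L2 ?k (fourier_L1 ?k)" "\<And>\<xi>. \<xi> < 0 \<Longrightarrow> fourier_L1 ?k \<xi> = 0"
    by (rule fourier_L2_hardy_L1(3)[OF assms], assumption) (rule fourier_L2_hardy_L1(2)[OF assms])
  have "fourier_L2 (\<lambda>x. c / (of_real x + \<i>) + k (of_real x)) (\<lambda>\<xi>. c * g \<xi> + fourier_L1 ?k \<xi>)"
    using fourier_L2_add[OF fourier_L2_cmult[OF g(1), of c] k(1)] by simp
  then show thesis
    by (rule that) (simp add: g(2) k(2))
qed

lemma szego_projection_self:
  assumes "fourier_L2 h g" "\<And>\<xi>. \<xi> < 0 \<Longrightarrow> g \<xi> = 0"
  shows "szego_projection h h"
proof -
  have "(\<lambda>\<xi>. indicator {0..} \<xi> * g \<xi>) = g"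
    using assms(2) by (auto simp: indicator_def fun_eq_iff)
  then show ?thesis
    using assms(1) unfolding szego_projection_def by auto
qed

text \<open>The conjugate has transform cnj (g (-\<xi>)), which lives on \<xi> <= 0. The cutoff
  therefore returns \<open>g\<close>, except possibly at \<xi> = 0, where the two parts
  overlap.\<close>

lemma szego_projection_add_cnj:
  assumes "fourier_L2 h g" "\<And>\<xi>. \<xi> < 0 \<Longrightarrow> g \<xi> = 0"
  shows "szego_projection (\<lambda>x. h x + cnj (h x)) h"
  unfolding szego_projection_def
proof (intro exI conjI)
  let ?g = "\<lambda>\<xi>. g \<xi> + cnj (g (- \<xi>))"
  show *: "fourier_L2 (\<lambda>x. h x + cnj (h x)) ?g"
    by (intro fourier_L2_add fourier_L2_cnj assms)
  have "?g \<in> L2_space"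
    using * by (simp add: fourier_L2_def)
  then have [measurable]: "?g \<in> borel_measurable borel" and
      fin: "(\<integral>\<^sup>+\<xi>. ennreal ((cmod (?g \<xi>))\<^sup>2) \<partial>lborel) < \<infinity>"
    by (auto simp: L2_space_iff)
  have "(\<integral>\<^sup>+\<xi>. ennreal ((cmod (indicator {0..} \<xi> * ?g \<xi>))\<^sup>2) \<partial>lborel) \<le> (\<integral>\<^sup>+\<xi>. ennreal ((cmod (?g \<xi>))\<^sup>2) \<partial>lborel)"
    by (intro nn_integral_mono) (auto simp: indicator_def)
  with fin have "(\<lambda>\<xi>. indicator {0..} \<xi> * ?g \<xi>) \<in> L2_space"
    unfolding L2_space_iff by auto
  moreover have "AE \<xi> in lborel. indicator {0..} \<xi> * ?g \<xi> = g \<xi>"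
    using AE_lborel_singleton[of 0] by eventually_elim (auto simp: indicator_def assms(2))
  ultimately show "fourier_L2 h (\<lambda>\<xi>. indicator {0..} \<xi> * ?g \<xi>)"
    by (rule fourier_L2_cong_AE[OF assms(1)])
qed

section \<open>Resolvents of the multisoliton matrix\<close>

lemma mat_mult_vec: "(mat z :: complex^'n^'n) *v v = (\<chi> i. z * v $ i)"
  by (simp add: vec_eq_iff mat_def matrix_vector_mult_def if_distrib[of "\<lambda>x. x * _"] cong: if_cong)

lemma matrix_inv_works:
  fixes A :: "complex^'n^'n"
  assumes "invertible A"
  shows "A ** matrix_inv A = mat 1" "matrix_inv A ** A = mat 1"
proof -
  have "\<exists>A'. A ** A' = mat 1 \<and> A' ** A = mat 1"
    using assms by (simp add: invertible_def)
  from someI_ex[OF this] show "A ** matrix_inv A = mat 1" "matrix_inv A ** A = mat 1"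
    by (auto simp: matrix_inv_def)
qed

lemma matrix_inv_vector:
  fixes A :: "complex^'n^'n"
  assumes "invertible A"
  shows "A *v (matrix_inv A *v v) = v" "matrix_inv A *v (A *v v) = v"
  by (simp_all add: matrix_vector_mul_assoc matrix_inv_works[OF assms])

lemma invertibleI_kernel:
  fixes A :: "complex^'n^'n"
  assumes "\<And>v. A *v v = 0 \<Longrightarrow> v = 0"
  shows "invertible A"
  using assms matrix_left_invertible_ker[of A] invertible_left_inverse[of A] by auto

text \<open>Cramer's rule, from which both continuity and holomorphy of resolvent entries are read
  off.\<close>

lemma matrix_inv_entry:
  fixes A :: "complex^'n^'n"
  assumes "invertible A"
  shows "matrix_inv A $ i $ j = det (\<chi> a b. if b = i then axis j 1 $ a else A $ a $ b) / det A"
proof -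
  have "det A \<noteq> 0"
    using assms by (simp add: invertible_det_nz)
  then have "matrix_inv A *v axis j 1 = (\<chi> k. det (\<chi> a b. if b = k then axis j 1 $ a else A $ a $ b) / det A)"
    using cramer[of A "matrix_inv A *v axis j 1" "axis j 1"] matrix_inv_vector(1)[OF assms] by blast
  then have "(matrix_inv A *v axis j 1) $ i = det (\<chi> a b. if b = i then axis j 1 $ a else A $ a $ b) / det A"
    by simp
  moreover have "(matrix_inv A *v axis j 1) $ i = matrix_inv A $ i $ j"
    by (simp add: matrix_vector_mult_def axis_def if_distrib cong: if_cong)
  ultimately show ?thesis
    by simp
qed

lemma tendsto_det:
  fixes A :: "'a \<Rightarrow> complex^'n^'n"
  assumes "\<And>i j. ((\<lambda>x. A x $ i $ j) \<longlongrightarrow> B $ i $ j) F"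
  shows "((\<lambda>x. det (A x)) \<longlongrightarrow> det B) F"
  unfolding det_def by (intro tendsto_sum tendsto_mult tendsto_const tendsto_prod assms)

lemma tendsto_matrix_inv:
  fixes A :: "'a \<Rightarrow> complex^'n^'n"
  assumes "(A \<longlongrightarrow> B) F" "invertible B" "\<forall>\<^sub>F x in F. invertible (A x)"
  shows "((\<lambda>x. matrix_inv (A x)) \<longlongrightarrow> matrix_inv B) F"
proof (intro vec_tendstoI)
  fix i j
  have ent: "((\<lambda>x. A x $ i $ j) \<longlongrightarrow> B $ i $ j) F" for i j
    by (intro tendsto_vec_nth assms)
  have "((\<lambda>x. det (\<chi> a b. if b = i then axis j 1 $ a else A x $ a $ b) / det (A x))
      \<longlongrightarrow> det (\<chi> a b. if b = i then axis j 1 $ a else B $ a $ b) / det B) F"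
    using assms(2) by (intro tendsto_divide tendsto_det ent) (auto simp: invertible_det_nz intro!: ent)
  moreover have "\<forall>\<^sub>F x in F. det (\<chi> a b. if b = i then axis j 1 $ a else A x $ a $ b) / det (A x) = matrix_inv (A x) $ i $ j"
    using assms(3) by eventually_elim (simp add: matrix_inv_entry)
  ultimately show "((\<lambda>x. matrix_inv (A x) $ i $ j) \<longlongrightarrow> matrix_inv B $ i $ j) F"
    unfolding matrix_inv_entry[OF assms(2)] by (rule Lim_transform_eventually)
qed

lemma bounded_bilinear_matrix_mult: "bounded_bilinear ((**) :: complex^'n^'n \<Rightarrow> complex^'n^'n \<Rightarrow> complex^'n^'n)"
  unfolding bilinear_conv_bounded_bilinear[symmetric] bilinear_def
  by (auto intro!: linearI simp: vec_eq_iff matrix_matrix_mult_def algebra_simps sum.distrib scaleR_sum_right)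

lemma bounded_bilinear_matrix_vector_mult: "bounded_bilinear ((*v) :: complex^'n^'n \<Rightarrow> complex^'n \<Rightarrow> complex^'n)"
  unfolding bilinear_conv_bounded_bilinear[symmetric] bilinear_def
  by (auto intro!: linearI simp: vec_eq_iff matrix_vector_mult_def algebra_simps sum.distrib scaleR_sum_right)

lemmas tendsto_matrix_mult = bounded_bilinear.tendsto[OF bounded_bilinear_matrix_mult]
lemmas tendsto_matrix_vector_mult = bounded_bilinear.tendsto[OF bounded_bilinear_matrix_vector_mult]

lemma has_vector_derivativeI_quotient:
  assumes "((\<lambda>u. (f u - f s) /\<^sub>R (u - s)) \<longlongrightarrow> f') (at s)"
  shows "(f has_vector_derivative f') (at s)"
proof -
  have "((\<lambda>u. (f u - f s) /\<^sub>R (u - s) - f') \<longlongrightarrow> 0) (at s)"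
    using assms by (simp add: LIM_zero_iff)
  then have *: "((\<lambda>u. norm ((f u - f s) /\<^sub>R (u - s) - f')) \<longlongrightarrow> 0) (at s)"
    by (rule tendsto_norm_zero)
  have "((\<lambda>u. norm ((f u - f s - (u - s) *\<^sub>R f') /\<^sub>R norm (u - s))) \<longlongrightarrow> 0) (at s)"
  proof (rule Lim_transform_eventually[OF *])
    have "norm ((f u - f s) /\<^sub>R (u - s) - f') = norm ((f u - f s - (u - s) *\<^sub>R f') /\<^sub>R norm (u - s))" if "u \<noteq> s" for u
    proof -
      have "(f u - f s) /\<^sub>R (u - s) - f' = (f u - f s - (u - s) *\<^sub>R f') /\<^sub>R (u - s)"
        using that by (simp add: scaleR_diff_right)
      then show ?thesis by simp
    qed
    then show "\<forall>\<^sub>F u in at s. norm ((f u - f s) /\<^sub>R (u - s) - f') = norm ((f u - f s - (u - s) *\<^sub>R f') /\<^sub>R norm (u - s))"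
      by (auto simp: eventually_at_filter)
  qed
  then have "((\<lambda>u. (f u - f s - (u - s) *\<^sub>R f') /\<^sub>R norm (u - s)) \<longlongrightarrow> 0) (at s)"
    by (rule tendsto_norm_zero_cancel)
  then show ?thesis
    unfolding has_vector_derivative_def has_derivative_at_within
    by (simp add: bounded_linear_scaleR_left)
qed

text \<open>From the resolvent identity R(u) - R(s) = -(u - s) R(u) D R(s) and continuity. The
  matrix M(t) - x is affine in x and in t separately, so both derivatives of the resolvent are
  instances, with D = -1 and D = 2 Lambda.\<close>

lemma has_vector_derivative_matrix_inv:
  fixes A\<^sub>0 D :: "complex^'n^'n"
  assumes inv: "\<And>s. invertible (A\<^sub>0 + s *\<^sub>R D)"
  shows "((\<lambda>s. matrix_inv (A\<^sub>0 + s *\<^sub>R D)) has_vector_derivative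
      - (matrix_inv (A\<^sub>0 + s *\<^sub>R D) ** D ** matrix_inv (A\<^sub>0 + s *\<^sub>R D))) (at s)"
proof -
  define R where "R s = matrix_inv (A\<^sub>0 + s *\<^sub>R D)" for s
  have cont: "(R \<longlongrightarrow> R s) (at s)"
    unfolding R_def using inv by (intro tendsto_matrix_inv tendsto_intros) auto
  have "R u - R s = - ((u - s) *\<^sub>R (R u ** D ** R s))" for u
  proof -
    have "R u ** (A\<^sub>0 + s *\<^sub>R D - (A\<^sub>0 + u *\<^sub>R D)) ** R s = R u ** ((A\<^sub>0 + s *\<^sub>R D) ** R s) - (R u ** (A\<^sub>0 + u *\<^sub>R D)) ** R s"
      by (simp only: bounded_bilinear.diff_left[OF bounded_bilinear_matrix_mult]
          bounded_bilinear.diff_right[OF bounded_bilinear_matrix_mult] matrix_mul_assoc)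
    also have "\<dots> = R u - R s"
      unfolding R_def by (simp add: matrix_inv_works inv)
    also have "R u ** (A\<^sub>0 + s *\<^sub>R D - (A\<^sub>0 + u *\<^sub>R D)) ** R s = R u ** ((s - u) *\<^sub>R D) ** R s"
      by (simp add: scaleR_diff_left)
    also have "\<dots> = (s - u) *\<^sub>R (R u ** D ** R s)"
      by (simp only: bounded_bilinear.scaleR_left[OF bounded_bilinear_matrix_mult] bounded_bilinear.scaleR_right[OF bounded_bilinear_matrix_mult])
    finally show ?thesis
      by (simp add: scaleR_minus_left[symmetric] del: scaleR_minus_left)
  qed
  then have "(R u - R s) /\<^sub>R (u - s) = - (R u ** D ** R s)" if "u \<noteq> s" for u
    using that by simp
  moreover have "((\<lambda>u. - (R u ** D ** R s)) \<longlongrightarrow> - (R s ** D ** R s)) (at s)"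
    by (intro tendsto_minus tendsto_matrix_mult cont tendsto_const)
  ultimately have "((\<lambda>u. (R u - R s) /\<^sub>R (u - s)) \<longlongrightarrow> - (R s ** D ** R s)) (at s)"
    by (simp cong: Lim_cong_within)
  then show ?thesis
    unfolding R_def by (rule has_vector_derivativeI_quotient)
qed

lemma has_vector_derivative_vec_nth:
  "(f has_vector_derivative f') F \<Longrightarrow> ((\<lambda>x. f x $ i) has_vector_derivative f' $ i) F"
  by (rule bounded_linear.has_vector_derivative[OF bounded_linear_vec_nth])

locale soliton =
  fixes l :: "real^'n" and m :: 'n and \<rho> :: real and \<gamma> :: "real^'n"
  assumes inj: "inj (($) l)" and lm: "l $ m = 0" and rho: "\<rho> > 0"
begin

abbreviation "M \<equiv> multisoliton_M l m \<rho> \<gamma>"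

definition "R t z = matrix_inv (M t - mat z)"

lemma M_entry:
  "M t $ i $ j = (if i = j then of_real (2 * t * l $ i + \<gamma> $ i) - \<i> * of_real \<rho> * (if i = m then 1 else 0)
      else \<i> / of_real (l $ i - l $ j))"
  by (simp add: multisoliton_M_def multisoliton_W_def)

lemma l_eq_iff [simp]: "l $ i = l $ j \<longleftrightarrow> i = j"
  using inj by (auto simp: inj_def)

lemma M_cnj: "cnj (M t $ i $ j) = M t $ j $ i + (if i = m \<and> j = m then 2 * \<i> * of_real \<rho> else 0)"
  by (simp add: M_entry) (simp add: divide_simps; simp add: algebra_simps)

lemma M_commutator: "of_real (l $ i) * M t $ i $ j = M t $ i $ j * of_real (l $ j) + (if i = j then 0 else \<i>)"
  by (simp add: M_entry field_simps)

text \<open>M is Hermitian apart from the damping, so only the damping contributes. This yields both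
  the location of the spectrum and the expression of |q|^2 as an imaginary part.\<close>

lemma M_quadratic:
  "Im (\<Sum>i\<in>UNIV. cnj (v $ i) * (M t *v v) $ i) = - \<rho> * (cmod (v $ m))\<^sup>2"
proof -
  define S where "S = (\<Sum>i\<in>UNIV. \<Sum>j\<in>UNIV. cnj (v $ i) * (M t $ i $ j * v $ j))"
  have "cnj S = (\<Sum>i\<in>UNIV. \<Sum>j\<in>UNIV. v $ i * (cnj (M t $ i $ j) * cnj (v $ j)))"
    by (simp add: S_def)
  also have "\<dots> = (\<Sum>i\<in>UNIV. \<Sum>j\<in>UNIV. v $ i * (M t $ j $ i * cnj (v $ j)) +
       (if i = m then if j = m then 2 * \<i> * of_real \<rho> * (v $ i * cnj (v $ j)) else 0 else 0))"
    by (intro sum.cong refl) (auto simp: M_cnj algebra_simps)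
  also have "\<dots> = (\<Sum>j\<in>UNIV. \<Sum>i\<in>UNIV. v $ i * (M t $ j $ i * cnj (v $ j))) + 2 * \<i> * of_real \<rho> * (v $ m * cnj (v $ m))"
    by (subst sum.swap) (simp add: sum.distrib sum.delta if_distrib[of "sum _"] cong: if_cong)
  also have "(\<Sum>j\<in>UNIV. \<Sum>i\<in>UNIV. v $ i * (M t $ j $ i * cnj (v $ j))) = S"
    unfolding S_def by (intro sum.cong refl) (simp add: mult_ac)
  also have "v $ m * cnj (v $ m) = of_real ((cmod (v $ m))\<^sup>2)"
    by (rule complex_norm_square[symmetric])
  finally have "Im (cnj S) = Im (S + 2 * \<i> * of_real \<rho> * of_real ((cmod (v $ m))\<^sup>2))"
    by simp
  then have "Im S = - \<rho> * (cmod (v $ m))\<^sup>2"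
    by simp
  then show ?thesis
    by (simp add: S_def matrix_vector_mult_def sum_distrib_left)
qed

text \<open>For real \<open>z\<close> the kernel vector \<open>v\<close> has \<open>v\<^sub>m = 0\<close>; then \<open>w = \<Lambda>\<^sup>-\<^sup>1 v\<close> is orthogonal
  to \<open>(1,\<dots>,1)\<close> by row \<open>m\<close>, and evaluating \<open>v\<^sup>* (M - z) w = 0\<close> with the commutator of
  \<open>\<Lambda>\<close> and \<open>M\<close> gives \<open>|w|\<^sup>2 = 0\<close>.\<close>

lemma kernel_trivial:
  assumes z: "Im z \<ge> 0" and v: "(M t - mat z) *v v = 0"
  shows "v = 0"
proof -
  have Mv: "M t *v v = (\<chi> i. z * v $ i)"
    using v by (simp add: matrix_vector_mult_diff_rdistrib mat_mult_vec)
  have sq: "(\<Sum>i\<in>UNIV. cnj (u $ i) * u $ i) = of_real (\<Sum>i\<in>UNIV. (cmod (u $ i))\<^sup>2)" for u :: "complex^'n"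
    by (simp add: complex_norm_square mult.commute del: of_real_power)
  have zero: "u = 0" if "(\<Sum>i\<in>UNIV. (cmod (u $ i))\<^sup>2) = 0" for u :: "complex^'n"
    using that by (simp add: sum_nonneg_eq_0_iff vec_eq_iff)
  have "(\<Sum>i\<in>UNIV. cnj (v $ i) * (M t *v v) $ i) = z * of_real (\<Sum>i\<in>UNIV. (cmod (v $ i))\<^sup>2)"
    unfolding Mv sq[symmetric] by (simp add: sum_distrib_left mult_ac)
  then have *: "Im z * (\<Sum>i\<in>UNIV. (cmod (v $ i))\<^sup>2) = - \<rho> * (cmod (v $ m))\<^sup>2"
    using M_quadratic[of v t] by (simp del: of_real_sum)
  moreover have "0 \<le> Im z * (\<Sum>i\<in>UNIV. (cmod (v $ i))\<^sup>2)"
    using z by (intro mult_nonneg_nonneg sum_nonneg) auto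
  ultimately have vm: "v $ m = 0"
    using rho by (smt (verit, best) mult_pos_pos mult_minus_left norm_eq_zero zero_less_norm_iff zero_less_power)
  show ?thesis
  proof (cases "Im z = 0")
    case False
    then show ?thesis
      using * vm zero by simp
  next
    case True
    then have cz: "cnj z = z" by (simp add: complex_eq_iff)
    \<comment> \<open>At i = m this is 0/0 = 0, consistent with v_m = 0, so v = Lambda w holds in
      every component.\<close>
    define w where "w = (\<chi> i. v $ i / of_real (l $ i))"
    have vw: "v $ i = of_real (l $ i) * w $ i" for i
      using vm lm l_eq_iff[of i m] by (cases "i = m") (auto simp: w_def simp del: l_eq_iff)
    \<comment> \<open>In row m the diagonal term meets v_m = 0, and since l_m = 0 the other entries
      are -i / l_j, which turn v_j into -i w_j.\<close>
    have "(M t *v v) $ m = (\<Sum>j\<in>UNIV. - \<i> * w $ j)"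
      unfolding matrix_vector_mult_def
      by (auto intro!: sum.cong simp: M_entry lm w_def vm)
    then have sumw: "(\<Sum>j\<in>UNIV. w $ j) = 0"
      by (simp add: Mv vm sum_negf sum_distrib_left[symmetric])
    \<comment> \<open>T = v^* M w. As v_m = 0 the damping is invisible and M can be moved onto v;
      commuting Lambda past M instead gives the same number plus i |sum w|^2 - i |w|^2.\<close>
    define T where "T = (\<Sum>i\<in>UNIV. \<Sum>j\<in>UNIV. cnj (v $ i) * (M t $ i $ j * w $ j))"
    have "T = (\<Sum>j\<in>UNIV. w $ j * cnj ((M t *v v) $ j))"
    proof -
      have "cnj (v $ i) * (M t $ i $ j * w $ j) = w $ j * cnj (M t $ j $ i * v $ i)" for i j
        by (simp add: M_cnj vm)
      then have "T = (\<Sum>i\<in>UNIV. \<Sum>j\<in>UNIV. w $ j * cnj (M t $ j $ i * v $ i))"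
        by (simp only: T_def)
      also have "\<dots> = (\<Sum>j\<in>UNIV. \<Sum>i\<in>UNIV. w $ j * cnj (M t $ j $ i * v $ i))"
        by (rule sum.swap)
      finally show ?thesis
        by (simp add: matrix_vector_mult_def sum_distrib_left)
    qed
    then have T1: "T = z * (\<Sum>j\<in>UNIV. w $ j * cnj (v $ j))"
      by (simp add: Mv cz sum_distrib_left mult_ac)
    have "T = (\<Sum>i\<in>UNIV. \<Sum>j\<in>UNIV. cnj (w $ i) * (M t $ i $ j * v $ j) + \<i> * (cnj (w $ i) * w $ j)
        - (if j = i then \<i> * (cnj (w $ i) * w $ j) else 0))"
      unfolding T_def
    proof (intro sum.cong refl)
      fix i j
      have "cnj (v $ i) * (M t $ i $ j * w $ j) = cnj (w $ i) * (of_real (l $ i) * M t $ i $ j) * w $ j"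
        by (simp add: vw)
      also have "\<dots> = cnj (w $ i) * (M t $ i $ j * v $ j) + (if i = j then 0 else \<i> * (cnj (w $ i) * w $ j))"
        unfolding M_commutator by (simp add: vw algebra_simps)
      finally show "cnj (v $ i) * (M t $ i $ j * w $ j) = cnj (w $ i) * (M t $ i $ j * v $ j) + \<i> * (cnj (w $ i) * w $ j)
        - (if j = i then \<i> * (cnj (w $ i) * w $ j) else 0)"
        by simp
    qed
    also have "\<dots> = (\<Sum>i\<in>UNIV. \<Sum>j\<in>UNIV. cnj (w $ i) * (M t $ i $ j * v $ j)) + (\<Sum>i\<in>UNIV. \<Sum>j\<in>UNIV. \<i> * (cnj (w $ i) * w $ j))
        - (\<Sum>i\<in>UNIV. \<Sum>j\<in>UNIV. if j = i then \<i> * (cnj (w $ i) * w $ j) else 0)"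
      by (simp only: sum.distrib sum_subtractf)
    also have "(\<Sum>i\<in>UNIV. \<Sum>j\<in>UNIV. cnj (w $ i) * (M t $ i $ j * v $ j)) = (\<Sum>i\<in>UNIV. cnj (w $ i) * (M t *v v) $ i)"
      by (simp add: matrix_vector_mult_def sum_distrib_left)
    also have "(\<Sum>i\<in>UNIV. \<Sum>j\<in>UNIV. \<i> * (cnj (w $ i) * w $ j)) = \<i> * ((\<Sum>i\<in>UNIV. cnj (w $ i)) * (\<Sum>j\<in>UNIV. w $ j))"
      by (subst sum_product) (simp only: sum_distrib_left)
    also have "(\<Sum>i\<in>UNIV. \<Sum>j\<in>UNIV. if j = i then \<i> * (cnj (w $ i) * w $ j) else 0) = \<i> * (\<Sum>i\<in>UNIV. cnj (w $ i) * w $ i)"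
      by (simp add: sum.delta sum_distrib_left)
    also have "(\<Sum>i\<in>UNIV. cnj (w $ i) * (M t *v v) $ i) = T"
      unfolding T1 by (simp add: Mv vw sum_distrib_left mult_ac)
    finally have "(\<Sum>i\<in>UNIV. cnj (w $ i) * w $ i) = 0"
      using sumw by simp
    then have "w = 0"
      using zero[of w] unfolding sq of_real_eq_0_iff by simp
    then show ?thesis
      by (simp add: vec_eq_iff vw)
  qed
qed

lemma invertible_M: "Im z \<ge> 0 \<Longrightarrow> invertible (M t - mat z)"
  by (rule invertibleI_kernel) (rule kernel_trivial)

end

section \<open>Bounds, analyticity and Fourier transforms of the resolvent\<close>

lemma mat_of_real: "mat (of_real x) = x *\<^sub>R (mat 1 :: complex^'n^'n)"
  by (simp add: vec_eq_iff mat_def scaleR_conv_of_real[where 'a = complex])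

lemma norm_weighted_sum_le:
  fixes v :: "complex^'n"
  assumes "\<And>i. cmod (v $ i) \<le> B"
  shows "cmod (\<Sum>i\<in>UNIV. c $ i * v $ i) \<le> (\<Sum>i\<in>UNIV. cmod (c $ i)) * B"
  unfolding sum_distrib_right
  by (rule order_trans[OF norm_sum]) (auto simp: norm_mult intro!: sum_mono mult_left_mono assms)

context soliton begin

definition Lam :: "complex^'n^'n" where "Lam = (\<chi> i j. if i = j then of_real (l $ i) else 0)"

lemma M_affine: "M t = multisoliton_W l m \<rho> \<gamma> + t *\<^sub>R (2 *\<^sub>R Lam)"
  by (simp add: vec_eq_iff multisoliton_M_def Lam_def scaleR_conv_of_real[where 'a = complex])

lemma continuous_M: "continuous_on UNIV M"
  unfolding M_affine[abs_def] by (intro continuous_intros)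

text \<open>For |z| large compared with the norm of M the term z v dominates, locally uniformly in
  time. It bounds both the resolvent at infinity and the spectrum.\<close>

lemma M_coercive:
  assumes "bounded T"
  obtains B where "\<And>t z v. t \<in> T \<Longrightarrow> B \<le> cmod z \<Longrightarrow> (1 + cmod z) * norm v \<le> 2 * norm ((M t - mat z) *v v)"
proof -
  obtain a where a: "\<And>t. t \<in> T \<Longrightarrow> \<bar>t\<bar> \<le> a"
    using assms by (auto simp: bounded_iff)
  have "compact (M ` {-a..a})"
    by (intro compact_continuous_image continuous_on_subset[OF continuous_M]) auto
  then obtain L where L: "\<And>t. t \<in> {-a..a} \<Longrightarrow> norm (M t) \<le> L"
    using compact_imp_bounded[of "M ` {-a..a}"] unfolding bounded_iff by blast
  obtain K where K: "K > 0" "\<And>A v. norm ((A :: complex^'n^'n) *v v) \<le> norm A * norm v * K"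
    using bounded_bilinear.pos_bounded[OF bounded_bilinear_matrix_vector_mult] by blast
  show thesis
  \<comment> \<open>Exactly the threshold from which |z| - L K >= (1 + |z|) / 2; \<open>K\<close> is
    the constant of the matrix-vector product.\<close>
  proof (rule that[of "2 * (L * K) + 1"])
    fix t z v assume t: "t \<in> T" and z: "2 * (L * K) + 1 \<le> cmod z"
    have "mat z *v v = M t *v v - (M t - mat z) *v v"
      by (simp add: matrix_vector_mult_diff_rdistrib)
    then have "norm (mat z *v v) \<le> norm (M t *v v) + norm ((M t - mat z) *v v)"
      by (simp only: norm_triangle_ineq4)
    moreover have "norm (mat z *v v) = cmod z * norm v"
      by (simp add: mat_mult_vec norm_vec_def norm_mult L2_set_right_distrib)
    moreover have "norm (M t *v v) \<le> L * norm v * K"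
      using K(1) a[OF t] by (intro order_trans[OF K(2)] mult_right_mono L) (auto simp: abs_le_iff)
    ultimately have "(cmod z - L * K) * norm v \<le> norm ((M t - mat z) *v v)"
      by (simp add: algebra_simps)
    moreover have "(1 + cmod z) / 2 * norm v \<le> (cmod z - L * K) * norm v"
      using z by (intro mult_right_mono) auto
    ultimately show "(1 + cmod z) * norm v \<le> 2 * norm ((M t - mat z) *v v)"
      by simp
  qed
qed

text \<open>Coercivity handles large z; the remaining parameters form a compact set. The general set
  \<open>S\<close> covers both a closed strip at a fixed time, for the Hardy property, and the real
  line over a time window, for continuity in time.\<close>

lemma resolvent_bound:
  fixes S :: "(real \<times> complex) set"
  assumes S: "closed S" "bounded (fst ` S)"
    and inv: "\<And>t z. (t, z) \<in> S \<Longrightarrow> invertible (M t - mat z)"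
  obtains C where "\<And>t z i j. (t, z) \<in> S \<Longrightarrow> cmod (R t z $ i $ j) \<le> C / (1 + cmod z)"
proof -
  obtain B where B: "\<And>t z v. t \<in> fst ` S \<Longrightarrow> B \<le> cmod z \<Longrightarrow> (1 + cmod z) * norm v \<le> 2 * norm ((M t - mat z) *v v)"
    using M_coercive[OF S(2)] by blast
  have ent: "cmod (A $ i $ j) \<le> norm A" for A :: "complex^'n^'n" and i j
    using Finite_Cartesian_Product.norm_nth_le[of A i] Finite_Cartesian_Product.norm_nth_le[of "A $ i" j] by simp
  have large: "cmod (R t z $ i $ j) \<le> 2 / (1 + cmod z)" if "(t, z) \<in> S" "cmod z \<ge> B" for t z i j
  proof -
    have "t \<in> fst ` S" using that(1) by force
    from B[OF this that(2), of "R t z *v axis j 1"]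
    have "(1 + cmod z) * norm (R t z *v axis j 1) \<le> 2"
      by (simp add: R_def matrix_inv_vector inv[OF that(1)])
    moreover have "cmod (R t z $ i $ j) \<le> norm (R t z *v axis j 1)"
      using Finite_Cartesian_Product.norm_nth_le[of "R t z *v axis j 1" i]
      by (simp add: matrix_vector_mult_def axis_def if_distrib cong: if_cong)
    ultimately have "(1 + cmod z) * cmod (R t z $ i $ j) \<le> 2"
      by (smt (verit) mult_left_mono norm_ge_zero)
    then show ?thesis
      by (subst pos_le_divide_eq) (auto intro: add_pos_nonneg simp: mult.commute)
  qed
  define S' where "S' = S \<inter> (UNIV \<times> cball 0 B)"
  have "compact S'"
  proof -
    have "S' \<subseteq> fst ` S \<times> cball 0 B"
      by (auto simp: S'_def) (metis fst_conv image_eqI)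
    moreover have "bounded (fst ` S \<times> cball (0::complex) B)"
      by (intro bounded_Times S(2) bounded_cball)
    ultimately have "bounded S'"
      using bounded_subset by blast
    moreover have "closed S'"
      unfolding S'_def by (intro closed_Int S(1) closed_Times closed_UNIV closed_cball)
    ultimately show ?thesis
      by (simp add: compact_eq_bounded_closed)
  qed
  moreover have "continuous_on S' (\<lambda>p. R (fst p) (snd p))"
    unfolding continuous_on_def R_def
  proof
    fix p assume p: "p \<in> S'"
    show "((\<lambda>p. matrix_inv (M (fst p) - mat (snd p))) \<longlongrightarrow> matrix_inv (M (fst p) - mat (snd p))) (at p within S')"
    proof (rule tendsto_matrix_inv)
      have "((\<lambda>p. M (fst p)) \<longlongrightarrow> M (fst p)) (at p within S')"
        unfolding M_affine by (intro tendsto_intros)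
      moreover have "((\<lambda>p. mat (snd p)) \<longlongrightarrow> (mat (snd p) :: complex^'n^'n)) (at p within S')"
        by (intro vec_tendstoI) (auto simp: mat_def intro!: tendsto_intros)
      ultimately show "((\<lambda>p. M (fst p) - mat (snd p)) \<longlongrightarrow> M (fst p) - mat (snd p)) (at p within S')"
        by (rule tendsto_diff)
      show "invertible (M (fst p) - mat (snd p))"
        using p by (intro inv) (auto simp: S'_def)
      show "\<forall>\<^sub>F p in at p within S'. invertible (M (fst p) - mat (snd p))"
        using inv by (auto simp: eventually_at_filter S'_def)
    qed
  qed
  ultimately have "bounded ((\<lambda>p. R (fst p) (snd p)) ` S')"
    using compact_continuous_image compact_imp_bounded by blast
  then obtain L where L: "\<And>p. p \<in> S' \<Longrightarrow> norm (R (fst p) (snd p)) \<le> L"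
    by (auto simp: bounded_iff)
  show thesis
  proof (rule that[of "max 2 (\<bar>L\<bar> * (1 + \<bar>B\<bar>))"])
    fix t z i j assume tz: "(t, z) \<in> S"
    show "cmod (R t z $ i $ j) \<le> max 2 (\<bar>L\<bar> * (1 + \<bar>B\<bar>)) / (1 + cmod z)"
    proof (cases "cmod z \<ge> B")
      case True
      show ?thesis
        by (rule order_trans[OF large[OF tz True]]) (intro divide_right_mono, auto intro: add_nonneg_nonneg)
    next
      case False
      then have "norm (R t z) \<le> L"
        using L[of "(t, z)"] tz by (simp add: S'_def)
      then have "cmod (R t z $ i $ j) \<le> \<bar>L\<bar>"
        using ent[of "R t z" i j] by simp
      then have "cmod (R t z $ i $ j) * (1 + cmod z) \<le> \<bar>L\<bar> * (1 + \<bar>B\<bar>)"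
        using False by (intro mult_mono) auto
      also have "\<dots> \<le> max 2 (\<bar>L\<bar> * (1 + \<bar>B\<bar>))"
        by simp
      finally show ?thesis
        by (subst pos_le_divide_eq) (auto intro: add_pos_nonneg)
    qed
  qed
qed

text \<open>The spectrum is the zero set of a continuous determinant and is bounded by coercivity,
  hence compact. Its largest imaginary part is attained, and it is negative because the closed upper
  half-plane is free of eigenvalues.\<close>

lemma invertible_strip:
  obtains \<eta> where "0 < \<eta>" "\<And>z. Im z > - \<eta> \<Longrightarrow> invertible (M t - mat z)"
proof -
  define Z where "Z = {z. det (M t - mat z) = 0}"
  have "bounded {t}" by simp
  then obtain B where B: "\<And>s z v. s \<in> {t} \<Longrightarrow> B \<le> cmod z \<Longrightarrow> (1 + cmod z) * norm v \<le> 2 * norm ((M s - mat z) *v v)"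
    using M_coercive by blast
  have cont: "continuous_on UNIV (\<lambda>z. det (M t - mat z))"
    unfolding continuous_on_def
    by (intro ballI tendsto_det) (auto simp: mat_def intro!: tendsto_intros)
  have "closed Z"
    unfolding Z_def by (rule closed_Collect_eq[OF cont continuous_on_const])
  moreover have "bounded Z"
    unfolding bounded_iff
  proof (intro exI ballI)
    fix z assume "z \<in> Z"
    then have "\<not> invertible (M t - mat z)"
      by (simp add: Z_def invertible_det_nz)
    then obtain v where v: "(M t - mat z) *v v = 0" "v \<noteq> 0"
      using invertibleI_kernel by blast
    have "\<not> B \<le> cmod z"
    proof
      assume "B \<le> cmod z"
      then have "(1 + cmod z) * norm v \<le> 0"
        using B[of t z v] v(1) by simp
      then show False
        using v(2) by (simp add: mult_le_0_iff add_nonneg_eq_0_iff) (smt (verit) norm_ge_zero)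
    qed
    then show "norm z \<le> B" by simp
  qed
  ultimately have "compact Z"
    by (simp add: compact_eq_bounded_closed)
  show thesis
  proof (cases "Z = {}")
    case True
    then show ?thesis
      by (intro that[of 1]) (auto simp: Z_def invertible_det_nz)
  next
    case False
    obtain z\<^sub>0 where z\<^sub>0: "z\<^sub>0 \<in> Z" "\<And>z. z \<in> Z \<Longrightarrow> Im z \<le> Im z\<^sub>0"
      using continuous_attains_sup[OF \<open>compact Z\<close> False continuous_on_Im[OF continuous_on_id]] by auto
    show ?thesis
    proof (rule that[of "- Im z\<^sub>0"])
      show "0 < - Im z\<^sub>0"
        using z\<^sub>0(1) invertible_M[of z\<^sub>0 t] by (cases "0 \<le> Im z\<^sub>0") (auto simp: Z_def invertible_det_nz)
      show "invertible (M t - mat z)" if "Im z > - (- Im z\<^sub>0)" for z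
        using z\<^sub>0(2)[of z] that by (auto simp: Z_def invertible_det_nz)
    qed
  qed
qed

lemma resolvent_holomorphic:
  assumes "\<And>z. z \<in> S \<Longrightarrow> invertible (M t - mat z)"
  shows "(\<lambda>z. R t z $ i $ j) holomorphic_on S"
proof -
  have "(\<lambda>z. det (\<chi> a b. if b = i then axis j 1 $ a else (M t - mat z) $ a $ b) / det (M t - mat z)) holomorphic_on S"
  proof (rule holomorphic_on_divide)
    have ent: "(\<lambda>z. (M t - mat z) $ a $ b) holomorphic_on S" for a b
      unfolding mat_def by (cases "a = b") (auto intro!: holomorphic_intros)
    show "(\<lambda>z. det (M t - mat z)) holomorphic_on S"
      unfolding det_def by (intro holomorphic_on_sum holomorphic_on_mult holomorphic_on_const holomorphic_on_prod ent)
    have "(\<lambda>z. (\<chi> a b. if b = i then axis j 1 $ a else (M t - mat z) $ a $ b) $ a $ b) holomorphic_on S" for a b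
      using ent[of a b] by (cases "b = i") auto
    then show "(\<lambda>z. det (\<chi> a b. if b = i then axis j 1 $ a else (M t - mat z) $ a $ b)) holomorphic_on S"
      unfolding det_def by (intro holomorphic_on_sum holomorphic_on_mult holomorphic_on_const holomorphic_on_prod)
    show "det (M t - mat z) \<noteq> 0" if "z \<in> S" for z
      using assms[OF that] by (simp add: invertible_det_nz)
  qed
  then show ?thesis
    by (rule holomorphic_transform) (simp add: R_def matrix_inv_entry assms)
qed

text \<open>With u = (M + i) b one has R u = b + (z + i) R b. Solving for R b isolates the leading
  term -b / (z + i); the rest, R u / (z + i), decays quadratically.\<close>

lemma resolvent_fourier:
  obtains g where "fourier_L2 (\<lambda>x. \<Sum>i\<in>UNIV. c $ i * (R t (of_real x) *v b) $ i) g" "\<And>\<xi>. \<xi> < 0 \<Longrightarrow> g \<xi> = 0"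
proof -
  obtain \<eta>\<^sub>0 where \<eta>\<^sub>0: "0 < \<eta>\<^sub>0" "\<And>z. Im z > - \<eta>\<^sub>0 \<Longrightarrow> invertible (M t - mat z)"
    using invertible_strip by blast
  define \<eta> where "\<eta> = min (\<eta>\<^sub>0 / 2) (1 / 2)"
  have \<eta>: "0 < \<eta>" "\<eta> \<le> 1 / 2" "\<eta> < \<eta>\<^sub>0"
    using \<eta>\<^sub>0(1) by (auto simp: \<eta>_def)
  have inv: "invertible (M t - mat z)" if "Im z \<ge> - \<eta>" for z
    using that \<eta>(3) by (intro \<eta>\<^sub>0(2)) auto
  have "closed ({t} \<times> {z. - \<eta> \<le> Im z})" "bounded (fst ` ({t} \<times> {z. - \<eta> \<le> Im z}))"
    by (auto intro!: closed_Times closed_halfspace_Im_ge bounded_subset[of "{t}"])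
  from resolvent_bound[OF this] inv
  obtain C where C: "\<And>z i j. - \<eta> \<le> Im z \<Longrightarrow> cmod (R t z $ i $ j) \<le> C / (1 + cmod z)"
    by auto
  define u where "u = (M t + mat \<i>) *v b"
  define k where "k z = (\<Sum>i\<in>UNIV. c $ i * (R t z *v u) $ i) / (z + \<i>)" for z
  define c\<^sub>0 where "c\<^sub>0 = - (\<Sum>i\<in>UNIV. c $ i * b $ i)"
  have nz: "z + \<i> \<noteq> 0" if "Im z > - 1" for z
    using that by (auto simp: complex_eq_iff)
  have decomp: "(\<Sum>i\<in>UNIV. c $ i * (R t z *v b) $ i) = c\<^sub>0 / (z + \<i>) + k z" if z: "Im z \<ge> - \<eta>" for z
  proof -
    have "M t + mat \<i> = (M t - mat z) + mat (z + \<i>)"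
      by (simp add: vec_eq_iff mat_def)
    then have "u = (M t - mat z) *v b + (\<chi> i. (z + \<i>) * b $ i)"
      by (simp only: u_def matrix_vector_mult_add_rdistrib mat_mult_vec)
    then have "R t z *v u = b + R t z *v (\<chi> i. (z + \<i>) * b $ i)"
      by (simp add: matrix_vector_right_distrib R_def matrix_inv_vector(2)[OF inv[OF z]])
    also have "R t z *v (\<chi> i. (z + \<i>) * b $ i) = (\<chi> i. (z + \<i>) * (R t z *v b) $ i)"
      by (simp add: vec_eq_iff matrix_vector_mult_def sum_distrib_left mult.left_commute)
    finally have "(\<Sum>i\<in>UNIV. c $ i * (R t z *v u) $ i) = - c\<^sub>0 + (z + \<i>) * (\<Sum>i\<in>UNIV. c $ i * (R t z *v b) $ i)"
      by (simp add: c\<^sub>0_def distrib_left sum.distrib sum_distrib_left mult.left_commute)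
    then show ?thesis
      using nz[of z] z \<eta>(2) by (simp add: k_def diff_divide_distrib)
  qed
  define D where "D = (\<Sum>i\<in>UNIV. cmod (c $ i)) * (\<Sum>j\<in>UNIV. cmod (u $ j))"
  have "cmod (k z) \<le> D * C * 5 / (1 + cmod z)\<^sup>2" if z: "Im z > - \<eta>" for z
  proof -
    have "cmod ((R t z *v u) $ i) \<le> (\<Sum>j\<in>UNIV. cmod (u $ j)) * (C / (1 + cmod z))" for i
    proof -
      have "cmod ((R t z *v u) $ i) = cmod (\<Sum>j\<in>UNIV. u $ j * R t z $ i $ j)"
        by (simp add: matrix_vector_mult_def mult.commute)
      then show ?thesis
        using norm_weighted_sum_le[of "R t z $ i" "C / (1 + cmod z)" u] C[of z i] z by simp
    qed
    then have "cmod (\<Sum>i\<in>UNIV. c $ i * (R t z *v u) $ i) \<le> (\<Sum>i\<in>UNIV. cmod (c $ i)) * ((\<Sum>j\<in>UNIV. cmod (u $ j)) * (C / (1 + cmod z)))"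
      by (rule norm_weighted_sum_le)
    also have "\<dots> = D * C / (1 + cmod z)"
      by (simp add: D_def)
    finally have 1: "cmod (\<Sum>i\<in>UNIV. c $ i * (R t z *v u) $ i) \<le> D * C / (1 + cmod z)" .
    have "0 \<le> D * C / (1 + cmod z)"
      using 1 norm_ge_zero order_trans by blast
    \<comment> \<open>The constant 1 + 2 (1 + b) / b for b = 1.\<close>
    have "1 + cmod z \<le> 5 * cmod (z + \<i>)"
      using norm_inverse_shifted_le[of 1 z] z \<eta>(2) by simp
    then have 2: "1 / cmod (z + \<i>) \<le> 5 / (1 + cmod z)"
      using nz[of z] z \<eta>(2) by (simp add: field_simps add_pos_nonneg)
    have "cmod (k z) = cmod (\<Sum>i\<in>UNIV. c $ i * (R t z *v u) $ i) * (1 / cmod (z + \<i>))"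
      by (simp add: k_def norm_divide)
    also have "\<dots> \<le> (D * C / (1 + cmod z)) * (5 / (1 + cmod z))"
      using 1 2 \<open>0 \<le> D * C / (1 + cmod z)\<close> by (intro mult_mono) auto
    finally show ?thesis
      by (simp add: power2_eq_square)
  qed
  moreover have "k holomorphic_on {z. Im z > - \<eta>}"
    unfolding k_def matrix_vector_mult_def using nz \<eta>(2) inv
    by (auto intro!: holomorphic_intros resolvent_holomorphic)
  ultimately obtain g where g: "fourier_L2 (\<lambda>x. c\<^sub>0 / (of_real x + \<i>) + k (of_real x)) g" "\<And>\<xi>. \<xi> < 0 \<Longrightarrow> g \<xi> = 0"
    using fourier_L2_hardy[of k \<eta> "D * C * 5" c\<^sub>0] \<eta>(1) by blast
  show thesis
    using g \<eta>(1) decomp[of "of_real _"] by (intro that[of g]) simp_all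
qed

end

section \<open>Multisolitons solve the equation\<close>

lemma continuous_on_of_derivative:
  assumes "\<And>x. (f has_vector_derivative f' x) (at x)"
  shows "continuous_on UNIV f"
  using assms by (intro continuous_at_imp_continuous_on ballI) (rule has_vector_derivative_continuous)

text \<open>Dominated convergence along arbitrary sequences of times. Dropping finitely many terms
  places all of them in the window where the decay bound is uniform.\<close>

lemma L2_tendsto_at:
  assumes cont: "\<And>s. continuous_on UNIV (F s)"
    and bound: "\<And>s x. \<bar>s - t\<bar> \<le> 1 \<Longrightarrow> cmod (F s x) \<le> C / (1 + \<bar>x\<bar>)"
    and lim: "\<And>x. ((\<lambda>s. F s x) \<longlongrightarrow> F t x) (at t)"
  shows "L2_tendsto F (F t) (at (t::real))"
  unfolding L2_tendsto_def tendsto_at_iff_sequentially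
proof (intro allI impI)
  fix X :: "nat \<Rightarrow> real"
  assume X: "\<forall>i. X i \<in> UNIV - {t}" "X \<longlonglongrightarrow> t"
  obtain n\<^sub>0 where n\<^sub>0: "\<And>n. n \<ge> n\<^sub>0 \<Longrightarrow> \<bar>X n - t\<bar> \<le> 1"
    using X(2)[unfolded LIMSEQ_iff, rule_format, of 1] by (auto intro: less_imp_le)
  have [measurable]: "F s \<in> borel_measurable borel" for s
    using cont borel_measurable_continuous_onI by blast
  have "L2_tendsto (\<lambda>n. F (X (n + n\<^sub>0))) (F t) sequentially"
  proof (rule L2_tendsto_dominated)
    show "integrable lborel (\<lambda>x. 4 * C\<^sup>2 * (1 / (1 + x\<^sup>2)))"
      by (intro integrable_mult_right integrable_one_over_one_plus_square)
    show "AE x in lborel. (cmod (F (X (n + n\<^sub>0)) x - F t x))\<^sup>2 \<le> 4 * C\<^sup>2 * (1 / (1 + x\<^sup>2))" for n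
    proof (rule AE_I2)
      fix x
      have "cmod (F (X (n + n\<^sub>0)) x - F t x) \<le> C / (1 + \<bar>x\<bar>) + C / (1 + \<bar>x\<bar>)"
        using n\<^sub>0 by (intro order_trans[OF norm_triangle_ineq4] add_mono bound) auto
      then have "(cmod (F (X (n + n\<^sub>0)) x - F t x))\<^sup>2 \<le> (2 * C / (1 + \<bar>x\<bar>))\<^sup>2"
        by (intro power_mono) auto
      also have "\<dots> = 4 * C\<^sup>2 * (1 / (1 + \<bar>x\<bar>)\<^sup>2)"
        by (simp add: power_divide power_mult_distrib)
      also have "\<dots> \<le> 4 * C\<^sup>2 * (1 / (1 + x\<^sup>2))"
        using one_plus_norm_square_ge[of "of_real x"]
        by (intro mult_left_mono divide_left_mono mult_pos_pos) (auto intro: add_pos_nonneg)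
      finally show "(cmod (F (X (n + n\<^sub>0)) x - F t x))\<^sup>2 \<le> 4 * C\<^sup>2 * (1 / (1 + x\<^sup>2))" .
    qed
    show "AE x in lborel. (\<lambda>n. F (X (n + n\<^sub>0)) x) \<longlonglongrightarrow> F t x"
    proof (rule AE_I2)
      fix x
      have "((\<lambda>s. F s x) \<circ> X) \<longlonglongrightarrow> F t x"
        using lim[of x] X unfolding tendsto_at_iff_sequentially by blast
      then show "(\<lambda>n. F (X (n + n\<^sub>0)) x) \<longlonglongrightarrow> F t x"
        unfolding o_def by (rule LIMSEQ_ignore_initial_segment)
    qed
  qed measurable
  then show "((\<lambda>s. \<integral>\<^sup>+ x. ennreal ((cmod (F s x - F t x))\<^sup>2) \<partial>lborel) \<circ> X) \<longlonglongrightarrow> 0"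
    unfolding L2_tendsto_def o_def by (rule LIMSEQ_offset)
qed

lemma smooth_derivative:
  assumes "smooth \<phi>"
  shows "(\<phi> has_vector_derivative vector_derivative \<phi> (at x)) (at x)"
    and "continuous_on UNIV (\<lambda>x. vector_derivative \<phi> (at x))"
proof -
  obtain D where D: "D 0 = \<phi>" "\<And>k t. (D k has_vector_derivative D (Suc k) t) (at t)"
    using assms unfolding smooth_def by auto
  have "(\<phi> has_vector_derivative D (Suc 0) x) (at x)" for x
    using D(2)[of 0 x] D(1) by simp
  then have *: "vector_derivative \<phi> (at x) = D (Suc 0) x" for x
    by (rule vector_derivative_at)
  show "(\<phi> has_vector_derivative vector_derivative \<phi> (at x)) (at x)"
    unfolding * using D(2)[of 0 x] D(1) by simp
  show "continuous_on UNIV (\<lambda>x. vector_derivative \<phi> (at x))"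
    unfolding * by (rule continuous_on_of_derivative[OF D(2)])
qed

lemma test_function_support:
  assumes "test_function \<phi>"
  obtains a where "0 < a" "\<And>x. a \<le> \<bar>x\<bar> \<Longrightarrow> \<phi> x = 0" "\<And>x. a \<le> \<bar>x\<bar> \<Longrightarrow> vector_derivative \<phi> (at x) = 0"
proof -
  let ?K = "closure {x. \<phi> x \<noteq> 0}"
  have "bounded ?K"
    using assms by (simp add: test_function_def compact_imp_bounded)
  then obtain a where a: "\<And>x. x \<in> ?K \<Longrightarrow> \<bar>x\<bar> \<le> a"
    by (auto simp: bounded_iff)
  have out: "x \<notin> ?K" if "\<bar>a\<bar> + 1 \<le> \<bar>x\<bar>" for x
    using a[of x] that by auto
  show thesis
  proof (rule that[of "\<bar>a\<bar> + 1"])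
    fix x assume x: "\<bar>a\<bar> + 1 \<le> \<bar>x\<bar>"
    show "\<phi> x = 0"
      using out[OF x] closure_subset[of "{x. \<phi> x \<noteq> 0}"] by auto
    have "(\<phi> has_vector_derivative 0) (at x)"
    proof (rule has_vector_derivative_transform_within_open)
      show "((\<lambda>x. 0) has_vector_derivative 0) (at x)" by simp
      show "open (- ?K)" by auto
      show "x \<in> - ?K" using out[OF x] by simp
      show "0 = \<phi> y" if "y \<in> - ?K" for y
        using that closure_subset[of "{x. \<phi> x \<noteq> 0}"] by auto
    qed
    then show "vector_derivative \<phi> (at x) = 0"
      by (rule vector_derivative_at)
  qed auto
qed

lemma weak_L2_derivative_classical:
  assumes f: "\<And>x. (f has_vector_derivative g x) (at x)" and cont: "continuous_on UNIV g" and "g \<in> L2_space"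
  shows "weak_L2_derivative f g"
  unfolding weak_L2_derivative_def
proof (intro conjI allI impI)
  show "g \<in> L2_space" by fact
  fix \<phi> assume \<phi>: "test_function \<phi>"
  let ?d = "\<lambda>x. vector_derivative \<phi> (at x)"
  have sm: "smooth \<phi>" using \<phi> by (simp add: test_function_def)
  note d = smooth_derivative[OF sm]
  obtain a where a: "0 < a" "\<And>x. a \<le> \<bar>x\<bar> \<Longrightarrow> \<phi> x = 0" "\<And>x. a \<le> \<bar>x\<bar> \<Longrightarrow> ?d x = 0"
    using test_function_support[OF \<phi>] by blast
  have cf: "continuous_on UNIV f"
    by (rule continuous_on_of_derivative[OF f])
  have c\<phi>: "continuous_on UNIV \<phi>"
    by (rule continuous_on_of_derivative[OF d(1)])
  have ind: "indicator {-a..a} x *\<^sub>R (h x :: complex) = h x" if "\<And>x. a \<le> \<bar>x\<bar> \<Longrightarrow> h x = 0" for h x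
    using that[of x] by (auto simp: indicator_def)
  have int: "integrable lborel h" if "continuous_on UNIV h" "\<And>x. a \<le> \<bar>x\<bar> \<Longrightarrow> h x = 0" for h :: "real \<Rightarrow> complex"
    using borel_integrable_compact[of "{-a..a}" h] continuous_on_subset[OF that(1)] ind[of h, OF that(2)] by simp
  have 1: "integrable lborel (\<lambda>x. f x * ?d x)"
    by (intro int continuous_on_mult cf d(2)) (simp add: a)
  have 2: "integrable lborel (\<lambda>x. g x * \<phi> x)"
    by (intro int continuous_on_mult cont c\<phi>) (simp add: a)
  have "(LINT x|lborel. indicator {-a..a} x *\<^sub>R (f x * ?d x + g x * \<phi> x)) = f a * \<phi> a - f (- a) * \<phi> (- a)"
  proof (rule integral_FTC_Icc)
    show "- a \<le> a" using a(1) by simp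
    show "((\<lambda>x. f x * \<phi> x) has_vector_derivative f x * ?d x + g x * \<phi> x) (at x within {-a..a})" for x
      by (rule has_vector_derivative_mult) (rule has_vector_derivative_at_within, rule f, rule has_vector_derivative_at_within, rule d(1))
    show "continuous_on {-a..a} (\<lambda>x. f x * ?d x + g x * \<phi> x)"
      by (intro continuous_on_add continuous_on_mult; rule continuous_on_subset[OF _ subset_UNIV]) (fact cf d(2) cont c\<phi>)+
  qed
  also have "\<dots> = 0"
    using a by simp
  also have "(\<lambda>x. indicator {-a..a} x *\<^sub>R (f x * ?d x + g x * \<phi> x)) = (\<lambda>x. f x * ?d x + g x * \<phi> x)"
    by (intro ext ind) (simp add: a)
  finally have "(LINT x|lborel. f x * ?d x) + (LINT x|lborel. g x * \<phi> x) = 0"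
    using 1 2 by simp
  then show "(LINT x|lborel. f x * ?d x) = - (LINT x|lborel. g x * \<phi> x)"
    by (simp add: add_eq_0_iff2)
qed

context soliton begin

abbreviation "r t x \<equiv> R t (complex_of_real x) *v vec 1"

lemma M_affine_x: "M t - mat (of_real x) = M t + x *\<^sub>R (- mat 1)"
  by (simp add: mat_of_real)

lemma M_affine_t: "M t - mat z = (multisoliton_W l m \<rho> \<gamma> - mat z) + t *\<^sub>R (2 *\<^sub>R Lam)"
  by (simp add: M_affine)

lemma R_derivative_x:
  "((\<lambda>x. R t (of_real x)) has_vector_derivative R t (of_real x) ** R t (of_real x)) (at x)"
proof -
  have "((\<lambda>x. R t (of_real x)) has_vector_derivative - (R t (of_real x) ** (- mat 1) ** R t (of_real x))) (at x)"
    unfolding R_def M_affine_x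
    by (rule has_vector_derivative_matrix_inv) (simp only: M_affine_x[symmetric] invertible_M Im_complex_of_real order_refl)
  then show ?thesis
    by (simp add: bounded_bilinear.minus_right[OF bounded_bilinear_matrix_mult] bounded_bilinear.minus_left[OF bounded_bilinear_matrix_mult])
qed

lemma R_derivative_t:
  "((\<lambda>t. R t (of_real x)) has_vector_derivative - 2 *\<^sub>R (R t (of_real x) ** Lam ** R t (of_real x))) (at t)"
proof -
  have "((\<lambda>t. R t (of_real x)) has_vector_derivative - (R t (of_real x) ** (2 *\<^sub>R Lam) ** R t (of_real x))) (at t)"
    unfolding R_def M_affine_t
    by (rule has_vector_derivative_matrix_inv) (simp only: M_affine_t[symmetric] invertible_M Im_complex_of_real order_refl)
  then show ?thesis
    by (simp add: bounded_bilinear.scaleR_right[OF bounded_bilinear_matrix_mult] bounded_bilinear.scaleR_left[OF bounded_bilinear_matrix_mult])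
qed

lemma has_vector_derivative_matrix_vector:
  fixes A :: "real \<Rightarrow> complex^'n^'n"
  assumes "(A has_vector_derivative A') (at x)"
  shows "((\<lambda>x. A x *v v) has_vector_derivative A' *v v) (at x)"
  by (rule bounded_linear.has_vector_derivative[OF bounded_bilinear.bounded_linear_left[OF bounded_bilinear_matrix_vector_mult] assms])

lemma r_derivative_x: "((\<lambda>x. r t x) has_vector_derivative R t (of_real x) *v r t x) (at x)"
  using has_vector_derivative_matrix_vector[OF R_derivative_x] by (simp add: matrix_vector_mul_assoc)

lemma Rr_derivative_x:
  "((\<lambda>x. R t (of_real x) *v r t x) has_vector_derivative 2 *\<^sub>R (R t (of_real x) *v (R t (of_real x) *v r t x))) (at x)"
proof -
  have "((\<lambda>x. R t (of_real x) *v r t x) has_vector_derivative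
      (R t (of_real x) *v (R t (of_real x) *v r t x) + (R t (of_real x) ** R t (of_real x)) *v r t x)) (at x)"
    by (rule bounded_bilinear.has_vector_derivative[OF bounded_bilinear_matrix_vector_mult R_derivative_x r_derivative_x])
  then show ?thesis
    by (simp only: scaleR_2 matrix_vector_mul_assoc matrix_mul_assoc)
qed

lemma r_derivative_t: "((\<lambda>t. r t x) has_vector_derivative - 2 *\<^sub>R (R t (of_real x) *v (Lam *v r t x))) (at t)"
  using has_vector_derivative_matrix_vector[OF R_derivative_t]
  by (simp add: matrix_vector_mul_assoc bounded_bilinear.scaleR_left[OF bounded_bilinear_matrix_vector_mult]
      bounded_bilinear.minus_left[OF bounded_bilinear_matrix_vector_mult] matrix_mul_assoc)

lemma Lam_component: "(Lam *v u) $ i = of_real (l $ i) * u $ i"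
  by (simp add: Lam_def matrix_vector_mult_def if_distrib[of "\<lambda>x. x * _"] cong: if_cong)

lemma M_commutator_vector:
  "Lam *v ((M t - mat z) *v u) - (M t - mat z) *v (Lam *v u) = (\<chi> i. \<i> * ((\<Sum>j\<in>UNIV. u $ j) - u $ i))"
proof -
  have "(Lam *v (M t *v u)) $ i - (M t *v (Lam *v u)) $ i = \<i> * ((\<Sum>j\<in>UNIV. u $ j) - u $ i)" for i
  proof -
    have "(Lam *v (M t *v u)) $ i - (M t *v (Lam *v u)) $ i
        = (\<Sum>j\<in>UNIV. of_real (l $ i) * M t $ i $ j * u $ j - M t $ i $ j * of_real (l $ j) * u $ j)"
      by (simp add: matrix_vector_mult_def[of "M t"] Lam_component sum_distrib_left sum_subtractf mult.assoc)
    also have "\<dots> = (\<Sum>j\<in>UNIV. \<i> * u $ j - (if j = i then \<i> * u $ j else 0))"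
      unfolding M_commutator by (intro sum.cong refl) (simp add: algebra_simps)
    also have "\<dots> = \<i> * ((\<Sum>j\<in>UNIV. u $ j) - u $ i)"
      by (simp add: sum_subtractf sum_distrib_left right_diff_distrib)
    finally show ?thesis .
  qed
  then show ?thesis
    by (simp add: vec_eq_iff matrix_vector_mult_diff_rdistrib matrix_vector_mult_diff_distrib mat_mult_vec Lam_component algebra_simps)
qed

text \<open>What remains of the equation once q_t, q_xx and the derivative of the projection are
  written by resolvents. It is row m of R [Lambda, A] y with A = M - x and y = R r, where the stray
  term Lambda y vanishes because l_m = 0.\<close>

lemma soliton_identity:
  "(\<Sum>i\<in>UNIV. (R t (of_real x) *v r t x) $ i) * r t x $ m
     = (R t (of_real x) *v (R t (of_real x) *v r t x)) $ m - \<i> * (R t (of_real x) *v (Lam *v r t x)) $ m"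
proof -
  let ?R = "R t (of_real x)" and ?A = "M t - mat (of_real x)" and ?r = "r t x"
  define y where "y = ?R *v ?r"
  have inv: "invertible ?A" by (simp add: invertible_M)
  have "?A *v y = ?r"
    by (simp add: y_def R_def matrix_inv_vector[OF inv])
  then have "Lam *v ?r - ?A *v (Lam *v y) = (\<chi> i. \<i> * ((\<Sum>j\<in>UNIV. y $ j) - y $ i))"
    using M_commutator_vector[of t "of_real x" y] by simp
  then have "?R *v (Lam *v ?r - ?A *v (Lam *v y)) = ?R *v (\<chi> i. \<i> * ((\<Sum>j\<in>UNIV. y $ j) - y $ i))"
    by simp
  then have "?R *v (Lam *v ?r) - Lam *v y = ?R *v (\<chi> i. \<i> * ((\<Sum>j\<in>UNIV. y $ j) - y $ i))"
    unfolding matrix_vector_mult_diff_distrib by (simp add: R_def matrix_inv_vector[OF inv])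
  then have "(?R *v (Lam *v ?r)) $ m - (Lam *v y) $ m = (?R *v (\<chi> i. \<i> * ((\<Sum>j\<in>UNIV. y $ j) - y $ i))) $ m"
    by (metis vector_minus_component)
  moreover have "(?R *v (\<chi> i. \<i> * (a - y $ i))) $ m = \<i> * (a * ?r $ m - (?R *v y) $ m)" for a
    by (simp add: matrix_vector_mult_def sum_distrib_left sum_subtractf algebra_simps)
  moreover have "(Lam *v y) $ m = 0"
    by (simp add: Lam_component lm)
  ultimately have "(?R *v (Lam *v ?r)) $ m = \<i> * ((\<Sum>j\<in>UNIV. y $ j) * ?r $ m - (?R *v y) $ m)"
    by simp
  then have "\<i> * (?R *v (Lam *v ?r)) $ m = - ((\<Sum>j\<in>UNIV. y $ j) * ?r $ m - (?R *v y) $ m)"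
    by simp
  then show ?thesis
    unfolding y_def[symmetric] by simp
qed

text \<open>Pair r with (M - x) r = 1: the term x |r|^2 is real, so the imaginary part is that of
  \<open>M_quadratic\<close>. Multiplied by 2 it says |q|^2 = P + cnj P.\<close>

lemma Im_sum_r: "Im (\<Sum>i\<in>UNIV. r t x $ i) = \<rho> * (cmod (r t x $ m))\<^sup>2"
proof -
  have "(M t - mat (of_real x)) *v r t x = vec 1"
    by (simp add: R_def matrix_inv_vector invertible_M)
  then have "M t *v r t x = (\<chi> i. 1 + of_real x * r t x $ i)"
    by (simp add: matrix_vector_mult_diff_rdistrib mat_mult_vec vec_eq_iff algebra_simps)
  then have "(\<Sum>i\<in>UNIV. cnj (r t x $ i) * (M t *v r t x) $ i) = (\<Sum>i\<in>UNIV. cnj (r t x $ i) + of_real (x * (cmod (r t x $ i))\<^sup>2))"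
    by (simp add: distrib_left complex_norm_square mult_ac del: of_real_power)
  then have "Im (\<Sum>i\<in>UNIV. cnj (r t x $ i) * (M t *v r t x) $ i) = - Im (\<Sum>i\<in>UNIV. r t x $ i)"
    by (simp add: sum_negf)
  then show ?thesis
    using M_quadratic[of "r t x" t] by simp
qed

definition amp :: "real \<Rightarrow> complex" where "amp \<phi> = of_real (sqrt (2 * \<rho>)) * exp (\<i> * of_real \<phi>)"

lemma cmod_amp: "(cmod (amp \<phi>))\<^sup>2 = 2 * \<rho>"
  using rho by (simp add: amp_def norm_mult norm_exp_eq_Re)

lemma multisoliton_eq: "multisoliton l m \<rho> \<gamma> \<phi> t x = amp \<phi> * r t x $ m"
  by (simp add: multisoliton_def amp_def R_def)

definition P :: "real \<Rightarrow> real \<Rightarrow> complex" where "P t x = - \<i> * (\<Sum>i\<in>UNIV. r t x $ i)"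

lemma cmod_multisoliton: "of_real ((cmod (multisoliton l m \<rho> \<gamma> \<phi> t x))\<^sup>2) = P t x + cnj (P t x)"
  unfolding complex_add_cnj multisoliton_eq norm_mult power_mult_distrib cmod_amp
  using Im_sum_r[of t x] by (simp add: P_def)

lemma P_szego: "szego_projection (\<lambda>x. of_real ((cmod (multisoliton l m \<rho> \<gamma> \<phi> t x))\<^sup>2)) (P t)"
proof -
  obtain g where g: "fourier_L2 (\<lambda>x. \<Sum>i\<in>UNIV. (vec (- \<i>) :: complex^'n) $ i * (R t (of_real x) *v vec 1) $ i) g" "\<And>\<xi>. \<xi> < 0 \<Longrightarrow> g \<xi> = 0"
    using resolvent_fourier by blast
  have "(\<lambda>x. \<Sum>i\<in>UNIV. (vec (- \<i>) :: complex^'n) $ i * (R t (of_real x) *v vec 1) $ i) = P t"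
    by (simp add: P_def fun_eq_iff sum_distrib_left sum_negf)
  then show ?thesis
    unfolding cmod_multisoliton using szego_projection_add_cnj[of "P t" g] g by simp
qed

lemma multisoliton_szego: "szego_projection (multisoliton l m \<rho> \<gamma> \<phi> t) (multisoliton l m \<rho> \<gamma> \<phi> t)"
proof -
  obtain g where g: "fourier_L2 (\<lambda>x. \<Sum>i\<in>UNIV. (axis m (amp \<phi>) :: complex^'n) $ i * (R t (of_real x) *v vec 1) $ i) g" "\<And>\<xi>. \<xi> < 0 \<Longrightarrow> g \<xi> = 0"
    using resolvent_fourier by blast
  have "(\<lambda>x. \<Sum>i\<in>UNIV. (axis m (amp \<phi>) :: complex^'n) $ i * (R t (of_real x) *v vec 1) $ i) = multisoliton l m \<rho> \<gamma> \<phi> t"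
    by (simp add: multisoliton_eq fun_eq_iff axis_def if_distrib[of "\<lambda>x. x * _"] cong: if_cong)
  then show ?thesis
    using szego_projection_self[of "multisoliton l m \<rho> \<gamma> \<phi> t" g] g by simp
qed

lemma multisoliton_ccm: "ccm_solution (multisoliton l m \<rho> \<gamma> \<phi>)"
  unfolding ccm_solution_def
proof (intro exI conjI allI)
  fix t x
  let ?R = "R t (of_real x)" and ?r = "r t x" and ?q = "multisoliton l m \<rho> \<gamma> \<phi>"
  show "szego_projection (\<lambda>x. of_real ((cmod (?q t x))\<^sup>2)) (P t)"
    by (rule P_szego)
  show "((\<lambda>s. ?q s x) has_vector_derivative amp \<phi> * (- 2 *\<^sub>R (?R *v (Lam *v ?r))) $ m) (at t)"
    unfolding multisoliton_eq
    by (intro has_vector_derivative_mult_right has_vector_derivative_vec_nth r_derivative_t)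
  show "(?q t has_vector_derivative amp \<phi> * (?R *v ?r) $ m) (at x)"
    unfolding multisoliton_eq[abs_def]
    by (intro has_vector_derivative_mult_right has_vector_derivative_vec_nth r_derivative_x)
  show "((\<lambda>x. amp \<phi> * (R t (of_real x) *v r t x) $ m) has_vector_derivative amp \<phi> * (2 *\<^sub>R (?R *v (?R *v ?r))) $ m) (at x)"
    by (intro has_vector_derivative_mult_right has_vector_derivative_vec_nth Rr_derivative_x)
  show "(P t has_vector_derivative - \<i> * (\<Sum>i\<in>UNIV. (?R *v ?r) $ i)) (at x)"
    unfolding P_def[abs_def]
    by (intro has_vector_derivative_mult_right has_vector_derivative_sum has_vector_derivative_vec_nth r_derivative_x)
  show "\<i> * (amp \<phi> * (- 2 *\<^sub>R (?R *v (Lam *v ?r))) $ m) + amp \<phi> * (2 *\<^sub>R (?R *v (?R *v ?r))) $ m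
     - 2 * \<i> * ?q t x * (- \<i> * (\<Sum>i\<in>UNIV. (?R *v ?r) $ i)) = 0"
  proof -
    have "2 * \<i> * ?q t x * (- \<i> * (\<Sum>i\<in>UNIV. (?R *v ?r) $ i)) = amp \<phi> * (2 * ((\<Sum>i\<in>UNIV. (?R *v ?r) $ i) * ?r $ m))"
      unfolding multisoliton_eq by simp
    also have "\<dots> = amp \<phi> * (2 * ((?R *v (?R *v ?r)) $ m - \<i> * (?R *v (Lam *v ?r)) $ m))"
      unfolding soliton_identity ..
    finally show ?thesis
      by (simp add: algebra_simps scaleR_conv_of_real[where 'a = complex])
  qed
qed

text \<open>The decay of q and of its derivative on the time window of \<open>L2_tendsto_at\<close>;
  one power of 1 / (1 + |x|) is enough for an L2 majorant.\<close>

lemma r_bound: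
  obtains C where "\<And>s x. \<bar>s - t\<bar> \<le> 1 \<Longrightarrow> cmod (r s x $ i) \<le> C / (1 + \<bar>x\<bar>)"
    "\<And>s x. \<bar>s - t\<bar> \<le> 1 \<Longrightarrow> cmod ((R s (of_real x) *v r s x) $ i) \<le> C / (1 + \<bar>x\<bar>)"
proof -
  define S where "S = {t - 1..t + 1} \<times> {z. Im z = 0}"
  have "closed S" "bounded (fst ` S)"
    unfolding S_def by (auto intro!: closed_Times closed_Collect_eq continuous_intros bounded_subset[of "{t - 1..t + 1}"])
  moreover have "invertible (M t - mat z)" if "(t, z) \<in> S" for t z
    using that by (auto simp: S_def invertible_M)
  ultimately obtain C where C: "\<And>t z i j. (t, z) \<in> S \<Longrightarrow> cmod (R t z $ i $ j) \<le> C / (1 + cmod z)"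
    using resolvent_bound[of S] by blast
  define N where "N = real CARD('n)"
  have C': "cmod (R s (of_real x) $ i $ j) \<le> C / (1 + \<bar>x\<bar>)" if "\<bar>s - t\<bar> \<le> 1" for s x i j
    using C[of s "of_real x"] that by (auto simp: S_def abs_le_iff)
  have 1: "cmod (r s x $ i) \<le> N * (C / (1 + \<bar>x\<bar>))" if "\<bar>s - t\<bar> \<le> 1" for s x i
    using norm_weighted_sum_le[of "R s (of_real x) $ i" "C / (1 + \<bar>x\<bar>)" "vec 1"] C'[OF that]
    by (simp add: matrix_vector_mult_def N_def)
  have "0 \<le> C"
    using order_trans[OF norm_ge_zero C'[of t 0 i i]] by simp
  have 2: "cmod ((R s (of_real x) *v r s x) $ i) \<le> N * C * (N * C) / (1 + \<bar>x\<bar>)" if "\<bar>s - t\<bar> \<le> 1" for s x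
  proof -
    have "cmod ((R s (of_real x) *v r s x) $ i) = cmod (\<Sum>j\<in>UNIV. r s x $ j * R s (of_real x) $ i $ j)"
      by (simp add: matrix_vector_mult_def mult.commute)
    also have "\<dots> \<le> (\<Sum>j\<in>UNIV. cmod (r s x $ j)) * (C / (1 + \<bar>x\<bar>))"
      by (rule norm_weighted_sum_le) (rule C'[OF that])
    also have "\<dots> \<le> (\<Sum>j\<in>(UNIV :: 'n set). N * C) * (C / (1 + \<bar>x\<bar>))"
    proof (intro mult_right_mono sum_mono)
      fix j
      have "C / (1 + \<bar>x\<bar>) \<le> C"
        using \<open>0 \<le> C\<close> by (simp add: divide_le_eq mult_le_cancel_left1 add_pos_nonneg)
      then have "N * (C / (1 + \<bar>x\<bar>)) \<le> N * C"
        by (intro mult_left_mono) (auto simp: N_def)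
      with 1[OF that, of x j] show "cmod (r s x $ j) \<le> N * C"
        by (rule order_trans)
    qed (use \<open>0 \<le> C\<close> in simp)
    finally show ?thesis by (simp add: N_def mult_ac)
  qed
  show thesis
  proof (rule that[of "max (N * C) (N * C * (N * C))"])
    fix s x assume s: "\<bar>s - t\<bar> \<le> 1"
    show "cmod (r s x $ i) \<le> max (N * C) (N * C * (N * C)) / (1 + \<bar>x\<bar>)"
      using 1[OF s, of x i] by (rule order_trans) (simp add: divide_right_mono)
    show "cmod ((R s (of_real x) *v r s x) $ i) \<le> max (N * C) (N * C * (N * C)) / (1 + \<bar>x\<bar>)"
      using 2[OF s, of x] by (rule order_trans) (simp add: divide_right_mono)
  qed
qed

lemma multisoliton_continuous_into_H1_plus: "continuous_into_H1_plus (multisoliton l m \<rho> \<gamma> \<phi>)"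
proof -
  let ?q = "multisoliton l m \<rho> \<gamma> \<phi>"
  define p where "p t x = amp \<phi> * (R t (of_real x) *v r t x) $ m" for t x
  have dq: "(?q t has_vector_derivative p t x) (at x)" for t x
    unfolding multisoliton_eq[abs_def] p_def
    by (intro has_vector_derivative_mult_right has_vector_derivative_vec_nth r_derivative_x)
  have cq: "continuous_on UNIV (?q t)" for t
    by (rule continuous_on_of_derivative[OF dq])
  have cp: "continuous_on UNIV (p t)" for t
  proof (rule continuous_on_of_derivative)
    show "(p t has_vector_derivative amp \<phi> * (2 *\<^sub>R (R t (of_real x) *v (R t (of_real x) *v r t x))) $ m) (at x)" for x
      unfolding p_def[abs_def]
      by (intro has_vector_derivative_mult_right has_vector_derivative_vec_nth Rr_derivative_x)
  qed
  have bounds: "\<exists>C. \<forall>s x. \<bar>s - t\<bar> \<le> 1 \<longrightarrow> cmod (?q s x) \<le> C / (1 + \<bar>x\<bar>) \<and> cmod (p s x) \<le> C / (1 + \<bar>x\<bar>)" for t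
  proof -
    obtain C where C: "\<And>s x. \<bar>s - t\<bar> \<le> 1 \<Longrightarrow> cmod (r s x $ m) \<le> C / (1 + \<bar>x\<bar>)"
      "\<And>s x. \<bar>s - t\<bar> \<le> 1 \<Longrightarrow> cmod ((R s (of_real x) *v r s x) $ m) \<le> C / (1 + \<bar>x\<bar>)"
      using r_bound[of t m] by blast
    show ?thesis
    proof (intro exI[of _ "cmod (amp \<phi>) * C"] allI impI)
      fix s x assume s: "\<bar>s - t\<bar> \<le> 1"
      show "cmod (?q s x) \<le> cmod (amp \<phi>) * C / (1 + \<bar>x\<bar>) \<and> cmod (p s x) \<le> cmod (amp \<phi>) * C / (1 + \<bar>x\<bar>)"
        using mult_left_mono[OF C(1)[OF s], of "cmod (amp \<phi>)" x] mult_left_mono[OF C(2)[OF s], of "cmod (amp \<phi>)" x]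
        by (simp add: multisoliton_eq p_def norm_mult)
    qed
  qed
  have L2: "?q t \<in> L2_space" "p t \<in> L2_space" for t
  proof -
    obtain C where C: "\<And>s x. \<bar>s - t\<bar> \<le> 1 \<Longrightarrow> cmod (?q s x) \<le> C / (1 + \<bar>x\<bar>) \<and> cmod (p s x) \<le> C / (1 + \<bar>x\<bar>)"
      using bounds[of t] by blast
    show "?q t \<in> L2_space" "p t \<in> L2_space"
      using C[of t] by (auto intro!: L2_space_linear_decay[where C = C] cq cp)
  qed
  have wd: "weak_L2_derivative (?q t) (p t)" for t
    by (intro weak_L2_derivative_classical dq cp L2)
  have "?q t \<in> H1_plus" for t
    unfolding H1_plus_def H1_space_def L2_plus_def using L2 wd multisoliton_szego by blast
  moreover have "L2_tendsto ?q (?q t) (at t) \<and> L2_tendsto p (p t) (at t)" for t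
  proof -
    obtain C where C: "\<And>s x. \<bar>s - t\<bar> \<le> 1 \<Longrightarrow> cmod (?q s x) \<le> C / (1 + \<bar>x\<bar>) \<and> cmod (p s x) \<le> C / (1 + \<bar>x\<bar>)"
      using bounds[of t] by blast
    have R: "((\<lambda>s. R s (of_real x)) \<longlongrightarrow> R t (of_real x)) (at t)" for x
      using has_vector_derivative_continuous[OF R_derivative_t] by (simp add: continuous_at)
    have r: "((\<lambda>s. r s x) \<longlongrightarrow> r t x) (at t)" for x
      by (intro tendsto_matrix_vector_mult R tendsto_const)
    have lq: "((\<lambda>s. ?q s x) \<longlongrightarrow> ?q t x) (at t)" for x
      unfolding multisoliton_eq by (intro tendsto_intros r)
    have lp: "((\<lambda>s. p s x) \<longlongrightarrow> p t x) (at t)" for x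
      unfolding p_def by (intro tendsto_intros tendsto_matrix_vector_mult R r)
    show ?thesis
    proof
      show "L2_tendsto ?q (?q t) (at t)"
        by (rule L2_tendsto_at[OF cq _ lq, where C = C]) (use C in blast)
      show "L2_tendsto p (p t) (at t)"
        by (rule L2_tendsto_at[OF cp _ lp, where C = C]) (use C in blast)
    qed
  qed
  ultimately show ?thesis
    unfolding continuous_into_H1_plus_def using wd by blast
qed

end

section \<open>The Lax pair and scattering data\<close>

lemma has_vector_derivative_matrixI:
  fixes A :: "real \<Rightarrow> complex^'n^'n"
  assumes "\<And>i j. ((\<lambda>t. A t $ i $ j) has_vector_derivative A' $ i $ j) (at t)"
  shows "(A has_vector_derivative A') (at t)"
  using assms unfolding has_vector_derivative_def has_derivative_at_within
  by (auto intro!: bounded_linear_scaleR_left vec_tendstoI)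

text \<open>A monic polynomial in a matrix, given by the list of its real roots. Traces of these
  polynomials serve as the spectral invariants of the flow.\<close>

primrec shifted_product :: "complex^'n^'n \<Rightarrow> real list \<Rightarrow> complex^'n^'n" where
  "shifted_product Y [] = mat 1"
| "shifted_product Y (\<xi> # \<xi>s) = (Y - mat (of_real \<xi>)) ** shifted_product Y \<xi>s"

lemma shifted_product_append: "shifted_product Y (\<xi>s @ \<zeta>s) = shifted_product Y \<xi>s ** shifted_product Y \<zeta>s"
  by (induction \<xi>s) (simp_all add: matrix_mul_assoc)

lemmas matrix_mult_simps =
  bounded_bilinear.diff_left[OF bounded_bilinear_matrix_mult] bounded_bilinear.diff_right[OF bounded_bilinear_matrix_mult]
  bounded_bilinear.add_left[OF bounded_bilinear_matrix_mult] bounded_bilinear.add_right[OF bounded_bilinear_matrix_mult]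
  bounded_bilinear.scaleR_left[OF bounded_bilinear_matrix_mult] bounded_bilinear.scaleR_right[OF bounded_bilinear_matrix_mult]
  bounded_bilinear.minus_left[OF bounded_bilinear_matrix_mult] bounded_bilinear.minus_right[OF bounded_bilinear_matrix_mult]

lemma mat_commute: "mat z ** (B :: complex^'n^'n) = B ** mat z"
  by (simp add: vec_eq_iff matrix_matrix_mult_def mat_def if_distrib[of "\<lambda>x. x * _"] if_distrib[of "\<lambda>x. _ * x"] mult.commute cong: if_cong)

text \<open>The commutator with B is a derivation that annihilates scalar matrices, so a Lax
  equation passes to polynomials.\<close>

lemma shifted_product_lax:
  fixes Y B :: "real \<Rightarrow> complex^'n^'n"
  assumes "\<And>t. (Y has_vector_derivative B t ** Y t - Y t ** B t) (at t)"
  shows "((\<lambda>t. shifted_product (Y t) \<xi>s) has_vector_derivative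
      B t ** shifted_product (Y t) \<xi>s - shifted_product (Y t) \<xi>s ** B t) (at t)"
proof (induction \<xi>s)
  case Nil
  then show ?case by simp
next
  case (Cons \<xi> \<xi>s)
  let ?Z = "\<lambda>t. Y t - mat (of_real \<xi>)" and ?P = "\<lambda>t. shifted_product (Y t) \<xi>s"
  have "(?Z has_vector_derivative B t ** Y t - Y t ** B t - 0) (at t)"
    by (intro has_vector_derivative_diff assms has_vector_derivative_const)
  from bounded_bilinear.has_vector_derivative[OF bounded_bilinear_matrix_mult this Cons]
  have "((\<lambda>t. ?Z t ** ?P t) has_vector_derivative
      ?Z t ** (B t ** ?P t - ?P t ** B t) + (B t ** Y t - Y t ** B t) ** ?P t) (at t)"
    by simp
  moreover have "B t ** Y t - Y t ** B t = B t ** ?Z t - ?Z t ** B t"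
    by (simp add: matrix_mult_simps mat_commute)
  moreover have "Z ** (C ** Q - Q ** C) + (C ** Z - Z ** C) ** Q = C ** (Z ** Q) - (Z ** Q) ** C" for Z C Q :: "complex^'n^'n"
    by (simp add: matrix_mult_simps matrix_mul_assoc)
  ultimately show ?case by simp
qed

lemma bounded_linear_trace: "bounded_linear (trace :: complex^'n^'n \<Rightarrow> complex)"
  unfolding trace_def
  by (intro bounded_linear_sum bounded_linear_compose[OF bounded_linear_vec_nth bounded_linear_vec_nth])

text \<open>Isospectrality in terms of traces: a commutator has trace 0, so there is no need to
  solve for a conjugating propagator.\<close>

lemma trace_shifted_product_constant:
  fixes Y B :: "real \<Rightarrow> complex^'n^'n"
  assumes "\<And>t. (Y has_vector_derivative B t ** Y t - Y t ** B t) (at t)"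
  shows "trace (shifted_product (Y s) \<xi>s) = trace (shifted_product (Y t) \<xi>s)"
proof -
  have "((\<lambda>t. trace (shifted_product (Y t) \<xi>s)) has_vector_derivative 0) (at t within UNIV)" for t
  proof -
    have "trace (B t ** shifted_product (Y t) \<xi>s - shifted_product (Y t) \<xi>s ** B t) = 0"
      using trace_mul_sym[of "B t" "shifted_product (Y t) \<xi>s"] by (simp add: trace_sub)
    moreover have "((\<lambda>t. trace (shifted_product (Y t) \<xi>s)) has_vector_derivative
        trace (B t ** shifted_product (Y t) \<xi>s - shifted_product (Y t) \<xi>s ** B t)) (at t)"
      by (rule bounded_linear.has_vector_derivative[OF bounded_linear_trace shifted_product_lax[OF assms]])
    ultimately show ?thesis
      by simp
  qed
  then obtain c where "\<And>t. trace (shifted_product (Y t) \<xi>s) = c"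
    using has_vector_derivative_zero_constant[of UNIV "\<lambda>t. trace (shifted_product (Y t) \<xi>s)"] by auto
  then show ?thesis by simp
qed

section \<open>Adjoints, and eigenvectors recovered from traces\<close>

definition adj :: "complex^'n^'n \<Rightarrow> complex^'n^'n" where "adj A = (\<chi> i j. cnj (A $ j $ i))"

lemma adj_mult: "adj (A ** B) = adj B ** adj A"
  by (simp add: adj_def vec_eq_iff matrix_matrix_mult_def mult.commute)

lemma adj_adj [simp]: "adj (adj A) = A"
  by (simp add: adj_def vec_eq_iff)

lemma adj_diff: "adj (A - B) = adj A - adj B"
  by (simp add: adj_def vec_eq_iff)

lemma adj_mat_of_real [simp]: "adj (mat (of_real \<xi>)) = mat (of_real \<xi>)" "adj (mat 1) = mat 1"
  by (auto simp: adj_def vec_eq_iff mat_def)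

text \<open>Makes p(K) p(K)^* a shifted product again, so that its trace is among the known
  ones.\<close>

lemma adj_shifted_product:
  assumes "adj K = K"
  shows "adj (shifted_product K \<xi>s) = shifted_product K (rev \<xi>s)"
  by (induction \<xi>s) (simp_all add: adj_mult adj_diff assms shifted_product_append)

lemma trace_mult_adj: "trace (A ** adj A) = of_real (\<Sum>i\<in>UNIV. \<Sum>j\<in>UNIV. (cmod (A $ i $ j))\<^sup>2)"
  by (simp add: trace_def matrix_matrix_mult_def adj_def complex_norm_square del: of_real_power)

lemma trace_mult_adj_eq_0: "trace (A ** adj A) = 0 \<Longrightarrow> A = 0"
  unfolding trace_mult_adj of_real_eq_0_iff by (simp add: sum_nonneg_eq_0_iff sum_nonneg vec_eq_iff)

definition diag :: "('n \<Rightarrow> complex) \<Rightarrow> complex^'n^'n" where "diag d = (\<chi> i j. if i = j then d i else 0)"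

lemma diag_nth: "diag d $ i $ j = (if i = j then d i else 0)"
  by (simp add: diag_def)

lemma diag_mult_left: "(diag d ** A) $ i $ j = d i * A $ i $ j"
  by (simp add: diag_def matrix_matrix_mult_def if_distrib[of "\<lambda>x. x * _"] cong: if_cong)

lemma diag_mult_right: "(A ** diag d) $ i $ j = A $ i $ j * d j"
  by (simp add: diag_def matrix_matrix_mult_def if_distrib[of "\<lambda>x. _ * x"] cong: if_cong)

lemma shifted_product_diag:
  "shifted_product (diag d) \<xi>s = diag (\<lambda>i. \<Prod>\<xi>\<leftarrow>\<xi>s. d i - of_real \<xi>)"
proof (induction \<xi>s)
  case Nil
  then show ?case by (simp add: diag_def mat_def)
next
  case (Cons \<xi> \<xi>s)
  have "diag d - mat (of_real \<xi>) = diag (\<lambda>i. d i - of_real \<xi>)"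
    by (simp add: diag_nth mat_def vec_eq_iff)
  then have "shifted_product (diag d) (\<xi> # \<xi>s) = diag (\<lambda>i. d i - of_real \<xi>) ** diag (\<lambda>i. \<Prod>\<xi>\<leftarrow>\<xi>s. d i - of_real \<xi>)"
    by (simp only: shifted_product.simps Cons)
  then show ?case
    by (simp add: vec_eq_iff diag_mult_left diag_nth)
qed

lemma trace_diag: "trace (diag d) = (\<Sum>i\<in>UNIV. d i)"
  by (simp add: trace_def diag_def)

text \<open>For Hermitian \<open>K\<close>, the vanishing of \<open>p(K)\<close> is detected by the trace of \<open>p(K) p(K)\<^sup>*\<close>.\<close>

lemma eigenvector_of_trace_eq:
  fixes K :: "complex^'n^'n" and d :: "'n \<Rightarrow> real"
  assumes K: "adj K = K" and d: "inj d"
    and tr: "\<And>\<xi>s. trace (shifted_product K \<xi>s) = trace (shifted_product (diag (\<lambda>i. of_real (d i))) \<xi>s)"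
  shows "\<exists>w. w \<noteq> 0 \<and> K *v w = (\<chi> i. of_real (d j) * w $ i)"
proof -
  \<comment> \<open>The roots are all values other than d j, so p vanishes at every d i with i
    different from j and not at d j.\<close>
  obtain js where js: "set js = UNIV - {j}"
    using finite_list[of "UNIV - {j}"] by auto
  define \<xi>s where "\<xi>s = map d js"
  define p where "p i = (\<Prod>\<xi>\<leftarrow>\<xi>s. complex_of_real (d i) - of_real \<xi>)" for i
  have p: "p i = 0 \<longleftrightarrow> i \<noteq> j" for i
  proof -
    have "p i = 0 \<longleftrightarrow> (\<exists>k\<in>set js. d i = d k)"
      unfolding p_def \<xi>s_def by (auto simp: prod_list_zero_iff)
    then show ?thesis
      using d js by (auto simp: inj_eq)
  qed
  \<comment> \<open>Adding the root d j gives a polynomial vanishing at all d i; the reversed copy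
    supplies the adjoint factor.\<close>
  have "trace (shifted_product K ((d j # \<xi>s) @ rev (d j # \<xi>s))) = 0"
  proof -
    have "(\<Prod>\<xi>\<leftarrow>(d j # \<xi>s) @ rev (d j # \<xi>s). complex_of_real (d i) - of_real \<xi>) = 0" for i
      using p[of i] unfolding p_def by (cases "i = j") auto
    then show ?thesis
      unfolding tr shifted_product_diag trace_diag by (intro sum.neutral ballI)
  qed
  then have "shifted_product K (d j # \<xi>s) = 0"
    by (intro trace_mult_adj_eq_0) (simp only: shifted_product_append adj_shifted_product[OF K])
  then have zero: "(K - mat (of_real (d j))) ** shifted_product K \<xi>s = 0"
    by simp
  \<comment> \<open>This trace equals p (d j), which is nonzero. Hence p(K) has a nonzero column,
    and every column is annihilated by K - d j.\<close>
  have "trace (shifted_product K \<xi>s) = (\<Sum>i\<in>UNIV. p i)"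
    unfolding tr shifted_product_diag trace_diag p_def ..
  also have "\<dots> = (\<Sum>i\<in>{j}. p i)"
    by (rule sum.mono_neutral_right) (auto simp: p)
  also have "\<dots> \<noteq> 0"
    by (simp add: p)
  finally have "shifted_product K \<xi>s \<noteq> 0"
    by (auto simp: trace_def)
  then obtain a b where ab: "shifted_product K \<xi>s $ a $ b \<noteq> 0"
    by (auto simp: vec_eq_iff)
  define w where "w = shifted_product K \<xi>s *v axis b 1"
  have "w \<noteq> 0"
  proof
    assume "w = 0"
    then have "w $ a = 0" by simp
    then show False
      using ab by (simp add: w_def matrix_vector_mult_def axis_def if_distrib cong: if_cong)
  qed
  moreover have "(K - mat (of_real (d j))) *v w = 0"
    by (simp add: w_def matrix_vector_mul_assoc zero)
  then have "K *v w = (\<chi> i. of_real (d j) * w $ i)"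
    by (simp add: matrix_vector_mult_diff_rdistrib vec_eq_iff mat_mult_vec)
  ultimately show ?thesis by blast
qed

section \<open>The Lax pair of the particle system and the uniform gap\<close>

locale calogero_moser =
  fixes x v :: "real \<Rightarrow> real^'n"
  assumes distinct: "\<And>t j k. j \<noteq> k \<Longrightarrow> x t $ j \<noteq> x t $ k"
    and x_deriv: "\<And>t. (x has_vector_derivative v t) (at t)"
    and v_deriv: "\<And>t. (v has_vector_derivative (\<chi> j. \<Sum>k\<in>UNIV - {j}. 8 / (x t $ j - x t $ k) ^ 3)) (at t)"
begin

abbreviation "y t i \<equiv> complex_of_real (x t $ i)"

definition "X t = diag (y t)"

text \<open>The diagonal carries half the velocities, matching X' = 2 L + [B, X]; the off-diagonal
  part makes [X, L] constant, equal to -i off the diagonal.\<close>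

definition "L t = (\<chi> i j. if i = j then of_real (v t $ i / 2) else - \<i> / (y t i - y t j))"

text \<open>Off the diagonal, B is fixed by X' being diagonal: [B, X] has to cancel 2 L there. The
  diagonal is chosen to cancel the three-particle terms in [B, L].\<close>

definition "B t = (\<chi> i j. if i = j then 2 * \<i> * (\<Sum>l\<in>UNIV - {i}. 1 / (y t i - y t l)\<^sup>2) else - 2 * \<i> / (y t i - y t j)\<^sup>2)"

lemma y_distinct: "j \<noteq> k \<Longrightarrow> y t j - y t k \<noteq> 0"
  using distinct[of j k t] by simp

lemma X_commutator: "(X t ** A - A ** X t) $ i $ j = (y t i - y t j) * A $ i $ j"
  by (simp add: X_def diag_mult_left diag_mult_right algebra_simps)

lemma comp_deriv: "((\<lambda>t. x t $ i) has_real_derivative v t $ i) (at t)"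
    "((\<lambda>t. v t $ i) has_real_derivative (\<Sum>k\<in>UNIV - {i}. 8 / (x t $ i - x t $ k) ^ 3)) (at t)"
  using has_vector_derivative_vec_nth[OF x_deriv[of t], of i] has_vector_derivative_vec_nth[OF v_deriv[of t], of i]
  by (simp_all add: has_real_derivative_iff_has_vector_derivative)

lemma y_deriv: "((\<lambda>t. y t i) has_vector_derivative of_real (v t $ i)) (at t)"
  using comp_deriv(1)[of i t] by (rule has_vector_derivative_of_real)

lemma X_deriv: "(X has_vector_derivative 2 *\<^sub>R L t + (B t ** X t - X t ** B t)) (at t)"
proof (rule has_vector_derivative_matrixI)
  fix i j
  have *: "(B t ** X t - X t ** B t) $ i $ j = - ((y t i - y t j) * B t $ i $ j)"
  proof -
    have "(B t ** X t - X t ** B t) $ i $ j = - ((X t ** B t - B t ** X t) $ i $ j)"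
      by simp
    then show ?thesis
      unfolding X_commutator .
  qed
  have e: "(2 *\<^sub>R L t + (B t ** X t - X t ** B t)) $ i $ j = 2 *\<^sub>R L t $ i $ j - (y t i - y t j) * B t $ i $ j"
    by (simp only: vector_add_component vector_scaleR_component *) simp
  show "((\<lambda>t. X t $ i $ j) has_vector_derivative (2 *\<^sub>R L t + (B t ** X t - X t ** B t)) $ i $ j) (at t)"
  proof (cases "i = j")
    case True
    then have "(2 *\<^sub>R L t + (B t ** X t - X t ** B t)) $ i $ j = of_real (v t $ j)"
      unfolding e by (simp add: L_def scaleR_conv_of_real[where 'a = complex])
    then show ?thesis
      using y_deriv[of j t] True unfolding \<open>_ = of_real (v t $ j)\<close> by (simp add: X_def diag_def)
  next
    case False
    have "(2 *\<^sub>R L t + (B t ** X t - X t ** B t)) $ i $ j = 0"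
      using False y_distinct[OF False, of t]
      unfolding e by (simp add: L_def B_def scaleR_conv_of_real[where 'a = complex] power2_eq_square)
    then show ?thesis
      using False by (simp add: X_def diag_def)
  qed
qed

text \<open>By partial fractions, each third particle l contributes (2 / D) times the difference of
  the inverse squares of its distances to k and to j. Their sum cancels against (B_jj - B_kk) L_jk,
  and only the velocity term survives.\<close>

lemma lax_commutator_offdiag:
  assumes jk: "j \<noteq> k"
  shows "(B t ** L t - L t ** B t) $ j $ k = \<i> * of_real (v t $ j - v t $ k) / (y t j - y t k)\<^sup>2"
proof -
  define Q where "Q = UNIV - {j, k}"
  have U: "UNIV = insert j (insert k Q)" "finite Q" "j \<notin> insert k Q" "k \<notin> Q"
    using jk by (auto simp: Q_def)
  define D where "D = y t j - y t k"
  have D: "D \<noteq> 0" using y_distinct[OF jk] by (simp add: D_def)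
  let ?T = "\<lambda>l. B t $ j $ l * L t $ l $ k - L t $ j $ l * B t $ l $ k"
  have rest: "?T l = (2 / D) * (1 / (y t k - y t l)\<^sup>2 - 1 / (y t j - y t l)\<^sup>2)" if "l \<in> Q" for l
  proof -
    define a b where "a = y t j - y t l" and "b = y t l - y t k"
    have ab: "a \<noteq> 0" "b \<noteq> 0" "D = a + b"
      using that y_distinct[of j l t] y_distinct[of l k t] by (auto simp: Q_def a_def b_def D_def)
    have kl: "(y t k - y t l)\<^sup>2 = b\<^sup>2"
      by (simp add: b_def power2_commute)
    have "?T l = (- 2 * \<i> / a\<^sup>2) * (- \<i> / b) - (- \<i> / a) * (- 2 * \<i> / b\<^sup>2)"
      using that by (auto simp: B_def L_def Q_def a_def[symmetric] b_def[symmetric])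
    also have "\<dots> = - 2 / (a\<^sup>2 * b) + 2 / (a * b\<^sup>2)"
      using ab by (simp add: field_simps)
    also have "\<dots> = (2 / (a + b)) * (1 / b\<^sup>2 - 1 / a\<^sup>2)"
    proof -
      have "1 / b\<^sup>2 - 1 / a\<^sup>2 = (a + b) * ((a - b) / (a\<^sup>2 * b\<^sup>2))"
        using ab by (simp add: field_simps power2_eq_square)
      then have "(2 / (a + b)) * (1 / b\<^sup>2 - 1 / a\<^sup>2) = 2 * ((a - b) / (a\<^sup>2 * b\<^sup>2))"
        using ab(3) D by simp
      also have "\<dots> = - 2 / (a\<^sup>2 * b) + 2 / (a * b\<^sup>2)"
        using ab by (simp add: field_simps power2_eq_square)
      finally show ?thesis ..
    qed
    finally show ?thesis
      unfolding kl a_def[symmetric] ab(3) .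
  qed
  have S: "(\<Sum>l\<in>UNIV - {j}. 1 / (y t j - y t l)\<^sup>2) = 1 / D\<^sup>2 + (\<Sum>l\<in>Q. 1 / (y t j - y t l)\<^sup>2)"
    "(\<Sum>l\<in>UNIV - {k}. 1 / (y t k - y t l)\<^sup>2) = 1 / D\<^sup>2 + (\<Sum>l\<in>Q. 1 / (y t k - y t l)\<^sup>2)"
  proof -
    have "UNIV - {j} = insert k Q" "UNIV - {k} = insert j Q"
      using jk by (auto simp: Q_def)
    then show "(\<Sum>l\<in>UNIV - {j}. 1 / (y t j - y t l)\<^sup>2) = 1 / D\<^sup>2 + (\<Sum>l\<in>Q. 1 / (y t j - y t l)\<^sup>2)"
      "(\<Sum>l\<in>UNIV - {k}. 1 / (y t k - y t l)\<^sup>2) = 1 / D\<^sup>2 + (\<Sum>l\<in>Q. 1 / (y t k - y t l)\<^sup>2)"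
      using U by (simp_all add: D_def power2_commute)
  qed
  have "(B t ** L t - L t ** B t) $ j $ k = (\<Sum>l\<in>UNIV. ?T l)"
    by (simp add: matrix_matrix_mult_def sum_subtractf)
  also have "\<dots> = ?T j + (?T k + (\<Sum>l\<in>Q. ?T l))"
  proof -
    have "(\<Sum>l\<in>UNIV. ?T l) = (\<Sum>l\<in>insert j (insert k Q). ?T l)"
      by (rule arg_cong[OF U(1)])
    then show ?thesis
      using U(2-4) by simp
  qed
  also have "(\<Sum>l\<in>Q. ?T l) = (2 / D) * ((\<Sum>l\<in>Q. 1 / (y t k - y t l)\<^sup>2) - (\<Sum>l\<in>Q. 1 / (y t j - y t l)\<^sup>2))"
    by (simp only: rest sum_distrib_left[symmetric] sum_subtractf cong: sum.cong)
  also have "?T j + (?T k + \<dots>) = \<i> * of_real (v t $ j - v t $ k) / D\<^sup>2"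
    using jk D by (simp add: B_def L_def S D_def[symmetric]) (simp add: field_simps power2_eq_square)
  finally show ?thesis
    by (simp add: D_def)
qed

text \<open>Half of the force, since L carries half of the velocity on its diagonal.\<close>

lemma lax_commutator_diag:
  "(B t ** L t - L t ** B t) $ j $ j = (\<Sum>l\<in>UNIV - {j}. 4 / (y t j - y t l) ^ 3)"
proof -
  let ?T = "\<lambda>l. B t $ j $ l * L t $ l $ j - L t $ j $ l * B t $ l $ j"
  have "(B t ** L t - L t ** B t) $ j $ j = (\<Sum>l\<in>UNIV. ?T l)"
    by (simp add: matrix_matrix_mult_def sum_subtractf)
  also have "\<dots> = (\<Sum>l\<in>UNIV - {j}. ?T l)"
    by (rule sum.mono_neutral_right) (auto simp: mult.commute)
  also have "\<dots> = (\<Sum>l\<in>UNIV - {j}. 4 / (y t j - y t l) ^ 3)"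
  proof (intro sum.cong refl)
    fix l assume l: "l \<in> UNIV - {j}"
    define a where "a = y t j - y t l"
    have a: "a \<noteq> 0" "y t l - y t j = - a"
      using l y_distinct[of j l t] by (auto simp: a_def)
    show "?T l = 4 / (y t j - y t l) ^ 3"
      using l a unfolding a_def[symmetric]
      by (simp add: B_def L_def a_def[symmetric] power2_eq_square power3_eq_cube)
  qed
  finally show ?thesis .
qed

lemma L_deriv: "(L has_vector_derivative B t ** L t - L t ** B t) (at t)"
proof (rule has_vector_derivative_matrixI)
  fix i j
  show "((\<lambda>t. L t $ i $ j) has_vector_derivative (B t ** L t - L t ** B t) $ i $ j) (at t)"
  proof (cases "i = j")
    case True
    have "((\<lambda>t. v t $ i / 2) has_real_derivative (\<Sum>k\<in>UNIV - {i}. 4 / (x t $ i - x t $ k) ^ 3)) (at t)"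
      using DERIV_cdivide[OF comp_deriv(2)[of i t], of 2] by (simp add: sum_divide_distrib)
    from has_vector_derivative_of_real[OF this, where 'a = complex] show ?thesis
      unfolding True lax_commutator_diag by (simp add: L_def)
  next
    case False
    have "((\<lambda>t. 1 / (x t $ i - x t $ j)) has_real_derivative - (v t $ i - v t $ j) / (x t $ i - x t $ j)\<^sup>2) (at t)"
      using distinct[OF False, of t]
      by (auto intro!: derivative_eq_intros comp_deriv simp: power2_eq_square)
    from has_vector_derivative_mult_right[OF has_vector_derivative_of_real[OF this, where 'a = complex], of "- \<i>"]
    have "((\<lambda>t. - \<i> * of_real (1 / (x t $ i - x t $ j))) has_vector_derivative
        - \<i> * of_real (- (v t $ i - v t $ j) / (x t $ i - x t $ j)\<^sup>2)) (at t)" .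
    moreover have "- \<i> * of_real (- (v t $ i - v t $ j) / (x t $ i - x t $ j)\<^sup>2) = \<i> * of_real (v t $ i - v t $ j) / (y t i - y t j)\<^sup>2"
      by (simp add: algebra_simps diff_divide_distrib)
    moreover have "(\<lambda>t. - \<i> * of_real (1 / (x t $ i - x t $ j))) = (\<lambda>t. L t $ i $ j)"
      using False by (simp add: L_def)
    ultimately show ?thesis
      unfolding lax_commutator_offdiag[OF False] by simp
  qed
qed

lemma trace_constant:
  "trace (shifted_product (X 0 + (2 * s) *\<^sub>R L 0) \<xi>s) = trace (shifted_product (X s) \<xi>s)"
proof -
  \<comment> \<open>At t = 0 this is the linear flow X(0) + 2 s L(0), at t = s it is X(s).
    Differentiating the factor 2 (s - t) cancels the term 2 L in X', which leaves a pure
    commutator.\<close>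
  define Y where "Y t = X t + (2 * (s - t)) *\<^sub>R L t" for t
  have "(Y has_vector_derivative B t ** Y t - Y t ** B t) (at t)" for t
  proof -
    have "((\<lambda>t. 2 * (s - t)) has_real_derivative - 2) (at t)"
      by (auto intro!: derivative_eq_intros)
    then have "(Y has_vector_derivative (2 *\<^sub>R L t + (B t ** X t - X t ** B t)) + ((2 * (s - t)) *\<^sub>R (B t ** L t - L t ** B t) + (- 2) *\<^sub>R L t)) (at t)"
      unfolding Y_def[abs_def] by (intro has_vector_derivative_add X_deriv has_vector_derivative_scaleR L_deriv)
    moreover have "(2 *\<^sub>R L t + (B t ** X t - X t ** B t)) + ((2 * (s - t)) *\<^sub>R (B t ** L t - L t ** B t) + (- 2) *\<^sub>R L t) = B t ** Y t - Y t ** B t"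
      by (simp add: Y_def matrix_mult_simps scaleR_diff_right)
    ultimately show ?thesis by simp
  qed
  from trace_shifted_product_constant[of Y B, OF this, of 0 \<xi>s s] show ?thesis
    by (simp add: Y_def)
qed

lemma L_hermitian: "adj (L t) = L t"
  by (simp add: adj_def L_def vec_eq_iff) (metis minus_diff_eq divide_minus_left divide_minus_right)

lemma X_hermitian: "adj (X t) = X t"
  by (auto simp: adj_def X_def diag_def vec_eq_iff)

lemma projection_eigenvector:
  "\<exists>w. w \<noteq> 0 \<and> (X 0 + (2 * s) *\<^sub>R L 0) *v w = (\<chi> i. y s j * w $ i)"
proof (rule eigenvector_of_trace_eq)
  show "adj (X 0 + (2 * s) *\<^sub>R L 0) = X 0 + (2 * s) *\<^sub>R L 0"
    using X_hermitian[of 0] L_hermitian[of 0] by (simp add: adj_def vec_eq_iff)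
  show "inj (\<lambda>i. x s $ i)"
    using distinct by (auto simp: inj_def)
  show "trace (shifted_product (X 0 + (2 * s) *\<^sub>R L 0) \<xi>s) = trace (shifted_product (diag (\<lambda>i. y s i)) \<xi>s)" for \<xi>s
    by (simp only: trace_constant) (simp only: X_def)
qed

text \<open>L is Hermitian, so tr L^2 is the sum of all |L_ij|^2. Its conservation bounds the
  entries, and the off-diagonal ones have modulus 1 / |x_j - x_k|.\<close>

lemma uniform_gap:
  obtains \<delta> where "0 < \<delta>" "\<And>t j k. j \<noteq> k \<Longrightarrow> \<delta> \<le> \<bar>x t $ j - x t $ k\<bar>"
proof -
  define E where "E t = (\<Sum>i\<in>UNIV. \<Sum>j\<in>UNIV. (cmod (L t $ i $ j))\<^sup>2)" for t
  have "complex_of_real (E t) = trace (shifted_product (L t) [0, 0])" for t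
  proof -
    have "mat (complex_of_real 0) = (0 :: complex^'n^'n)"
      by (simp add: mat_def vec_eq_iff)
    then have "shifted_product (L t) [0, 0] = L t ** L t"
      by simp
    then show ?thesis
      using trace_mult_adj[of "L t"] by (simp only: E_def L_hermitian)
  qed
  then have E: "E t = E 0" for t
    using trace_shifted_product_constant[OF L_deriv, of t "[0, 0]" 0] by (metis of_real_eq_iff)
  show thesis
  \<comment> \<open>The summand 1 keeps the gap well defined when E 0 = 0, as for a single particle
    at rest.\<close>
  proof (rule that[of "1 / (sqrt (E 0) + 1)"])
    have "0 \<le> E 0" unfolding E_def by (intro sum_nonneg) auto
    then have pos: "0 < sqrt (E 0) + 1" by (simp add: add_nonneg_pos)
    then show "0 < 1 / (sqrt (E 0) + 1)" by simp
    fix t and j k :: 'n assume jk: "j \<noteq> k"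
    have "(cmod (L t $ j $ k))\<^sup>2 \<le> (\<Sum>b\<in>UNIV. (cmod (L t $ j $ b))\<^sup>2)"
      by (intro member_le_sum) auto
    also have "\<dots> \<le> E t"
      unfolding E_def by (rule member_le_sum[where f = "\<lambda>a. \<Sum>b\<in>UNIV. (cmod (L t $ a $ b))\<^sup>2"]) (auto intro: sum_nonneg)
    finally have "cmod (L t $ j $ k) \<le> sqrt (E 0)"
      unfolding E[of t] by (rule real_le_rsqrt)
    moreover have "cmod (L t $ j $ k) = 1 / \<bar>x t $ j - x t $ k\<bar>"
      using jk by (simp add: L_def norm_divide of_real_diff[symmetric] del: of_real_diff)
    ultimately have "1 / \<bar>x t $ j - x t $ k\<bar> \<le> sqrt (E 0) + 1"
      by simp
    then show "1 / (sqrt (E 0) + 1) \<le> \<bar>x t $ j - x t $ k\<bar>"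
      using pos distinct[OF jk, of t] by (simp add: field_simps)
  qed
qed

end

section \<open>Orthonormal diagonalization of Hermitian matrices\<close>

definition cdot :: "complex^'n \<Rightarrow> complex^'n \<Rightarrow> complex" where
  "cdot u v = (\<Sum>i\<in>UNIV. cnj (u $ i) * v $ i)"

lemma cdot_simps:
  "cdot u (v + w) = cdot u v + cdot u w" "cdot (u + w) v = cdot u v + cdot w v"
  "cdot u (v - w) = cdot u v - cdot u w" "cdot (u - w) v = cdot u v - cdot w v"
  "cdot u (c *s v) = c * cdot u v" "cdot (c *s u) v = cnj c * cdot u v"
  "cdot u (a *\<^sub>R v) = of_real a * cdot u v" "cdot (a *\<^sub>R u) v = of_real a * cdot u v"
  "cdot u 0 = 0" "cdot 0 u = 0"
  by (simp_all add: cdot_def sum.distrib sum_subtractf sum_distrib_left algebra_simps scaleR_conv_of_real[where 'a = complex])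

lemma cdot_commute: "cdot v u = cnj (cdot u v)"
  by (simp add: cdot_def mult.commute)

lemma cdot_self: "cdot u u = of_real ((norm u)\<^sup>2)"
proof -
  have "(norm u)\<^sup>2 = (\<Sum>i\<in>UNIV. (cmod (u $ i))\<^sup>2)"
    by (simp add: norm_vec_def L2_set_def sum_nonneg)
  then show ?thesis
    by (simp add: cdot_def complex_norm_square mult.commute del: of_real_power)
qed

lemma cdot_adj: "cdot u (A *v v) = cdot (adj A *v u) v"
proof -
  have "cdot u (A *v v) = (\<Sum>i\<in>UNIV. \<Sum>j\<in>UNIV. cnj (u $ i) * A $ i $ j * v $ j)"
    by (simp add: cdot_def matrix_vector_mult_def sum_distrib_left mult.assoc)
  also have "\<dots> = (\<Sum>j\<in>UNIV. \<Sum>i\<in>UNIV. cnj (u $ i) * A $ i $ j * v $ j)"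
    by (rule sum.swap)
  also have "\<dots> = cdot (adj A *v u) v"
    by (simp add: cdot_def matrix_vector_mult_def adj_def sum_distrib_right sum_distrib_left mult_ac)
  finally show ?thesis .
qed

lemma matrix_vector_scaleR: "(A :: complex^'n^'n) *v (a *\<^sub>R v) = a *\<^sub>R (A *v v)"
  by (rule bounded_bilinear.scaleR_right[OF bounded_bilinear_matrix_vector_mult])

lemma continuous_on_cdot:
  "continuous_on S f \<Longrightarrow> continuous_on S g \<Longrightarrow> continuous_on S (\<lambda>x. cdot (f x) (g x))"
  unfolding cdot_def by (intro continuous_intros)

text \<open>Maximises the Rayleigh quotient on the unit sphere of the invariant subspace ker N. In
  the application N encodes orthogonality to the eigenvectors already found.\<close>

lemma rayleigh_eigenvector:
  fixes A N :: "complex^'n^'n"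
  assumes A: "adj A = A"
    and inv: "\<And>v. N *v v = 0 \<Longrightarrow> N *v (A *v v) = 0"
    and ex: "N *v v\<^sub>0 = 0" "v\<^sub>0 \<noteq> 0"
  obtains w \<mu> where "norm w = 1" "N *v w = 0" "A *v w = complex_of_real \<mu> *s w"
proof -
  define f where "f v = Re (cdot v (A *v v))" for v
  define K where "K = {v. N *v v = 0} \<inter> sphere 0 1"
  have cont: "continuous_on S (\<lambda>v. B *v v)" for S and B :: "complex^'n^'n"
    by (rule linear_continuous_on) (rule matrix_vector_mul_bounded_linear)
  have "closed {v. N *v v = 0}"
    by (intro closed_Collect_eq cont continuous_on_const)
  then have "compact K"
    unfolding K_def by (intro closed_Int_compact compact_sphere)
  have norm1: "v /\<^sub>R norm v \<in> K" if "N *v v = 0" "v \<noteq> 0" for v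
    using that by (simp add: K_def matrix_vector_scaleR)
  then have "K \<noteq> {}"
    using ex by blast
  have "continuous_on K f"
    unfolding f_def by (intro continuous_on_Re continuous_on_cdot cont continuous_on_id)
  then obtain w where w: "w \<in> K" "\<And>v. v \<in> K \<Longrightarrow> f v \<le> f w"
    using continuous_attains_sup[OF \<open>compact K\<close> \<open>K \<noteq> {}\<close>] by blast
  have Nw: "N *v w = 0" and nw: "norm w = 1"
    using w(1) by (auto simp: K_def)
  have le: "f v \<le> f w * (norm v)\<^sup>2" if "N *v v = 0" for v
  proof (cases "v = 0")
    case False
    have "f (v /\<^sub>R norm v) = f v / (norm v)\<^sup>2"
      using False by (simp add: f_def matrix_vector_scaleR cdot_simps power2_eq_square field_simps)
    then have "f v / (norm v)\<^sup>2 \<le> f w"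
      using w(2)[OF norm1[OF that False]] by simp
    then show ?thesis
      using False by (simp add: divide_le_eq)
  qed (simp add: f_def cdot_simps)
  \<comment> \<open>The residual of the eigenvalue equation, which itself lies in ker N. Maximality
    tested along w + s h has first-order term 2 s |h|^2, which forces h = 0.\<close>
  define h where "h = A *v w - complex_of_real (f w) *s w"
  have Nh: "N *v h = 0"
    by (simp add: h_def matrix_vector_mult_diff_distrib vector_scalar_commute inv Nw)
  have h0: "Re (cdot h (A *v w)) - f w * Re (cdot h w) = (norm h)\<^sup>2"
  proof -
    have "cdot h (A *v w) - of_real (f w) * cdot h w = cdot h h"
      by (simp add: h_def cdot_simps algebra_simps)
    then have "Re (cdot h (A *v w) - of_real (f w) * cdot h w) = Re (cdot h h)"
      by simp
    then show ?thesis
      by (simp add: cdot_self)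
  qed
  have quad: "2 * s * (norm h)\<^sup>2 + s\<^sup>2 * (f h - f w * (norm h)\<^sup>2) \<le> 0" for s
  proof -
    have n: "(norm v)\<^sup>2 = Re (cdot v v)" for v :: "complex^'n"
      by (simp add: cdot_self)
    have sym: "Re (cdot w (A *v h)) = Re (cdot h (A *v w))" "Re (cdot w h) = Re (cdot h w)"
      using cdot_adj[of w A h] cdot_commute[of "A *v w" h] cdot_commute[of w h] by (simp_all add: A)
    have "f (w + s *\<^sub>R h) \<le> f w * (norm (w + s *\<^sub>R h))\<^sup>2"
      by (rule le) (simp add: matrix_vector_right_distrib matrix_vector_scaleR Nw Nh)
    moreover have "f (w + s *\<^sub>R h) = f w + 2 * s * Re (cdot h (A *v w)) + s\<^sup>2 * f h"
      by (simp add: f_def matrix_vector_right_distrib matrix_vector_scaleR cdot_simps sym algebra_simps power2_eq_square)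
    moreover have "(norm (w + s *\<^sub>R h))\<^sup>2 = 1 + 2 * s * Re (cdot h w) + s\<^sup>2 * (norm h)\<^sup>2"
    proof -
      have "Re (cdot w w) = 1" using n[of w] nw by simp
      then show ?thesis
        unfolding n by (simp add: cdot_simps sym algebra_simps power2_eq_square)
    qed
    ultimately have "2 * s * (Re (cdot h (A *v w)) - f w * Re (cdot h w)) + s\<^sup>2 * (f h - f w * (norm h)\<^sup>2) \<le> 0"
      by (simp add: algebra_simps)
    then show ?thesis
      unfolding h0 .
  qed
  have "norm h = 0"
  proof (rule ccontr)
    assume "norm h \<noteq> 0"
    define a b where "a = (norm h)\<^sup>2" and "b = \<bar>f h - f w * (norm h)\<^sup>2\<bar> + 1"
    have a: "0 < a" "0 < b" using \<open>norm h \<noteq> 0\<close> by (auto simp: a_def b_def)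
    \<comment> \<open>With this step the quadratic term exceeds -s a, too little to offset the
      linear term 2 s a.\<close>
    define s where "s = a / b"
    have "0 < s" using a by (simp add: s_def)
    define D where "D = f h - f w * (norm h)\<^sup>2"
    have "s\<^sup>2 * (- D) \<le> s\<^sup>2 * b"
      by (intro mult_left_mono) (auto simp: b_def D_def)
    moreover have "s\<^sup>2 * b = s * a"
      using a by (simp add: s_def power2_eq_square)
    moreover have "2 * (s * a) + s\<^sup>2 * D \<le> 0"
      using quad[of s] unfolding a_def D_def by (simp only: mult.assoc)
    ultimately have "2 * (s * a) \<le> s * a"
      by linarith
    then show False
      using mult_pos_pos[OF \<open>0 < s\<close> a(1)] by linarith
  qed
  then have "A *v w = complex_of_real (f w) *s w"
    by (simp add: h_def)
  with nw Nw show thesis by (rule that)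
qed

text \<open>Induction over the index set. The rows of N indexed by T are the adjoints of the
  eigenvectors found so far and all others are 0; the zero row at the new index makes N singular, so
  its kernel holds a further eigenvector.\<close>

lemma orthonormal_eigenvectors:
  fixes A :: "complex^'n^'n" and T :: "'n set"
  assumes A: "adj A = A"
  shows "finite T \<Longrightarrow> \<exists>u \<mu>. (\<forall>j\<in>T. \<forall>k\<in>T. cdot (u j) (u k) = (if j = k then 1 else 0)) \<and>
      (\<forall>j\<in>T. A *v u j = complex_of_real (\<mu> j) *s u j)"
proof (induction T rule: finite_induct)
  case empty
  then show ?case by simp
next
  case (insert a T)
  then obtain u \<mu> where u: "\<And>j k. j \<in> T \<Longrightarrow> k \<in> T \<Longrightarrow> cdot (u j) (u k) = (if j = k then 1 else 0)"
    "\<And>j. j \<in> T \<Longrightarrow> A *v u j = complex_of_real (\<mu> j) *s u j"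
    by blast
  define N :: "complex^'n^'n" where "N = (\<chi> i j. if i \<in> T then cnj (u i $ j) else 0)"
  have N: "(N *v v) $ i = (if i \<in> T then cdot (u i) v else 0)" for v i
    by (simp add: N_def matrix_vector_mult_def cdot_def)
  then have N0: "N *v v = 0 \<longleftrightarrow> (\<forall>i\<in>T. cdot (u i) v = 0)" for v
    by (auto simp: vec_eq_iff)
  have "\<not> invertible N"
  proof
    assume "invertible N"
    then have "(N *v (matrix_inv N *v axis a 1)) $ a = 1"
      by (simp add: matrix_inv_vector)
    then show False
      using N \<open>a \<notin> T\<close> by simp
  qed
  then obtain v\<^sub>0 where "N *v v\<^sub>0 = 0" "v\<^sub>0 \<noteq> 0"
    using invertibleI_kernel by blast
  moreover have "N *v (A *v v) = 0" if "N *v v = 0" for v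
    using that unfolding N0 by (auto simp: cdot_adj A u cdot_simps)
  ultimately obtain w \<nu> where w: "norm w = 1" "N *v w = 0" "A *v w = complex_of_real \<nu> *s w"
    using rayleigh_eigenvector[OF A] by blast
  have "cdot w w = 1"
    using w(1) by (simp add: cdot_self)
  moreover have "cdot (u j) w = 0" if "j \<in> T" for j
    using w(2) that by (simp add: N0)
  moreover have "cdot w (u j) = 0" if "j \<in> T" for j
    using \<open>\<And>j. j \<in> T \<Longrightarrow> cdot (u j) w = 0\<close>[OF that] cdot_commute[of w "u j"] by simp
  ultimately show ?case
    using u w(3) \<open>a \<notin> T\<close>
    by (intro exI[of _ "u(a := w)"] exI[of _ "\<mu>(a := \<nu>)"]) auto
qed

lemma adj_mult_nth: "(adj U ** A) $ i $ j = cdot (column i U) (column j A)"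
  by (simp add: adj_def matrix_matrix_mult_def cdot_def column_def)

lemma hermitian_diagonalization:
  fixes A :: "complex^'n^'n"
  assumes "adj A = A"
  obtains U \<mu> where "adj U ** U = mat 1" "A ** U = U ** diag (\<lambda>i. complex_of_real (\<mu> i))"
proof -
  have "\<exists>u \<mu>. (\<forall>j k :: 'n. cdot (u j) (u k) = (if j = k then 1 else 0)) \<and> (\<forall>j. A *v u j = complex_of_real (\<mu> j) *s u j)"
    using orthonormal_eigenvectors[where T = UNIV, OF assms finite] by simp
  then obtain u \<mu> where "(\<forall>j k :: 'n. cdot (u j) (u k) = (if j = k then 1 else 0)) \<and> (\<forall>j. A *v u j = complex_of_real (\<mu> j) *s u j)"
    by blast
  then have u: "cdot (u j) (u k) = (if j = k then 1 else 0)" "A *v u j = complex_of_real (\<mu> j) *s u j" for j k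
    by blast+
  define U where "U = (\<chi> i j. u j $ i)"
  have col: "column j U = u j" for j
    by (simp add: U_def column_def vec_eq_iff)
  show thesis
  proof (rule that[of U \<mu>])
    show "adj U ** U = mat 1"
      by (simp add: vec_eq_iff adj_mult_nth col u mat_def)
    have "(A ** U) $ i $ j = (A *v u j) $ i" for i j
      by (simp add: matrix_matrix_mult_def matrix_vector_mult_def U_def)
    then show "A ** U = U ** diag (\<lambda>i. complex_of_real (\<mu> i))"
      by (simp add: vec_eq_iff u diag_mult_right) (simp add: U_def mult.commute)
  qed
qed

text \<open>This is \<open>M(s)\<close> without the damping \<open>\<rho>\<close> and before the Galilean boost.\<close>

definition scattering_matrix :: "real^'n \<Rightarrow> real^'n \<Rightarrow> real \<Rightarrow> complex^'n^'n" where
  "scattering_matrix \<kappa> \<gamma> s = (\<chi> i j. if i = j then of_real (\<gamma> $ i + 2 * s * \<kappa> $ i) else \<i> / of_real (\<kappa> $ i - \<kappa> $ j))"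

section \<open>The linear flow in an eigenbasis of \<open>L 0\<close>\<close>

context calogero_moser begin

lemma XL_commutator: "X t ** L t - L t ** X t = (\<chi> i j. if i = j then 0 else - \<i>)"
proof -
  have "(X t ** L t - L t ** X t) $ i $ j = (if i = j then 0 else - \<i>)" for i j
    unfolding X_commutator using y_distinct[of i j t] by (simp add: L_def)
  then show ?thesis by (simp add: vec_eq_iff)
qed

text \<open>In an eigenbasis of L(0) the commutator relation reads Y_jk (\<mu>_k - \<mu>_j) = -i
  (c_j cnj c_k - \<delta>_jk), with c_j the pairing of column j with the all-ones vector. It
  determines the off-diagonal entries of Y once the phases are normalised to c_j = 1.\<close>

lemma scattering_normal_form:
  obtains \<kappa> \<gamma> :: "real^'n" where "inj (($) \<kappa>)"
    "\<And>s j. \<exists>w. w \<noteq> 0 \<and> scattering_matrix \<kappa> \<gamma> s *v w = (\<chi> i. y s j * w $ i)"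
proof -
  obtain U\<^sub>0 \<mu> where U\<^sub>0: "adj U\<^sub>0 ** U\<^sub>0 = mat 1" "L 0 ** U\<^sub>0 = U\<^sub>0 ** diag (\<lambda>i. complex_of_real (\<mu> i))"
    using hermitian_diagonalization[OF L_hermitian[of 0]] by blast
  let ?D = "diag (\<lambda>i. complex_of_real (\<mu> i))"
  \<comment> \<open>Stated for an arbitrary diagonalising unitary because it is applied twice,
    before and after the phases are adjusted.\<close>
  have main: "(adj U ** X 0 ** U) $ j $ k * of_real (\<mu> k - \<mu> j) = - \<i> * (cdot (column j U) (vec 1) * cnj (cdot (column k U) (vec 1)) - (if j = k then 1 else 0))"
    if U: "adj U ** U = mat 1" "L 0 ** U = U ** ?D" for U j k
  proof -
    have UL: "adj U ** L 0 = ?D ** adj U"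
    proof -
      have "adj (L 0 ** U) = adj (U ** ?D)" using U(2) by simp
      moreover have "adj ?D = ?D" by (simp add: adj_def diag_def vec_eq_iff)
      ultimately show ?thesis by (simp add: adj_mult L_hermitian)
    qed
    have "adj U ** (X 0 ** L 0 - L 0 ** X 0) ** U = adj U ** X 0 ** (L 0 ** U) - (adj U ** L 0) ** X 0 ** U"
      by (simp only: matrix_mult_simps matrix_mul_assoc)
    also have "\<dots> = (adj U ** X 0 ** U) ** ?D - ?D ** (adj U ** X 0 ** U)"
      unfolding U(2) UL by (simp only: matrix_mul_assoc)
    finally have e: "adj U ** (X 0 ** L 0 - L 0 ** X 0) ** U = (adj U ** X 0 ** U) ** ?D - ?D ** (adj U ** X 0 ** U)" .
    have "(adj U ** X 0 ** U) $ j $ k * of_real (\<mu> k - \<mu> j) = ((adj U ** X 0 ** U) ** ?D - ?D ** (adj U ** X 0 ** U)) $ j $ k"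
      by (simp add: diag_mult_left diag_mult_right algebra_simps)
    also have "\<dots> = (adj U ** (X 0 ** L 0 - L 0 ** X 0) ** U) $ j $ k"
      unfolding e ..
    also have "X 0 ** L 0 - L 0 ** X 0 = mat \<i> - (\<chi> a b. \<i>)"
      unfolding XL_commutator by (simp add: vec_eq_iff mat_def)
    also have "adj U ** (mat \<i> - (\<chi> a b. \<i>)) ** U = mat \<i> ** (adj U ** U) - adj U ** (\<chi> a b. \<i>) ** U"
      by (simp only: matrix_mult_simps mat_commute[of _ "adj U", symmetric] matrix_mul_assoc)
    also have "(adj U ** (\<chi> a b. \<i>) ** U) $ j $ k = \<i> * (cdot (column j U) (vec 1) * cnj (cdot (column k U) (vec 1)))"
    proof -
      have "(adj U ** (\<chi> a b. \<i>) ** U) $ j $ k = (\<Sum>b\<in>UNIV. (\<Sum>a\<in>UNIV. cnj (U $ a $ j) * \<i>) * U $ b $ k)"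
        by (simp add: matrix_matrix_mult_def adj_def)
      also have "\<dots> = (\<Sum>a\<in>UNIV. cnj (U $ a $ j) * \<i>) * (\<Sum>b\<in>UNIV. U $ b $ k)"
        by (simp add: sum_distrib_left)
      also have "(\<Sum>a\<in>UNIV. cnj (U $ a $ j) * \<i>) = \<i> * cdot (column j U) (vec 1)"
        by (simp add: cdot_def column_def sum_distrib_left mult.commute)
      also have "(\<Sum>b\<in>UNIV. U $ b $ k) = cnj (cdot (column k U) (vec 1))"
        by (simp add: cdot_def column_def)
      finally show ?thesis by simp
    qed
    then have "(mat \<i> ** (adj U ** U) - adj U ** (\<chi> a b. \<i>) ** U) $ j $ k
       = - \<i> * (cdot (column j U) (vec 1) * cnj (cdot (column k U) (vec 1)) - (if j = k then 1 else 0))"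
      unfolding U(1) matrix_mul_rid by (simp add: mat_def algebra_simps)
    finally show ?thesis .
  qed
  define c where "c j = cdot (column j U\<^sub>0) (vec 1)" for j
  have c1: "c j * cnj (c j) = 1" for j
    using main[OF U\<^sub>0, of j j] by (simp add: c_def)
  \<comment> \<open>A repeated eigenvalue would force c_j cnj c_k = 0, although both factors have
    modulus 1 by the diagonal of the relation.\<close>
  have \<mu>: "\<mu> j \<noteq> \<mu> k" if "j \<noteq> k" for j k
  proof
    assume "\<mu> j = \<mu> k"
    then have "c j * cnj (c k) = 0"
      using main[OF U\<^sub>0, of j k] that by (simp add: c_def)
    then show False
      using c1[of j] c1[of k] by auto
  qed
  \<comment> \<open>Rephasing column j by c_j makes its pairing with the all-ones vector equal to
    cnj c_j c_j = 1.\<close>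
  define U where "U = U\<^sub>0 ** diag c"
  have dd: "diag a ** diag b = diag (\<lambda>i. a i * b i)" for a b :: "'n \<Rightarrow> complex"
    by (simp add: vec_eq_iff diag_mult_left diag_nth)
  have ad: "adj (diag c) = diag (\<lambda>i. cnj (c i))"
    by (simp add: adj_def diag_def vec_eq_iff)
  have "adj U ** U = adj (diag c) ** (adj U\<^sub>0 ** U\<^sub>0) ** diag c"
    by (simp only: U_def adj_mult matrix_mul_assoc)
  also have "\<dots> = diag (\<lambda>i. cnj (c i) * c i)"
    by (simp add: U\<^sub>0 ad dd)
  also have "\<dots> = mat 1"
    using c1 by (simp add: diag_def mat_def mult.commute)
  finally have U1: "adj U ** U = mat 1" .
  have U2: "L 0 ** U = U ** ?D"
  proof -
    have "L 0 ** U = L 0 ** U\<^sub>0 ** diag c"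
      by (simp only: U_def matrix_mul_assoc)
    also have "\<dots> = U\<^sub>0 ** (?D ** diag c)"
      by (simp only: U\<^sub>0 matrix_mul_assoc)
    also have "?D ** diag c = diag c ** ?D"
      by (simp add: dd mult.commute)
    finally show ?thesis
      by (simp only: U_def matrix_mul_assoc)
  qed
  have col: "cdot (column j U) (vec 1) = 1" for j
  proof -
    have "column j U = c j *s column j U\<^sub>0"
      by (simp add: U_def column_def vec_eq_iff diag_mult_right mult.commute)
    then show ?thesis
      unfolding \<open>column j U = _\<close> cdot_simps c_def[symmetric] using c1[of j] by (simp add: mult.commute)
  qed
  define Y where "Y = adj U ** X 0 ** U"
  define \<kappa> :: "real^'n" where "\<kappa> = (\<chi> i. \<mu> i)"
  define \<gamma> :: "real^'n" where "\<gamma> = (\<chi> i. Re (Y $ i $ i))"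
  have Yoff: "Y $ j $ k = \<i> / of_real (\<kappa> $ j - \<kappa> $ k)" if "j \<noteq> k" for j k
  proof -
    have "Y $ j $ k * of_real (\<mu> k - \<mu> j) = - \<i>"
      using main[OF U1 U2, of j k, unfolded col] that by (simp add: Y_def)
    moreover have "complex_of_real (\<mu> k) - of_real (\<mu> j) \<noteq> 0"
      using \<mu>[OF that] by simp
    ultimately have "Y $ j $ k = - \<i> / of_real (\<mu> k - \<mu> j)"
      using nonzero_eq_divide_eq[of "complex_of_real (\<mu> k) - of_real (\<mu> j)" "Y $ j $ k" "- \<i>"] by simp
    also have "\<dots> = \<i> / of_real (\<kappa> $ j - \<kappa> $ k)"
      unfolding \<kappa>_def by simp (metis divide_minus_left divide_minus_right minus_diff_eq)
    finally show ?thesis .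
  qed
  have "adj Y = Y"
    by (simp add: Y_def adj_mult X_hermitian matrix_mul_assoc)
  then have "cnj (Y $ j $ j) = Y $ j $ j" for j
    by (metis (no_types, lifting) adj_def vec_lambda_beta)
  then have Ydiag: "Y $ j $ j = of_real (\<gamma> $ j)" for j
    by (simp add: \<gamma>_def complex_eq_iff)
  have H: "scattering_matrix \<kappa> \<gamma> s = adj U ** (X 0 + (2 * s) *\<^sub>R L 0) ** U" for s
  proof -
    have "adj U ** (X 0 + (2 * s) *\<^sub>R L 0) ** U = Y + (2 * s) *\<^sub>R (adj U ** (L 0 ** U))"
      by (simp only: Y_def matrix_mult_simps matrix_mul_assoc)
    also have "adj U ** (L 0 ** U) = (adj U ** U) ** ?D"
      by (simp only: U2 matrix_mul_assoc)
    also have "\<dots> = ?D"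
      by (simp add: U1)
    finally have e: "adj U ** (X 0 + (2 * s) *\<^sub>R L 0) ** U = Y + (2 * s) *\<^sub>R ?D" .
    show ?thesis
      unfolding e by (auto simp: vec_eq_iff scattering_matrix_def Ydiag Yoff diag_nth \<kappa>_def scaleR_conv_of_real[where 'a = complex])
  qed
  have UU: "U ** adj U = mat 1"
    using U1 matrix_left_right_inverse by blast
  show thesis
  proof (rule that[of \<kappa> \<gamma>])
    show "inj (($) \<kappa>)"
      using \<mu> by (auto simp: inj_def \<kappa>_def)
    fix s j
    obtain w where w: "w \<noteq> 0" "(X 0 + (2 * s) *\<^sub>R L 0) *v w = (\<chi> i. y s j * w $ i)"
      using projection_eigenvector by blast
    have "U *v (adj U *v w) = w"
      by (simp add: matrix_vector_mul_assoc UU)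
    then have "adj U *v w \<noteq> 0"
      using w(1) by auto
    moreover have "scattering_matrix \<kappa> \<gamma> s *v (adj U *v w) = adj U *v ((X 0 + (2 * s) *\<^sub>R L 0) *v (U *v (adj U *v w)))"
      unfolding H by (simp only: matrix_vector_mul_assoc matrix_mul_assoc)
    then have "scattering_matrix \<kappa> \<gamma> s *v (adj U *v w) = (\<chi> i. y s j * (adj U *v w) $ i)"
      unfolding \<open>U *v (adj U *v w) = w\<close> w(2)
      by (simp add: vec_eq_iff matrix_vector_mult_def sum_distrib_left mult.left_commute)
    ultimately show "\<exists>w. w \<noteq> 0 \<and> scattering_matrix \<kappa> \<gamma> s *v w = (\<chi> i. y s j * w $ i)"
      by blast
  qed
qed

end

section \<open>Concentration\<close>

lemma integral_one_over_shifted_square: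
  fixes a :: real
  shows "integrable lborel (\<lambda>x. 1 / (1 + (x - a)\<^sup>2))" "(LINT x|lborel. 1 / (1 + (x - a)\<^sup>2)) = pi"
  using lborel_integrable_real_affine[OF integrable_one_over_one_plus_square, of 1 "- a"]
    lborel_integral_real_affine[of 1 "\<lambda>x. 1 / (1 + x\<^sup>2 :: real)" "- a"]
  by (simp_all add: integral_one_over_one_plus_square)

lemma abs_arctan_le: "\<bar>arctan u\<bar> \<le> \<bar>u\<bar>"
proof -
  have "norm (arctan u - arctan 0) \<le> 1 * norm (u - 0)"
  proof (rule field_differentiable_bound[of UNIV _ "\<lambda>x. inverse (1 + x\<^sup>2)"])
    show "norm (inverse (1 + z\<^sup>2)) \<le> 1" for z :: real
      by (simp add: inverse_le_1_iff abs_of_nonneg add_nonneg_nonneg)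
  qed (auto intro: DERIV_arctan)
  then show ?thesis by simp
qed

lemma set_integral_interval_bounds:
  fixes f F :: "real \<Rightarrow> real"
  assumes "a < b" and F: "\<And>x. a < x \<Longrightarrow> x < b \<Longrightarrow> (F has_real_derivative f x) (at x)"
    and f: "\<And>x. a < x \<Longrightarrow> x < b \<Longrightarrow> isCont f x" "\<And>x. a < x \<Longrightarrow> x < b \<Longrightarrow> 0 \<le> f x"
    and A: "(F \<longlongrightarrow> A) (at_right a)" and B: "(F \<longlongrightarrow> B) (at_left b)"
  shows "(LINT x:{a<..<b}|lborel. f x) = B - A"
proof -
  have "(LBINT x=ereal a..ereal b. f x) = B - A"
    by (rule interval_integral_FTC_nonneg(2)[where F = F])
      (use assms in \<open>auto simp: ereal_tendsto_simps\<close>)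
  then show ?thesis
    using \<open>a < b\<close> by (simp add: interval_lebesgue_integral_def)
qed

text \<open>Isolates what the estimates may depend on: \<epsilon>, the number of poles, and a radius
  r with gap at least 2 r, so that the intervals of radius r about the poles are disjoint. Time
  enters in no other way.\<close>

locale weighted_poles =
  fixes y p :: "'n::finite \<Rightarrow> real" and r \<epsilon> :: real
  assumes p_pos: "\<And>j. 0 < p j" and p_sum: "(\<Sum>j\<in>UNIV. p j) = 1"
    and r_pos: "0 < r" and eps_pos: "0 < \<epsilon>"
    and gap: "\<And>j k. j \<noteq> k \<Longrightarrow> 2 * r \<le> \<bar>y j - y k\<bar>"
begin

definition "S\<^sub>1 x = (\<Sum>j\<in>UNIV. p j / (y j - x))"
definition "S\<^sub>2 x = (\<Sum>j\<in>UNIV. p j / (y j - x)\<^sup>2)"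
definition "F x = 2 * \<epsilon> * S\<^sub>2 x / (1 + \<epsilon>\<^sup>2 * (S\<^sub>1 x)\<^sup>2)"
definition "\<theta> x = 2 * arctan (\<epsilon> * S\<^sub>1 x)"

lemma S\<^sub>2_nonneg: "0 \<le> S\<^sub>2 x"
  unfolding S\<^sub>2_def using p_pos by (intro sum_nonneg divide_nonneg_nonneg) (auto intro: less_imp_le)

lemma denominator_ge: "1 \<le> 1 + \<epsilon>\<^sup>2 * (S\<^sub>1 x)\<^sup>2"
  by simp

lemma F_nonneg: "0 \<le> F x"
  unfolding F_def using eps_pos S\<^sub>2_nonneg[of x] by (intro divide_nonneg_nonneg) (auto intro: add_nonneg_nonneg)

lemma F_le: "F x \<le> 2 * \<epsilon> * S\<^sub>2 x"
proof -
  have "F x \<le> 2 * \<epsilon> * S\<^sub>2 x / 1"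
    unfolding F_def using eps_pos S\<^sub>2_nonneg[of x] denominator_ge[of x]
    by (intro divide_left_mono) (auto intro: add_pos_nonneg)
  then show ?thesis by simp
qed

lemma isCont_S\<^sub>1: "x \<notin> range y \<Longrightarrow> isCont S\<^sub>1 x"
  unfolding S\<^sub>1_def[abs_def] by (intro continuous_intros) auto

lemma S\<^sub>1_deriv: "x \<notin> range y \<Longrightarrow> (S\<^sub>1 has_real_derivative S\<^sub>2 x) (at x)"
  unfolding S\<^sub>1_def[abs_def] S\<^sub>2_def
  by (intro DERIV_sum) (auto intro!: derivative_eq_intros simp: power2_eq_square)

lemma \<theta>_deriv:
  assumes "x \<notin> range y"
  shows "(\<theta> has_real_derivative F x) (at x)"
proof -
  have "((\<lambda>x. 2 * arctan (\<epsilon> * S\<^sub>1 x)) has_real_derivative 2 * ((1 / (1 + (\<epsilon> * S\<^sub>1 x)\<^sup>2)) * (\<epsilon> * S\<^sub>2 x))) (at x)"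
    by (auto intro!: derivative_eq_intros S\<^sub>1_deriv[OF assms] simp: inverse_eq_divide)
  moreover have "2 * ((1 / (1 + (\<epsilon> * S\<^sub>1 x)\<^sup>2)) * (\<epsilon> * S\<^sub>2 x)) = F x"
    by (simp add: F_def power_mult_distrib)
  ultimately show ?thesis
    unfolding \<theta>_def[abs_def] by simp
qed

lemma isCont_F: "x \<notin> range y \<Longrightarrow> isCont F x"
proof -
  assume x: "x \<notin> range y"
  have "isCont S\<^sub>2 x"
    unfolding S\<^sub>2_def[abs_def] using x by (intro continuous_intros) auto
  moreover have "1 + \<epsilon>\<^sup>2 * (S\<^sub>1 x)\<^sup>2 \<noteq> 0"
    using denominator_ge[of x] by linarith
  ultimately show ?thesis
    unfolding F_def[abs_def] using isCont_S\<^sub>1[OF x] by (intro continuous_intros)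
qed

lemma not_pole:
  assumes "0 < \<bar>x - y j\<bar>" "\<bar>x - y j\<bar> < 2 * r"
  shows "x \<notin> range y"
proof
  assume "x \<in> range y"
  then obtain k where k: "x = y k" by auto
  then have "k \<noteq> j" using assms(1) by auto
  from gap[OF this] show False using assms(2) k by simp
qed

lemma dist_ge:
  assumes "\<bar>x - y j\<bar> = r"
  shows "r \<le> \<bar>y k - x\<bar>"
  using assms gap[of k j] by (cases "k = j") (auto simp: abs_minus_commute)

text \<open>At distance r from one pole every pole is at distance at least r, and the weights sum to
  1, so the weighted sum is at most 1 / r.\<close>

lemma abs_\<theta>_le:
  assumes "\<bar>x - y j\<bar> = r"
  shows "\<bar>\<theta> x\<bar> \<le> 2 * \<epsilon> / r"
proof -
  have "\<bar>S\<^sub>1 x\<bar> \<le> (\<Sum>k\<in>UNIV. \<bar>p k / (y k - x)\<bar>)"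
    unfolding S\<^sub>1_def by (rule sum_abs)
  also have "\<dots> \<le> (\<Sum>k\<in>UNIV. p k / r)"
    using less_imp_le[OF p_pos] r_pos dist_ge[OF assms]
    by (intro sum_mono) (auto simp: abs_divide intro!: frac_le)
  also have "\<dots> = 1 / r"
    by (simp add: sum_divide_distrib[symmetric] p_sum)
  finally have "\<epsilon> * \<bar>S\<^sub>1 x\<bar> \<le> \<epsilon> * (1 / r)"
    using eps_pos by (intro mult_left_mono) auto
  then show ?thesis
    using abs_arctan_le[of "\<epsilon> * S\<^sub>1 x"] eps_pos by (simp add: \<theta>_def abs_mult)
qed

lemma S\<^sub>1_split: "S\<^sub>1 x = p j / (y j - x) + (\<Sum>k\<in>UNIV - {j}. p k / (y k - x))"
  unfolding S\<^sub>1_def by (simp add: sum.remove[of UNIV j])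

lemma rest_tendsto: "((\<lambda>x. \<Sum>k\<in>UNIV - {j}. p k / (y k - x)) \<longlongrightarrow> (\<Sum>k\<in>UNIV - {j}. p k / (y k - y j))) (at (y j) within T)"
proof (intro tendsto_intros)
  fix k assume "k \<in> UNIV - {j}"
  then show "y k - y j \<noteq> 0"
    using gap[of k j] r_pos by auto
qed

text \<open>The one-sided limits at a pole are independent of its weight, which is why each particle
  carries mass close to 2 pi however small that weight is.\<close>

lemma \<theta>_at_left: "(\<theta> \<longlongrightarrow> pi) (at_left (y j))"
proof -
  have "filterlim (\<lambda>x. y j - x) (at_right 0) (at_left (y j))"
    by (auto simp: filterlim_at eventually_at_filter intro!: tendsto_eq_intros)
  then have "filterlim (\<lambda>x. p j * inverse (y j - x)) at_top (at_left (y j))"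
    by (intro filterlim_tendsto_pos_mult_at_top[OF tendsto_const p_pos] filterlim_compose[OF filterlim_inverse_at_top_right])
  then have "filterlim (\<lambda>x. p j / (y j - x)) at_top (at_left (y j))"
    by (simp add: divide_inverse)
  then have "filterlim S\<^sub>1 at_top (at_left (y j))"
    unfolding S\<^sub>1_split[of _ j]
    by (subst add.commute) (rule filterlim_tendsto_add_at_top[OF rest_tendsto])
  then have "filterlim (\<lambda>x. \<epsilon> * S\<^sub>1 x) at_top (at_left (y j))"
    by (rule filterlim_tendsto_pos_mult_at_top[OF tendsto_const eps_pos])
  then have "((\<lambda>x. arctan (\<epsilon> * S\<^sub>1 x)) \<longlongrightarrow> pi / 2) (at_left (y j))"
    by (rule filterlim_compose[OF tendsto_arctan_at_top])
  then have "((\<lambda>x. 2 * arctan (\<epsilon> * S\<^sub>1 x)) \<longlongrightarrow> 2 * (pi / 2)) (at_left (y j))"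
    by (intro tendsto_intros)
  then show ?thesis
    unfolding \<theta>_def[abs_def] by simp
qed

lemma \<theta>_at_right: "(\<theta> \<longlongrightarrow> - pi) (at_right (y j))"
proof -
  have "filterlim (\<lambda>x. y j - x) (at_left 0) (at_right (y j))"
    by (auto simp: filterlim_at eventually_at_filter intro!: tendsto_eq_intros)
  then have "filterlim (\<lambda>x. p j * inverse (y j - x)) at_bot (at_right (y j))"
    by (intro filterlim_tendsto_pos_mult_at_bot[OF tendsto_const p_pos] filterlim_compose[OF filterlim_inverse_at_bot_neg])
  then have "filterlim (\<lambda>x. p j / (y j - x)) at_bot (at_right (y j))"
    by (simp add: divide_inverse)
  then have "filterlim S\<^sub>1 at_bot (at_right (y j))"
    unfolding S\<^sub>1_split[of _ j]
    by (subst add.commute) (rule filterlim_tendsto_add_at_bot_iff[OF rest_tendsto, THEN iffD2])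
  then have "filterlim (\<lambda>x. \<epsilon> * S\<^sub>1 x) at_bot (at_right (y j))"
    by (rule filterlim_tendsto_pos_mult_at_bot[OF tendsto_const eps_pos])
  then have "((\<lambda>x. arctan (\<epsilon> * S\<^sub>1 x)) \<longlongrightarrow> - (pi / 2)) (at_right (y j))"
    by (rule filterlim_compose[OF tendsto_arctan_at_bot])
  then have "((\<lambda>x. 2 * arctan (\<epsilon> * S\<^sub>1 x)) \<longlongrightarrow> 2 * - (pi / 2)) (at_right (y j))"
    by (intro tendsto_intros)
  then show ?thesis
    unfolding \<theta>_def[abs_def] by simp
qed

lemma isCont_\<theta>: "x \<notin> range y \<Longrightarrow> isCont \<theta> x"
  using \<theta>_deriv DERIV_isCont by blast

text \<open>\<open>F\<close> agrees with the density only off the poles, where division by zero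
  would put 0 for the singular terms; \<open>w\<close> stands for the true density.\<close>

context
  fixes w :: "real \<Rightarrow> real"
  assumes w_int: "integrable lborel w" and w_nonneg: "\<And>x. 0 \<le> w x" and w_eq: "\<And>x. x \<notin> range y \<Longrightarrow> w x = F x"
begin

definition "I j = {y j - r<..<y j + r}"

definition "Far = - (\<Union>j. I j)"

text \<open>The fundamental theorem on the two halves of \<open>I j\<close> gives pi - \<theta>(y_j
  - r) and \<theta>(y_j + r) + pi; each endpoint value is at most 2 \<epsilon> / r in
  modulus.\<close>

lemma near_mass: "\<bar>(LINT x|lborel. indicator (I j) x * w x) - 2 * pi\<bar> \<le> 4 * \<epsilon> / r"
proof -
  let ?A = "{y j - r<..<y j}" and ?B = "{y j<..<y j + r}"
  have NA: "x \<notin> range y" if "y j - r < x" "x < y j" for x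
    using that by (intro not_pole[of x j]) auto
  have NB: "x \<notin> range y" if "y j < x" "x < y j + r" for x
    using that by (intro not_pole[of x j]) auto
  have A: "(LINT x:?A|lborel. F x) = pi - \<theta> (y j - r)"
  proof (rule set_integral_interval_bounds[where F = \<theta>])
    have "y j - r \<notin> range y"
      using r_pos by (intro not_pole[of _ j]) auto
    then show "(\<theta> \<longlongrightarrow> \<theta> (y j - r)) (at_right (y j - r))"
      using isCont_\<theta> by (auto simp: isCont_def intro: tendsto_mono[OF at_le])
  qed (use r_pos in \<open>auto intro: \<theta>_deriv[OF NA] isCont_F[OF NA] F_nonneg \<theta>_at_left\<close>)
  have B: "(LINT x:?B|lborel. F x) = \<theta> (y j + r) - (- pi)"
  proof (rule set_integral_interval_bounds[where F = \<theta>])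
    have "y j + r \<notin> range y"
      using r_pos by (intro not_pole[of _ j]) auto
    then show "(\<theta> \<longlongrightarrow> \<theta> (y j + r)) (at_left (y j + r))"
      using isCont_\<theta> by (auto simp: isCont_def intro: tendsto_mono[OF at_le])
  qed (use r_pos in \<open>auto intro: \<theta>_deriv[OF NB] isCont_F[OF NB] F_nonneg \<theta>_at_right\<close>)
  have int: "integrable lborel (\<lambda>x. indicator S x * w x)" if "S \<in> sets lborel" for S
    using integrable_mult_indicator[OF that w_int] by simp
  have "AE x in lborel. indicator (I j) x * w x = indicator ?A x * w x + indicator ?B x * w x"
    using AE_lborel_singleton[of "y j"] by eventually_elim (auto simp: I_def indicator_def)
  then have "(LINT x|lborel. indicator (I j) x * w x) = (LINT x|lborel. indicator ?A x * w x + indicator ?B x * w x)"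
    using int by (intro integral_cong_AE) (auto simp: I_def)
  also have "\<dots> = (LINT x|lborel. indicator ?A x * w x) + (LINT x|lborel. indicator ?B x * w x)"
    by (intro Bochner_Integration.integral_add int) auto
  also have "(LINT x|lborel. indicator ?A x * w x) = (LINT x:?A|lborel. F x)"
    unfolding set_lebesgue_integral_def
    by (intro Bochner_Integration.integral_cong) (auto simp: indicator_def w_eq[OF NA])
  also have "(LINT x|lborel. indicator ?B x * w x) = (LINT x:?B|lborel. F x)"
    unfolding set_lebesgue_integral_def
    by (intro Bochner_Integration.integral_cong) (auto simp: indicator_def w_eq[OF NB])
  finally show ?thesis
    using abs_\<theta>_le[of "y j - r" j] abs_\<theta>_le[of "y j + r" j] r_pos unfolding A B by simp
qed

text \<open>Away from the poles the denominator of \<open>F\<close> is dropped and each inverse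
  square is dominated by a multiple of 1 / (1 + (x - y_j)^2), of integral pi. As the weights sum to
  1, the number of poles does not enter.\<close>

lemma far_mass:
  "(LINT x|lborel. indicator Far x * w x) \<le> 2 * \<epsilon> * (1 + 1 / r\<^sup>2) * pi"
proof -
  let ?h = "\<lambda>x. 2 * \<epsilon> * (1 + 1 / r\<^sup>2) * (\<Sum>j\<in>UNIV. p j * (1 / (1 + (x - y j)\<^sup>2)))"
  have sets: "Far \<in> sets lborel"
    unfolding Far_def I_def by auto
  have "(LINT x|lborel. indicator Far x * w x) \<le> (LINT x|lborel. ?h x)"
  proof (rule integral_mono)
    show "integrable lborel (\<lambda>x. indicator Far x * w x)"
      using integrable_mult_indicator[OF sets w_int] by simp
    show "integrable lborel ?h"
      by (intro integrable_mult_right Bochner_Integration.integrable_sum integral_one_over_shifted_square)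
    fix x
    show "indicator Far x * w x \<le> ?h x"
    proof (cases "x \<in> Far")
      case True
      then have far: "r \<le> \<bar>y j - x\<bar>" for j
      proof -
        have "x \<notin> I j" using True by (auto simp: Far_def)
        then show ?thesis by (auto simp: I_def)
      qed
      have "x \<notin> range y"
      proof
        assume "x \<in> range y"
        then obtain k where "x = y k" by auto
        then show False using far[of k] r_pos by simp
      qed
      then have "w x \<le> 2 * \<epsilon> * S\<^sub>2 x"
        using w_eq F_le by simp
      also have "S\<^sub>2 x \<le> (\<Sum>j\<in>UNIV. p j * ((1 + 1 / r\<^sup>2) * (1 / (1 + (x - y j)\<^sup>2))))"
        unfolding S\<^sub>2_def
      proof (intro sum_mono)
        fix j
        define a where "a = (y j - x)\<^sup>2"
        have "r\<^sup>2 \<le> a"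
          using far[of j] r_pos power_mono[of r "\<bar>y j - x\<bar>" 2] by (simp add: a_def)
        moreover have "0 < r\<^sup>2" using r_pos by simp
        ultimately have "0 < a"
          by linarith
        have "1 / a \<le> 1 / r\<^sup>2"
          using \<open>r\<^sup>2 \<le> a\<close> \<open>0 < r\<^sup>2\<close> \<open>0 < a\<close> by (intro divide_left_mono mult_pos_pos) auto
        have "1 / a = (1 + 1 / a) * (1 / (1 + a))"
          using \<open>0 < a\<close> by (simp add: field_simps)
        also have "\<dots> \<le> (1 + 1 / r\<^sup>2) * (1 / (1 + a))"
          using \<open>0 < a\<close> \<open>1 / a \<le> 1 / r\<^sup>2\<close> by (intro mult_right_mono) auto
        finally have "1 / a \<le> (1 + 1 / r\<^sup>2) * (1 / (1 + a))" .
        then have "p j * (1 / a) \<le> p j * ((1 + 1 / r\<^sup>2) * (1 / (1 + a)))"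
          using p_pos[of j] by (intro mult_left_mono) auto
        then show "p j / (y j - x)\<^sup>2 \<le> p j * ((1 + 1 / r\<^sup>2) * (1 / (1 + (x - y j)\<^sup>2)))"
          by (simp add: a_def power2_commute)
      qed
      finally show ?thesis
        using True eps_pos by (simp add: sum_distrib_left mult_ac)
    next
      case False
      have "0 \<le> ?h x"
        using p_pos eps_pos
        by (intro mult_nonneg_nonneg sum_nonneg) (auto intro: less_imp_le add_nonneg_nonneg)
      then show ?thesis using False by simp
    qed
  qed
  also have "\<dots> = 2 * \<epsilon> * (1 + 1 / r\<^sup>2) * (\<Sum>j\<in>UNIV. p j * pi)"
  proof -
    have "(LINT x|lborel. (\<Sum>j\<in>UNIV. p j * (1 / (1 + (x - y j)\<^sup>2)))) = (\<Sum>j\<in>UNIV. (LINT x|lborel. p j * (1 / (1 + (x - y j)\<^sup>2))))"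
      by (intro Bochner_Integration.integral_sum integrable_mult_right integral_one_over_shifted_square)
    then show ?thesis
      by (simp only: integral_mult_right_zero integral_one_over_shifted_square)
  qed
  also have "\<dots> = 2 * \<epsilon> * (1 + 1 / r\<^sup>2) * pi"
    by (simp add: sum_distrib_right[symmetric] p_sum)
  finally show ?thesis .
qed

text \<open>On \<open>I j\<close> the test function differs from its value at the pole by at most
  \<Lambda> r, and the mass error is weighted by S; the far part costs S times its mass. Complex
  \<phi> with general S and \<Lambda> covers both modes of convergence in the theorem.\<close>

lemma concentration:
  fixes \<phi> :: "real \<Rightarrow> complex"
  assumes bound: "\<And>x. cmod (\<phi> x) \<le> S" and lip: "\<And>x x'. cmod (\<phi> x - \<phi> x') \<le> \<Lambda> * \<bar>x - x'\<bar>"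
    and "0 \<le> \<Lambda>" and cont: "continuous_on UNIV \<phi>"
  shows "cmod ((LINT x|lborel. of_real (w x) * \<phi> x) - of_real (2 * pi) * (\<Sum>j\<in>UNIV. \<phi> (y j)))
    \<le> real CARD('n) * (\<Lambda> * r * (2 * pi + 4 * \<epsilon> / r) + S * (4 * \<epsilon> / r))
      + S * (2 * \<epsilon> * (1 + 1 / r\<^sup>2) * pi)"
proof -
  let ?f = "\<lambda>T \<psi> x. complex_of_real (indicator T x * w x) * \<psi> x"
  have [measurable]: "\<phi> \<in> borel_measurable borel"
    using cont borel_measurable_continuous_onI by blast
  have "0 \<le> S" using order_trans[OF norm_ge_zero bound[of 0]] .
  have setsI: "I j \<in> sets lborel" for j by (simp add: I_def)
  have sets: "Far \<in> sets lborel"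
    unfolding Far_def I_def by auto
  have intw: "integrable lborel (\<lambda>x. indicator T x * w x)" if "T \<in> sets lborel" for T
    using integrable_mult_indicator[OF that w_int] by simp
  have int: "integrable lborel (\<lambda>x. ?f T \<psi> x)"
    if [measurable]: "T \<in> sets lborel" "\<psi> \<in> borel_measurable borel" and "\<And>x. cmod (\<psi> x) \<le> B" for T and \<psi> :: "real \<Rightarrow> complex" and B
  proof (rule Bochner_Integration.integrable_bound)
    show "integrable lborel (\<lambda>x. B * (indicator T x * w x))"
      by (intro integrable_mult_right intw that)
    show "AE x in lborel. norm (?f T \<psi> x) \<le> norm (B * (indicator T x * w x))"
    proof (rule AE_I2)
      fix x
      have "0 \<le> B" using order_trans[OF norm_ge_zero that(3)] .
      then show "norm (?f T \<psi> x) \<le> norm (B * (indicator T x * w x))"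
        using mult_left_mono[OF that(3)[of x], of "\<bar>indicator T x * w x\<bar>"] by (simp add: norm_mult abs_mult mult.commute)
    qed
  qed (use w_int in measurable)
  have disj: "(\<Sum>j\<in>UNIV. indicator (I j) x) + indicator Far x = (1 :: real)" for x
  proof (cases "x \<in> Far")
    case False
    then obtain j where j: "x \<in> I j" by (auto simp: Far_def)
    have "x \<notin> I k" if "k \<noteq> j" for k
      using j gap[OF that] by (auto simp: I_def abs_if split: if_splits)
    then have "(\<Sum>k\<in>UNIV. indicator (I k) x) = (\<Sum>k\<in>{j}. indicator (I k) x :: real)"
      by (intro sum.mono_neutral_right) auto
    then show ?thesis using j False by simp
  qed (auto simp: Far_def)
  have "(LINT x|lborel. of_real (w x) * \<phi> x)
     = (LINT x|lborel. (\<Sum>j\<in>UNIV. ?f (I j) \<phi> x) + ?f Far \<phi> x)"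
  proof (intro Bochner_Integration.integral_cong refl)
    fix x
    have e1: "of_real (w x) * \<phi> x = of_real (((\<Sum>j\<in>UNIV. indicator (I j) x) + indicator Far x) * w x) * \<phi> x"
      unfolding disj by simp
    have e2: "of_real (((\<Sum>j\<in>UNIV. indicator (I j) x) + indicator Far x) * w x) * \<phi> x
        = (\<Sum>j\<in>UNIV. ?f (I j) \<phi> x) + ?f Far \<phi> x"
      by (simp only: distrib_right sum_distrib_right of_real_add of_real_sum of_real_mult)
    show "of_real (w x) * \<phi> x = (\<Sum>j\<in>UNIV. ?f (I j) \<phi> x) + ?f Far \<phi> x"
      by (rule trans[OF e1 e2])
  qed
  also have "\<dots> = (\<Sum>j\<in>UNIV. LINT x|lborel. ?f (I j) \<phi> x) + (LINT x|lborel. ?f Far \<phi> x)"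
    by (subst Bochner_Integration.integral_add)
      (auto intro!: Bochner_Integration.integrable_sum Bochner_Integration.integral_sum int[OF _ _ bound] setsI sets simp del: of_real_mult)
  finally have split: "(LINT x|lborel. of_real (w x) * \<phi> x) - of_real (2 * pi) * (\<Sum>j\<in>UNIV. \<phi> (y j))
     = (\<Sum>j\<in>UNIV. (LINT x|lborel. ?f (I j) \<phi> x) - of_real (2 * pi) * \<phi> (y j))
       + (LINT x|lborel. ?f Far \<phi> x)"
    by (simp add: sum_subtractf sum_distrib_left)
  have near: "cmod ((LINT x|lborel. ?f (I j) \<phi> x) - of_real (2 * pi) * \<phi> (y j))
      \<le> \<Lambda> * r * (2 * pi + 4 * \<epsilon> / r) + S * (4 * \<epsilon> / r)" for j
  proof -
    let ?m = "LINT x|lborel. indicator (I j) x * w x"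
    let ?\<psi> = "\<lambda>x. \<phi> x - \<phi> (y j)"
    have b: "cmod (?\<psi> x) \<le> S + S" for x
      using bound by (intro order_trans[OF norm_triangle_ineq4] add_mono)
    have "(LINT x|lborel. ?f (I j) \<phi> x)
        = (LINT x|lborel. ?f (I j) ?\<psi> x + of_real (indicator (I j) x * w x) * \<phi> (y j))"
      by (simp add: algebra_simps)
    also have "\<dots> = (LINT x|lborel. ?f (I j) ?\<psi> x) + (LINT x|lborel. of_real (indicator (I j) x * w x) * \<phi> (y j))"
      by (intro Bochner_Integration.integral_add int[OF _ _ b] int[where \<psi> = "\<lambda>x. \<phi> (y j)", OF _ _ bound] setsI) auto
    also have "(LINT x|lborel. of_real (indicator (I j) x * w x) * \<phi> (y j)) = of_real ?m * \<phi> (y j)"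
      by (simp only: integral_mult_left_zero integral_complex_of_real)
    finally have "(LINT x|lborel. ?f (I j) \<phi> x) - of_real (2 * pi) * \<phi> (y j)
       = (LINT x|lborel. ?f (I j) ?\<psi> x) + of_real (?m - 2 * pi) * \<phi> (y j)"
      by (simp add: algebra_simps)
    then have "cmod ((LINT x|lborel. ?f (I j) \<phi> x) - of_real (2 * pi) * \<phi> (y j))
       \<le> cmod (LINT x|lborel. ?f (I j) ?\<psi> x) + cmod (of_real (?m - 2 * pi) * \<phi> (y j))"
      by (simp only: norm_triangle_ineq)
    also have "cmod (of_real (?m - 2 * pi) * \<phi> (y j)) \<le> S * (4 * \<epsilon> / r)"
    proof -
      have "\<bar>?m - 2 * pi\<bar> * cmod (\<phi> (y j)) \<le> (4 * \<epsilon> / r) * S"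
        using near_mass[of j] bound[of "y j"] eps_pos r_pos by (intro mult_mono) auto
      then show ?thesis
        by (simp only: norm_mult norm_of_real mult.commute[of S])
    qed
    also have "cmod (LINT x|lborel. ?f (I j) ?\<psi> x) \<le> (LINT x|lborel. \<Lambda> * r * (indicator (I j) x * w x))"
    proof (rule Bochner_Integration.integral_norm_bound_integral)
      show "integrable lborel (\<lambda>x. ?f (I j) ?\<psi> x)"
        by (intro int[OF _ _ b] setsI) auto
      show "integrable lborel (\<lambda>x. \<Lambda> * r * (indicator (I j) x * w x))"
        by (intro integrable_mult_right intw setsI)
      fix x
      show "cmod (?f (I j) ?\<psi> x) \<le> \<Lambda> * r * (indicator (I j) x * w x)"
      proof (cases "x \<in> I j")
        case True
        then have "\<bar>x - y j\<bar> \<le> r"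
          by (auto simp: I_def abs_le_iff)
        then have "cmod (?\<psi> x) \<le> \<Lambda> * r"
          using lip[of x "y j"] \<open>0 \<le> \<Lambda>\<close> by (meson mult_left_mono order_trans)
        then show ?thesis
          using True w_nonneg[of x] by (simp add: norm_mult mult.commute mult_left_mono)
      qed simp
    qed
    also have "\<dots> = \<Lambda> * r * ?m"
      by (rule integral_mult_right_zero)
    also have "\<dots> \<le> \<Lambda> * r * (2 * pi + 4 * \<epsilon> / r)"
      using near_mass[of j] \<open>0 \<le> \<Lambda>\<close> r_pos by (intro mult_left_mono) auto
    finally show ?thesis by simp
  qed
  have far: "cmod (LINT x|lborel. ?f Far \<phi> x)
     \<le> S * (2 * \<epsilon> * (1 + 1 / r\<^sup>2) * pi)"
  proof -
    have "cmod (LINT x|lborel. ?f Far \<phi> x) \<le> (LINT x|lborel. S * (indicator Far x * w x))"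
    proof (rule Bochner_Integration.integral_norm_bound_integral)
      show "integrable lborel (\<lambda>x. ?f Far \<phi> x)"
        by (intro int[OF _ _ bound] sets) auto
      show "integrable lborel (\<lambda>x. S * (indicator Far x * w x))"
        by (intro integrable_mult_right intw sets)
      show "cmod (?f Far \<phi> x) \<le> S * (indicator Far x * w x)" for x
        using bound[of x] w_nonneg[of x] by (simp add: norm_mult mult.commute mult_left_mono mult_right_mono indicator_def)
    qed
    also have "\<dots> = S * (LINT x|lborel. indicator Far x * w x)"
      by (rule integral_mult_right_zero)
    also have "\<dots> \<le> S * (2 * \<epsilon> * (1 + 1 / r\<^sup>2) * pi)"
      by (intro mult_left_mono far_mass \<open>0 \<le> S\<close>)
    finally show ?thesis .
  qed
  have "cmod (\<Sum>j\<in>UNIV. (LINT x|lborel. ?f (I j) \<phi> x) - of_real (2 * pi) * \<phi> (y j))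
      \<le> (\<Sum>j\<in>(UNIV :: 'n set). \<Lambda> * r * (2 * pi + 4 * \<epsilon> / r) + S * (4 * \<epsilon> / r))"
    by (rule order_trans[OF norm_sum]) (intro sum_mono near)
  also have "\<dots> = real CARD('n) * (\<Lambda> * r * (2 * pi + 4 * \<epsilon> / r) + S * (4 * \<epsilon> / r))"
    by simp
  finally show ?thesis
    unfolding split using far by (intro order_trans[OF norm_triangle_ineq] add_mono)
qed

end
end

section \<open>The density in terms of the undamped spectral data\<close>

lemma cdot_axis: "cdot (a *s axis m 1) v = cnj a * v $ m"
  by (simp add: cdot_def axis_def if_distrib[of "\<lambda>x. cnj x * _"] if_distrib[of "\<lambda>x. _ * x"] cong: if_cong)

context soliton begin

text \<open>The u_j form an orthonormal eigenbasis of the undamped matrix M + i \<rho> e_m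
  e_m^*.\<close>

context
  fixes u :: "'n \<Rightarrow> complex^'n" and y :: "'n \<Rightarrow> real" and t :: real
  assumes orth: "\<And>j k. cdot (u j) (u k) = (if j = k then 1 else 0)"
    and eig: "\<And>j i. (M t *v u j) $ i = of_real (y j) * u j $ i - (if i = m then \<i> * of_real \<rho> * u j $ m else 0)"
begin

lemma completeness: "(\<Sum>j\<in>UNIV. u j $ i * cnj (u j $ k)) = (if i = k then 1 else 0)"
proof -
  define U where "U = (\<chi> i j. u j $ i)"
  have col: "column j U = u j" for j
    by (simp add: U_def column_def vec_eq_iff)
  have "adj U ** U = mat 1"
    by (simp add: vec_eq_iff adj_mult_nth col orth mat_def)
  then have "U ** adj U = mat 1"
    using matrix_left_right_inverse by blast
  then have "(U ** adj U) $ i $ k = (if i = k then 1 else 0)"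
    by (simp add: mat_def)
  then show ?thesis
    by (simp add: matrix_matrix_mult_def U_def adj_def)
qed

text \<open>If u_j had no m-th component, the damping would not act on it and M would have a real
  eigenvalue.\<close>

lemma weight_pos: "0 < (cmod (u j $ m))\<^sup>2"
proof -
  have "u j $ m \<noteq> 0"
  proof
    assume 0: "u j $ m = 0"
    then have "(M t - mat (of_real (y j))) *v u j = 0"
      using eig[of j] by (simp add: matrix_vector_mult_diff_rdistrib mat_mult_vec vec_eq_iff)
    then have "u j = 0"
      by (rule kernel_trivial[rotated]) simp
    then show False
      using orth[of j j] by (simp add: cdot_simps)
  qed
  then show ?thesis by simp
qed

lemma weight_sum: "(\<Sum>j\<in>UNIV. (cmod (u j $ m))\<^sup>2) = 1"
proof -
  have "complex_of_real (\<Sum>j\<in>UNIV. (cmod (u j $ m))\<^sup>2) = (\<Sum>j\<in>UNIV. u j $ m * cnj (u j $ m))"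
    by (simp add: complex_norm_square del: of_real_power)
  then show ?thesis
    unfolding completeness using of_real_eq_1_iff by fastforce
qed

text \<open>Here \<open>g\<close> is the undamped resolvent applied to \<open>e\<^sub>m\<close>; the damping is a rank-one
  perturbation, and the commutator identity turns \<open>|1\<^sup>* g|\<^sup>2\<close> into \<open>|g|\<^sup>2\<close>.\<close>

lemma density_formula:
  assumes x: "x \<notin> range y"
  defines "S\<^sub>1 \<equiv> \<Sum>j\<in>UNIV. (cmod (u j $ m))\<^sup>2 / (y j - x)"
    and "S\<^sub>2 \<equiv> \<Sum>j\<in>UNIV. (cmod (u j $ m))\<^sup>2 / (y j - x)\<^sup>2"
  shows "(cmod (multisoliton l m \<rho> \<gamma> \<phi> t x))\<^sup>2 = 2 * \<rho> * S\<^sub>2 / (1 + \<rho>\<^sup>2 * S\<^sub>1\<^sup>2)"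
proof -
  let ?A = "M t - mat (complex_of_real x)" and ?e = "axis m 1 :: complex^'n"
  \<comment> \<open>Coordinates in the eigenbasis of the undamped resolvent applied to e_m.\<close>
  define c :: "complex^'n" where "c = (\<chi> j. cnj (u j $ m) / of_real (y j - x))"
  define U where "U = (\<chi> i j. u j $ i)"
  define g where "g = U *v c"
  have yx: "complex_of_real (y j - x) \<noteq> 0" for j
    using x by auto
  have gi: "g $ i = (\<Sum>j\<in>UNIV. u j $ i * c $ j)" for i
    by (simp add: g_def U_def matrix_vector_mult_def)
  have gm: "g $ m = of_real S\<^sub>1"
    unfolding gi S\<^sub>1_def c_def by (simp add: complex_norm_square del: of_real_power)
  have "(?A *v g) $ i = ((1 - \<i> * of_real (\<rho> * S\<^sub>1)) *s ?e) $ i" for i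
  proof -
    have "(M t *v g) $ i = (\<Sum>k\<in>UNIV. \<Sum>j\<in>UNIV. M t $ i $ k * (u j $ k * c $ j))"
      by (simp add: matrix_vector_mult_def gi sum_distrib_left)
    also have "\<dots> = (\<Sum>j\<in>UNIV. \<Sum>k\<in>UNIV. M t $ i $ k * (u j $ k * c $ j))"
      by (rule sum.swap)
    also have "\<dots> = (\<Sum>j\<in>UNIV. (M t *v u j) $ i * c $ j)"
      by (simp add: matrix_vector_mult_def sum_distrib_right mult.assoc)
    finally have "(?A *v g) $ i = (\<Sum>j\<in>UNIV. (M t *v u j) $ i * c $ j - of_real x * (u j $ i * c $ j))"
      by (simp add: matrix_vector_mult_diff_rdistrib mat_mult_vec gi sum_distrib_left sum_subtractf)
    also have "\<dots> = (\<Sum>j\<in>UNIV. u j $ i * cnj (u j $ m) - (if i = m then \<i> * of_real \<rho> * (u j $ m * c $ j) else 0))"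
    proof (intro sum.cong refl)
      fix j
      have "of_real (y j - x) * c $ j = cnj (u j $ m)"
        using yx[of j] by (simp add: c_def)
      then have "u j $ i * cnj (u j $ m) = of_real (y j) * u j $ i * c $ j - of_real x * (u j $ i * c $ j)"
        by (metis (no_types, lifting) left_diff_distrib mult.assoc mult.left_commute of_real_diff)
      then show "(M t *v u j) $ i * c $ j - of_real x * (u j $ i * c $ j)
          = u j $ i * cnj (u j $ m) - (if i = m then \<i> * of_real \<rho> * (u j $ m * c $ j) else 0)"
        unfolding eig by (cases "i = m") (simp_all add: algebra_simps)
    qed
    also have "\<dots> = (if i = m then 1 else 0) - (if i = m then \<i> * of_real \<rho> * g $ m else 0)"
      unfolding sum_subtractf completeness by (simp add: gi sum_distrib_left)
    finally show ?thesis
      by (simp add: gm axis_def)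
  qed
  then have Ag: "?A *v g = (1 - \<i> * of_real (\<rho> * S\<^sub>1)) *s ?e"
    by (simp add: vec_eq_iff)
  \<comment> \<open>The adjoint reverses the sign of the damping.\<close>
  have adjA: "adj ?A *v g = (1 + \<i> * of_real (\<rho> * S\<^sub>1)) *s ?e"
  proof -
    have comp: "(adj ?A *v g) $ i = (?A *v g) $ i + (if i = m then 2 * \<i> * of_real \<rho> * g $ m else 0)" for i
    proof -
      have "adj ?A $ i $ k = ?A $ i $ k + (if k = m then if i = m then 2 * \<i> * of_real \<rho> else 0 else 0)" for k
        by (simp add: adj_def M_cnj mat_def)
      then show ?thesis
        by (simp add: matrix_vector_mult_def distrib_right sum.distrib if_distrib[of "\<lambda>x. x * _"] cong: if_cong)
    qed
    have "(adj ?A *v g) $ i = ((1 + \<i> * of_real (\<rho> * S\<^sub>1)) *s ?e) $ i" for i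
      using comp[of i] unfolding Ag by (cases "i = m") (simp_all add: gm axis_def algebra_simps)
    then show ?thesis
      by (simp add: vec_eq_iff)
  qed
  have cgg: "cdot g g = of_real S\<^sub>2"
  proof -
    have "adj U ** U = mat 1"
      by (simp add: vec_eq_iff adj_mult_nth U_def column_def orth mat_def)
    then have "cdot g g = cdot c c"
      unfolding g_def by (subst cdot_adj) (simp add: matrix_vector_mul_assoc)
    also have "\<dots> = of_real S\<^sub>2"
      unfolding cdot_def S\<^sub>2_def c_def of_real_sum
    proof (intro sum.cong refl)
      fix j
      have "u j $ m * cnj (u j $ m) = of_real ((cmod (u j $ m))\<^sup>2)"
        by (rule complex_norm_square[symmetric])
      then show "cnj ((\<chi> j. cnj (u j $ m) / of_real (y j - x)) $ j) * (\<chi> j. cnj (u j $ m) / of_real (y j - x)) $ j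
          = complex_of_real ((cmod (u j $ m))\<^sup>2 / (y j - x)\<^sup>2)"
        by (simp add: power2_eq_square)
    qed
    finally show ?thesis .
  qed
  define a where "a = cdot g (vec 1)"
  have sumg: "(\<Sum>j\<in>UNIV. g $ j) = cnj a"
    by (simp add: a_def cdot_def)
  \<comment> \<open>Both terms are multiples of component m of a vector multiplied by Lambda, hence
    0; the commutator then gives |1^* g|^2 = |g|^2.\<close>
  have "cdot g (Lam *v (?A *v g) - ?A *v (Lam *v g)) = 0"
  proof -
    have "Lam *v (?A *v g) = 0"
      unfolding Ag by (simp add: vec_eq_iff Lam_component axis_def lm)
    moreover have "cdot g (?A *v (Lam *v g)) = 0"
      unfolding cdot_adj[of g ?A] adjA cdot_axis by (simp add: Lam_component lm)
    ultimately show ?thesis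
      by (simp only: cdot_simps diff_zero)
  qed
  then have "cdot g (\<chi> i. \<i> * (cnj a - g $ i)) = 0"
    unfolding M_commutator_vector sumg .
  moreover have "cdot g (\<chi> i. \<i> * (cnj a - g $ i)) = \<i> * (cnj a * a - cdot g g)"
    by (simp add: cdot_def a_def sum_distrib_left sum_distrib_right sum_subtractf algebra_simps)
  ultimately have "cnj a * a = cdot g g"
    by simp
  then have "complex_of_real ((cmod a)\<^sup>2) = of_real S\<^sub>2"
    unfolding cgg complex_norm_square by (simp add: mult.commute)
  then have a: "(cmod a)\<^sup>2 = S\<^sub>2"
    by (simp only: of_real_eq_iff)
  \<comment> \<open>Insert (M - x) r = 1 and move M - x onto g: this links g to r_m, and so to
    q.\<close>
  have "a = cdot g (?A *v r t x)"
    by (simp add: a_def R_def matrix_inv_vector invertible_M)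
  also have "\<dots> = (1 - \<i> * of_real (\<rho> * S\<^sub>1)) * r t x $ m"
    unfolding cdot_adj[of g ?A] adjA cdot_axis by simp
  finally have "S\<^sub>2 = (cmod (1 - \<i> * of_real (\<rho> * S\<^sub>1)))\<^sup>2 * (cmod (r t x $ m))\<^sup>2"
    unfolding a[symmetric] by (simp add: norm_mult power_mult_distrib)
  also have "(cmod (1 - \<i> * of_real (\<rho> * S\<^sub>1)))\<^sup>2 = 1 + \<rho>\<^sup>2 * S\<^sub>1\<^sup>2"
    by (simp add: cmod_power2 power_mult_distrib)
  finally have "S\<^sub>2 = (1 + \<rho>\<^sup>2 * S\<^sub>1\<^sup>2) * (cmod (r t x $ m))\<^sup>2" .
  moreover have "0 < 1 + \<rho>\<^sup>2 * S\<^sub>1\<^sup>2"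
    by (intro add_pos_nonneg) auto
  ultimately have "(cmod (r t x $ m))\<^sup>2 = S\<^sub>2 / (1 + \<rho>\<^sup>2 * S\<^sub>1\<^sup>2)"
    by (simp add: field_simps)
  then show ?thesis
    by (simp add: multisoliton_eq norm_mult power_mult_distrib cmod_amp)
qed

end

lemma multisoliton_L2: "multisoliton l m \<rho> \<gamma> \<phi> t \<in> L2_space"
  using multisoliton_continuous_into_H1_plus[of \<phi>]
  unfolding continuous_into_H1_plus_def H1_plus_def H1_space_def by blast

end

text \<open>The bound of \<open>concentration\<close> at r = \<epsilon>^(1/4). The radius must tend
  to 0 while \<epsilon> / r^2 does as well; with this choice \<epsilon> / r = r^3 and \<epsilon> /
  r^2 = r^2.\<close>

definition concentration_bound :: "nat \<Rightarrow> real \<Rightarrow> real \<Rightarrow> real \<Rightarrow> real" where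
  "concentration_bound n S \<Lambda> \<epsilon> = (let r = sqrt (sqrt \<epsilon>) in
     real n * (\<Lambda> * (2 * pi * r + 4 * r ^ 4) + S * (4 * r ^ 3))
       + S * (2 * (r ^ 4 + r\<^sup>2) * pi))"

lemma concentration_bound_tendsto: "(concentration_bound n S \<Lambda> \<longlongrightarrow> 0) (at_right 0)"
proof -
  have "((\<lambda>\<epsilon>::real. sqrt (sqrt \<epsilon>)) \<longlongrightarrow> sqrt (sqrt 0)) (at_right 0)"
    by (intro tendsto_intros)
  then have r: "((\<lambda>\<epsilon>::real. sqrt (sqrt \<epsilon>)) \<longlongrightarrow> 0) (at_right 0)"
    by simp
  show ?thesis
  proof -
    define f where "f r = real n * (\<Lambda> * (2 * pi * r + 4 * r ^ 4) + S * (4 * r ^ 3))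
       + S * (2 * (r ^ 4 + r\<^sup>2) * pi)" for r
    have "isCont f 0"
      unfolding f_def[abs_def] by (intro continuous_intros)
    then have "((\<lambda>\<epsilon>. f (sqrt (sqrt \<epsilon>))) \<longlongrightarrow> f 0) (at_right 0)"
      using r by (rule isCont_tendsto_compose)
    then show ?thesis
      by (simp add: f_def concentration_bound_def[abs_def] Let_def)
  qed
qed

lemma orthonormal_eigenvectors_distinct:
  fixes A :: "complex^'n^'n" and y :: "'n \<Rightarrow> real"
  assumes A: "adj A = A" and y: "inj y"
    and ex: "\<And>j. \<exists>w. w \<noteq> 0 \<and> A *v w = (\<chi> i. of_real (y j) * w $ i)"
  obtains u where "\<And>j k. cdot (u j) (u k) = (if j = k then 1 else 0)"
    "\<And>j. A *v u j = complex_of_real (y j) *s u j"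
proof -
  obtain w where w: "\<And>j. w j \<noteq> 0" "\<And>j. A *v w j = (\<chi> i. of_real (y j) * w j $ i)"
    using ex by metis
  define u where "u j = (1 / norm (w j)) *\<^sub>R w j" for j
  have eig: "A *v u j = complex_of_real (y j) *s u j" for j
    by (simp add: u_def matrix_vector_scaleR w(2) vec_eq_iff)
  have "cdot (u j) (u k) = 0" if "j \<noteq> k" for j k
  proof -
    have "of_real (y k) * cdot (u j) (u k) = cdot (u j) (A *v u k)"
      by (simp add: eig cdot_simps)
    also have "\<dots> = of_real (y j) * cdot (u j) (u k)"
      unfolding cdot_adj A unfolding eig by (simp add: cdot_simps)
    finally have "of_real (y k) * cdot (u j) (u k) = of_real (y j) * cdot (u j) (u k)" .
    moreover have "y k \<noteq> y j"
      using y that by (auto dest: injD)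
    ultimately show ?thesis
      by simp
  qed
  moreover have "cdot (u j) (u j) = 1" for j
    using w(1)[of j] by (simp add: cdot_self u_def)
  ultimately show thesis
    using eig by (intro that[of u]) auto
qed

lemma multisoliton_concentration:
  fixes \<kappa> \<gamma> :: "real^'n" and \<phi> :: "real \<Rightarrow> complex" and y :: "'n \<Rightarrow> real"
  assumes inj: "inj (($) \<kappa>)" and eps: "0 < \<epsilon>"
    and gap: "\<And>j k. j \<noteq> k \<Longrightarrow> 2 * sqrt (sqrt \<epsilon>) \<le> \<bar>y j - y k\<bar>"
    and ex: "\<And>j. \<exists>w. w \<noteq> 0 \<and> scattering_matrix \<kappa> \<gamma> t *v w = (\<chi> i. of_real (y j) * w $ i)"
    and bound: "\<And>x. cmod (\<phi> x) \<le> S" and lip: "\<And>x x'. cmod (\<phi> x - \<phi> x') \<le> \<Lambda> * \<bar>x - x'\<bar>" and "0 \<le> \<Lambda>"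
  shows "cmod ((LINT x|lborel. of_real ((cmod (multisoliton (\<chi> i. \<kappa> $ i - \<kappa> $ m) m \<epsilon> \<gamma> \<phi>\<^sub>0 t x))\<^sup>2) * \<phi> x)
       - of_real (2 * pi) * (\<Sum>j\<in>UNIV. \<phi> (y j - 2 * \<kappa> $ m * t))) \<le> concentration_bound CARD('n) S \<Lambda> \<epsilon>"
proof -
  let ?l = "\<chi> i. \<kappa> $ i - \<kappa> $ m"
  interpret soliton ?l m \<epsilon> \<gamma>
    using inj eps by unfold_locales (auto simp: inj_def)
  define r where "r = sqrt (sqrt \<epsilon>)"
  have r: "0 < r" "r ^ 4 = \<epsilon>"
  proof -
    show "0 < r" using eps by (simp add: r_def)
    have "r ^ 4 = (r\<^sup>2)\<^sup>2" by simp
    also have "\<dots> = \<epsilon>" using eps by (simp add: r_def del: power2_eq_square)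
    finally show "r ^ 4 = \<epsilon>" .
  qed
  have herm: "adj (scattering_matrix \<kappa> \<gamma> t) = scattering_matrix \<kappa> \<gamma> t"
    by (simp add: adj_def scattering_matrix_def vec_eq_iff) (metis minus_diff_eq divide_minus_left divide_minus_right)
  have "inj y"
  proof (rule injI, rule ccontr)
    fix j k assume "y j = y k" "j \<noteq> k"
    then show False using gap[of j k] r(1) by (simp add: r_def)
  qed
  from orthonormal_eigenvectors_distinct[OF herm this ex]
  obtain u where orth: "\<And>j k. cdot (u j) (u k) = (if j = k then 1 else 0)"
    and eig: "\<And>j. scattering_matrix \<kappa> \<gamma> t *v u j = complex_of_real (y j) *s u j"
    by blast
  \<comment> \<open>The positions after the boost. Off-diagonal entries depend only on differences
    of \<kappa>, so the boost merely subtracts a scalar matrix and keeps the eigenvectors.\<close>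
  define z where "z j = y j - 2 * \<kappa> $ m * t" for j
  have eig': "(M t *v u j) $ i = of_real (z j) * u j $ i - (if i = m then \<i> * of_real \<epsilon> * u j $ m else 0)" for i j
  proof -
    have "M t $ i $ k = scattering_matrix \<kappa> \<gamma> t $ i $ k
        - (if k = i then of_real (2 * \<kappa> $ m * t) + (if i = m then \<i> * of_real \<epsilon> else 0) else 0)" for k
      unfolding M_entry by (auto simp: scattering_matrix_def algebra_simps)
    then have "(M t *v u j) $ i = (scattering_matrix \<kappa> \<gamma> t *v u j) $ i
        - (of_real (2 * \<kappa> $ m * t) + (if i = m then \<i> * of_real \<epsilon> else 0)) * u j $ i"
      by (simp add: matrix_vector_mult_def left_diff_distrib sum_subtractf if_distrib[of "\<lambda>x. x * _"] cong: if_cong)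
    then show ?thesis
      unfolding eig by (cases "i = m") (simp_all add: z_def algebra_simps)
  qed
  interpret poles: weighted_poles z "\<lambda>j. (cmod (u j $ m))\<^sup>2" r \<epsilon>
  proof
    show "0 < (cmod (u j $ m))\<^sup>2" for j
      by (rule weight_pos[OF orth eig'])
    show "(\<Sum>j\<in>UNIV. (cmod (u j $ m))\<^sup>2) = 1"
      by (rule weight_sum[OF orth eig'])
    show "0 < r" "0 < \<epsilon>" by fact+
    show "2 * r \<le> \<bar>z j - z k\<bar>" if "j \<noteq> k" for j k
      using gap[OF that] by (simp add: z_def r_def)
  qed
  let ?w = "\<lambda>x. (cmod (multisoliton ?l m \<epsilon> \<gamma> \<phi>\<^sub>0 t x))\<^sup>2"
  have cont: "continuous_on UNIV \<phi>"
    unfolding continuous_on_iff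
  proof (intro ballI allI impI)
    fix x e :: real assume "0 < e"
    have "dist (\<phi> x') (\<phi> x) < e" if "dist x' x < e / (\<Lambda> + 1)" for x'
    proof -
      have "dist (\<phi> x') (\<phi> x) \<le> (\<Lambda> + 1) * dist x' x"
        using lip[of x' x] by (simp add: dist_norm distrib_right add_increasing2)
      also have "\<dots> < e"
        using that \<open>0 \<le> \<Lambda>\<close> by (simp add: less_divide_eq mult.commute)
      finally show ?thesis .
    qed
    then show "\<exists>d>0. \<forall>x'\<in>UNIV. dist x' x < d \<longrightarrow> dist (\<phi> x') (\<phi> x) < e"
      using \<open>0 < e\<close> \<open>0 \<le> \<Lambda>\<close> by (intro exI[of _ "e / (\<Lambda> + 1)"]) auto
  qed
  have "cmod ((LINT x|lborel. of_real (?w x) * \<phi> x) - of_real (2 * pi) * (\<Sum>j\<in>UNIV. \<phi> (z j)))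
    \<le> real CARD('n) * (\<Lambda> * r * (2 * pi + 4 * \<epsilon> / r) + S * (4 * \<epsilon> / r))
      + S * (2 * \<epsilon> * (1 + 1 / r\<^sup>2) * pi)"
  proof (rule poles.concentration[OF _ _ _ bound lip \<open>0 \<le> \<Lambda>\<close> cont])
    show "integrable lborel ?w"
      using multisoliton_L2 by (simp add: L2_space_def)
    show "?w x = poles.F x" if "x \<notin> range z" for x
      unfolding density_formula[OF orth eig' that] poles.F_def poles.S\<^sub>1_def poles.S\<^sub>2_def ..
  qed simp
  also have "\<dots> = concentration_bound CARD('n) S \<Lambda> \<epsilon>"
  proof -
    have e1: "4 * \<epsilon> / r = 4 * r ^ 3"
      using r by (simp add: field_simps power2_eq_square eval_nat_numeral)
    have e2: "2 * \<epsilon> * (1 + 1 / r\<^sup>2) = 2 * (r ^ 4 + r\<^sup>2)"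
      using r by (auto simp: field_simps power2_eq_square eval_nat_numeral)
    have e3: "\<Lambda> * r * (2 * pi + 4 * r ^ 3) = \<Lambda> * (2 * pi * r + 4 * r ^ 4)"
      by (simp add: algebra_simps eval_nat_numeral)
    show ?thesis
      unfolding concentration_bound_def Let_def r_def[symmetric] e1 e2 e3 ..
  qed
  finally show ?thesis
    by (simp add: z_def)
qed

section \<open>The bounded-Lipschitz distance and the conclusion\<close>

lemma integral_dirac_comb:
  fixes f :: "real \<Rightarrow> real" and y :: "real^'n"
  assumes [measurable]: "f \<in> borel_measurable borel"
  shows "(LINT x|dirac_comb y. f x) = 2 * pi * (\<Sum>j\<in>UNIV. f (y $ j))"
proof -
  let ?D = "distr (count_space UNIV) borel (($) y)"
  have "dirac_comb y = density ?D (\<lambda>_. ennreal (2 * pi))"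
    unfolding dirac_comb_def
  proof (rule measure_eqI)
    fix A assume A: "A \<in> sets (scale_measure (ennreal (2 * pi)) ?D)"
    then show "emeasure (scale_measure (ennreal (2 * pi)) ?D) A = emeasure (density ?D (\<lambda>_. ennreal (2 * pi))) A"
      by (subst emeasure_density_const) auto
  qed simp
  also have "(LINT x|density ?D (\<lambda>_. ennreal (2 * pi)). f x) = (LINT x|?D. 2 * pi * f x)"
    by (subst integral_density) auto
  also have "\<dots> = 2 * pi * (LINT x|?D. f x)"
    by simp
  also have "(LINT x|?D. f x) = (\<Sum>j\<in>UNIV. f (y $ j))"
    by (subst integral_distr) (auto simp: lebesgue_integral_count_space_finite)
  finally show ?thesis .
qed

lemma test_function_bounded_lipschitz:
  assumes "test_function \<phi>"
  obtains S \<Lambda> where "\<And>x. cmod (\<phi> x) \<le> S" "\<And>x x'. cmod (\<phi> x - \<phi> x') \<le> \<Lambda> * \<bar>x - x'\<bar>" "0 \<le> \<Lambda>"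
proof -
  have sm: "smooth \<phi>" using assms by (simp add: test_function_def)
  note d = smooth_derivative[OF sm]
  let ?d = "\<lambda>x. vector_derivative \<phi> (at x)"
  obtain a where a: "0 < a" "\<And>x. a \<le> \<bar>x\<bar> \<Longrightarrow> \<phi> x = 0" "\<And>x. a \<le> \<bar>x\<bar> \<Longrightarrow> ?d x = 0"
    using test_function_support[OF assms] by blast
  have bounded: "\<exists>B\<ge>0. \<forall>x. cmod (f x) \<le> B" if "continuous_on UNIV f" "\<And>x. a \<le> \<bar>x\<bar> \<Longrightarrow> f x = 0" for f :: "real \<Rightarrow> complex"
  proof -
    have "compact (f ` {-a..a})"
      by (intro compact_continuous_image continuous_on_subset[OF that(1)]) auto
    then obtain B where B: "\<And>x. x \<in> {-a..a} \<Longrightarrow> cmod (f x) \<le> B"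
      using compact_imp_bounded[of "f ` {-a..a}"] unfolding bounded_iff by blast
    show ?thesis
    proof (intro exI[of _ "\<bar>B\<bar>"] conjI allI)
      fix x
      show "cmod (f x) \<le> \<bar>B\<bar>"
      proof (cases "a \<le> \<bar>x\<bar>")
        case False
        then have "x \<in> {-a..a}" by auto
        from B[OF this] show ?thesis by simp
      qed (simp add: that(2))
    qed simp
  qed
  have "continuous_on UNIV \<phi>"
    by (rule continuous_on_of_derivative[OF d(1)])
  then obtain S where S: "\<And>x. cmod (\<phi> x) \<le> S"
    using bounded[of \<phi>] a(2) by blast
  obtain \<Lambda> where \<Lambda>: "0 \<le> \<Lambda>" "\<And>x. cmod (?d x) \<le> \<Lambda>"
    using bounded[OF d(2)] a(3) by blast
  have "cmod (\<phi> x - \<phi> x') \<le> \<Lambda> * \<bar>x - x'\<bar>" for x x'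
  proof -
    have "norm (\<phi> x - \<phi> x') \<le> \<Lambda> * norm (x - x')"
    proof (rule differentiable_bound[of UNIV \<phi> "\<lambda>x h. h *\<^sub>R ?d x"])
      show "(\<phi> has_derivative (\<lambda>h. h *\<^sub>R ?d x)) (at x within UNIV)" for x
        using d(1)[of x] by (simp add: has_vector_derivative_def)
      show "onorm (\<lambda>h. h *\<^sub>R ?d x) \<le> \<Lambda>" for x
      proof (rule onorm_le)
        show "norm (h *\<^sub>R ?d x) \<le> \<Lambda> * norm h" for h
          using mult_left_mono[OF \<Lambda>(2)[of x], of "norm h"] by (simp add: mult.commute)
      qed
    qed auto
    then show ?thesis by simp
  qed
  then show thesis
    using S \<Lambda>(1) that by blast
qed

lemma bl_dist_nonneg: "0 \<le> bl_dist \<mu> \<nu>"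
  unfolding bl_dist_def
  by (rule SUP_upper2[of "\<lambda>_. 0"]) (auto intro: lipschitz_onI)

lemma bl_dist_le:
  assumes w: "f \<in> L2_space"
    and bound: "\<And>\<phi> :: real \<Rightarrow> complex. (\<And>x. cmod (\<phi> x) \<le> 1) \<Longrightarrow> (\<And>x x'. cmod (\<phi> x - \<phi> x') \<le> 1 * \<bar>x - x'\<bar>) \<Longrightarrow>
      cmod ((LINT x|lborel. of_real ((cmod (f x))\<^sup>2) * \<phi> x) - of_real (2 * pi) * (\<Sum>j\<in>UNIV. \<phi> (y $ j))) \<le> B"
  shows "bl_dist (density_measure f) (dirac_comb y) \<le> ereal B"
  unfolding bl_dist_def
proof (rule SUP_least)
  fix \<phi> :: "real \<Rightarrow> real"
  assume "\<phi> \<in> {\<phi>. (\<forall>x. \<bar>\<phi> x\<bar> \<le> 1) \<and> 1-lipschitz_on UNIV \<phi>}"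
  then have \<phi>: "\<And>x. \<bar>\<phi> x\<bar> \<le> 1" "1-lipschitz_on UNIV \<phi>" by auto
  have [measurable]: "\<phi> \<in> borel_measurable borel"
    by (intro borel_measurable_continuous_onI lipschitz_on_continuous_on[OF \<phi>(2)])
  have [measurable]: "f \<in> borel_measurable borel"
    using w by (rule L2_space_measurable)
  have "(LINT x|density_measure f. \<phi> x) = (LINT x|lborel. (cmod (f x))\<^sup>2 * \<phi> x)"
    unfolding density_measure_def by (subst integral_density) auto
  then have "complex_of_real ((LINT x|density_measure f. \<phi> x) - (LINT x|dirac_comb y. \<phi> x))
      = (LINT x|lborel. of_real ((cmod (f x))\<^sup>2) * of_real (\<phi> x)) - of_real (2 * pi) * (\<Sum>j\<in>UNIV. of_real (\<phi> (y $ j)))"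
    by (simp add: integral_dirac_comb integral_complex_of_real[symmetric])
  moreover have "cmod ((LINT x|lborel. of_real ((cmod (f x))\<^sup>2) * of_real (\<phi> x)) - of_real (2 * pi) * (\<Sum>j\<in>UNIV. of_real (\<phi> (y $ j)))) \<le> B"
  proof (rule bound)
    show "cmod (of_real (\<phi> x)) \<le> 1" for x
      using \<phi>(1) by simp
    show "cmod (of_real (\<phi> x) - of_real (\<phi> x')) \<le> 1 * \<bar>x - x'\<bar>" for x x'
      using lipschitz_onD[OF \<phi>(2), of x x'] by (simp add: dist_real_def of_real_diff[symmetric] del: of_real_diff)
  qed
  ultimately have "cmod (complex_of_real ((LINT x|density_measure f. \<phi> x) - (LINT x|dirac_comb y. \<phi> x))) \<le> B"
    by simp
  then show "ereal ((LINT x|density_measure f. \<phi> x) - (LINT x|dirac_comb y. \<phi> x)) \<le> ereal B"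
    unfolding norm_of_real by simp
qed

theorem theorem1p1:
  fixes x :: "real \<Rightarrow> real ^ 'n"
  assumes "calogero_moser_solution x"
  shows "\<exists>(c::real) (\<epsilon>\<^sub>0::real) (q :: real \<Rightarrow> real \<Rightarrow> real \<Rightarrow> complex).
    \<epsilon>\<^sub>0 > 0 \<and>
    (\<forall>\<epsilon>\<in>{0<..<\<epsilon>\<^sub>0}.
       q \<epsilon> \<in> rational_multisolitons TYPE('n) \<and>
       continuous_into_H1_plus (q \<epsilon>) \<and>
       ccm_solution (q \<epsilon>)) \<and>
    ((\<lambda>\<epsilon>. SUP t. bl_dist (density_measure (q \<epsilon> t)) (dirac_comb (\<chi> j. x t $ j - c * t)))
       \<longlongrightarrow> 0) (at_right 0) \<and>
    (\<forall>\<phi>. test_function \<phi> \<longrightarrow>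
       uniform_limit UNIV
         (\<lambda>\<epsilon> t. LINT y|lborel. of_real ((cmod (q \<epsilon> t y))\<^sup>2) * \<phi> y)
         (\<lambda>t. of_real (2 * pi) * (\<Sum>j\<in>UNIV. \<phi> (x t $ j - c * t)))
         (at_right 0))"
proof -
  obtain v where distinct: "\<And>t j k. j \<noteq> k \<Longrightarrow> x t $ j \<noteq> x t $ k"
    and v: "\<And>t. (x has_vector_derivative v t) (at t)"
      "\<And>t. (v has_vector_derivative (\<chi> j. \<Sum>k\<in>UNIV - {j}. 8 / (x t $ j - x t $ k) ^ 3)) (at t)"
    using assms unfolding calogero_moser_solution_def by blast
  interpret calogero_moser x v
    by unfold_locales (use distinct v in auto)
  obtain \<kappa> \<gamma> :: "real^'n" where inj: "inj (($) \<kappa>)"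
    and eig: "\<And>s j. \<exists>w. w \<noteq> 0 \<and> scattering_matrix \<kappa> \<gamma> s *v w = (\<chi> i. of_real (x s $ j) * w $ i)"
    using scattering_normal_form by blast
  obtain \<delta> where \<delta>: "0 < \<delta>" "\<And>t j k. j \<noteq> k \<Longrightarrow> \<delta> \<le> \<bar>x t $ j - x t $ k\<bar>"
    using uniform_gap by blast
  \<comment> \<open>Any index can serve as the damped one; the choice fixes the boost speed
    c.\<close>
  define m :: 'n where "m = undefined"
  define l :: "real^'n" where "l = (\<chi> i. \<kappa> $ i - \<kappa> $ m)"
  define c where "c = 2 * \<kappa> $ m"
  \<comment> \<open>Chosen so that the radius \<epsilon>^(1/4) is at most half of the gap
    \<delta>.\<close>
  define \<epsilon>\<^sub>0 where "\<epsilon>\<^sub>0 = (\<delta> / 2) ^ 4"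
  define q where "q \<epsilon> = multisoliton l m \<epsilon> \<gamma> 0" for \<epsilon>
  have \<epsilon>\<^sub>0: "0 < \<epsilon>\<^sub>0" using \<delta>(1) by (simp add: \<epsilon>\<^sub>0_def)
  have sol: "soliton l m \<epsilon>" if "0 < \<epsilon>" for \<epsilon>
    using inj that by unfold_locales (auto simp: inj_def l_def)
  have conc: "cmod ((LINT y|lborel. of_real ((cmod (q \<epsilon> t y))\<^sup>2) * \<phi> y) - of_real (2 * pi) * (\<Sum>j\<in>UNIV. \<phi> (x t $ j - c * t)))
      \<le> concentration_bound CARD('n) S \<Lambda> \<epsilon>"
    if \<epsilon>: "\<epsilon> \<in> {0<..<\<epsilon>\<^sub>0}"
      and "\<And>x. cmod (\<phi> x) \<le> S" "\<And>x x'. cmod (\<phi> x - \<phi> x') \<le> \<Lambda> * \<bar>x - x'\<bar>" "0 \<le> \<Lambda>"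
    for \<epsilon> t S \<Lambda> and \<phi> :: "real \<Rightarrow> complex"
    unfolding q_def l_def c_def
  proof (rule multisoliton_concentration[OF inj _ _ eig that(2-4)])
    show "0 < \<epsilon>" using \<epsilon> by simp
    have "sqrt (sqrt \<epsilon>) \<le> sqrt (sqrt ((\<delta> / 2) ^ 4))"
      using \<epsilon> by (simp add: \<epsilon>\<^sub>0_def)
    also have "(\<delta> / 2) ^ 4 = ((\<delta> / 2)\<^sup>2)\<^sup>2"
      by simp
    also have "sqrt (sqrt (((\<delta> / 2)\<^sup>2)\<^sup>2)) = \<delta> / 2"
      using \<delta>(1) by (simp only: real_sqrt_abs abs_power2)
    finally show "2 * sqrt (sqrt \<epsilon>) \<le> \<bar>x t $ j - x t $ k\<bar>" if "j \<noteq> k" for j k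
      using \<delta>(2)[OF that, of t] by linarith
  qed
  have near: "\<forall>\<^sub>F \<epsilon> in at_right 0. \<epsilon> \<in> {0<..<\<epsilon>\<^sub>0}"
    using eventually_at_right_real[OF \<epsilon>\<^sub>0] .
  show ?thesis
  proof (rule exI[of _ c], rule exI[of _ \<epsilon>\<^sub>0], rule exI[of _ q], intro conjI ballI allI impI)
    show "0 < \<epsilon>\<^sub>0" by fact
    fix \<epsilon> assume "\<epsilon> \<in> {0<..<\<epsilon>\<^sub>0}"
    then have "soliton l m \<epsilon>" by (intro sol) simp
    then interpret s: soliton l m \<epsilon> \<gamma> .
    show "q \<epsilon> \<in> rational_multisolitons TYPE('n)"
      unfolding rational_multisolitons_def q_def using s.inj s.lm s.rho by blast
    show "continuous_into_H1_plus (q \<epsilon>)"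
      unfolding q_def by (rule s.multisoliton_continuous_into_H1_plus)
    show "ccm_solution (q \<epsilon>)"
      unfolding q_def by (rule s.multisoliton_ccm)
  next
    \<comment> \<open>S = \<Lambda> = 1 is the unit ball of the bounded-Lipschitz norm; as the bound
      is free of t it passes to the supremum over time.\<close>
    let ?b = "concentration_bound CARD('n) 1 1"
    have "bl_dist (density_measure (q \<epsilon> t)) (dirac_comb (\<chi> j. x t $ j - c * t)) \<le> ereal (?b \<epsilon>)"
      if \<epsilon>: "\<epsilon> \<in> {0<..<\<epsilon>\<^sub>0}" for \<epsilon> t
    proof (rule bl_dist_le)
      interpret s: soliton l m \<epsilon> \<gamma>
        using \<epsilon> by (intro sol) simp
      show "q \<epsilon> t \<in> L2_space"
        unfolding q_def by (rule s.multisoliton_L2)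
    qed (use conc[OF \<epsilon>, of _ 1 1 t] in simp)
    then have upper: "\<forall>\<^sub>F \<epsilon> in at_right 0. (SUP t. bl_dist (density_measure (q \<epsilon> t)) (dirac_comb (\<chi> j. x t $ j - c * t))) \<le> ereal (?b \<epsilon>)"
      using near by (auto elim!: eventually_mono intro: SUP_least)
    have lower: "\<forall>\<^sub>F \<epsilon> in at_right 0. 0 \<le> (SUP t. bl_dist (density_measure (q \<epsilon> t)) (dirac_comb (\<chi> j. x t $ j - c * t)))"
      by (intro always_eventually allI SUP_upper2[of 0]) (auto intro: bl_dist_nonneg)
    have "((\<lambda>\<epsilon>. ereal (?b \<epsilon>)) \<longlongrightarrow> 0) (at_right 0)"
      using tendsto_ereal[OF concentration_bound_tendsto] by (simp add: zero_ereal_def)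
    then show "((\<lambda>\<epsilon>. SUP t. bl_dist (density_measure (q \<epsilon> t)) (dirac_comb (\<chi> j. x t $ j - c * t))) \<longlongrightarrow> 0) (at_right 0)"
      by (rule tendsto_sandwich[OF lower upper tendsto_const])
  next
    fix \<phi> :: "real \<Rightarrow> complex" assume "test_function \<phi>"
    then obtain S \<Lambda> where \<phi>: "\<And>x. cmod (\<phi> x) \<le> S" "\<And>x x'. cmod (\<phi> x - \<phi> x') \<le> \<Lambda> * \<bar>x - x'\<bar>" "0 \<le> \<Lambda>"
      using test_function_bounded_lipschitz by blast
    show "uniform_limit UNIV (\<lambda>\<epsilon> t. LINT y|lborel. of_real ((cmod (q \<epsilon> t y))\<^sup>2) * \<phi> y)
         (\<lambda>t. of_real (2 * pi) * (\<Sum>j\<in>UNIV. \<phi> (x t $ j - c * t))) (at_right 0)"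
    proof (rule uniform_limitI)
      fix e :: real assume "0 < e"
      then have "\<forall>\<^sub>F \<epsilon> in at_right 0. concentration_bound CARD('n) S \<Lambda> \<epsilon> < e"
        by (rule order_tendstoD(2)[OF concentration_bound_tendsto])
      then show "\<forall>\<^sub>F \<epsilon> in at_right 0. \<forall>t\<in>UNIV. dist (LINT y|lborel. of_real ((cmod (q \<epsilon> t y))\<^sup>2) * \<phi> y)
          (of_real (2 * pi) * (\<Sum>j\<in>UNIV. \<phi> (x t $ j - c * t))) < e"
        using near
      proof eventually_elim
        case (elim \<epsilon>)
        show ?case
          unfolding dist_norm using conc[OF elim(2) \<phi>] elim(1) by (blast intro: le_less_trans)
      qed
    qed
  qed
qed

end
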